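(* Let $n\geq 2$, $1\leq p\leq\infty$, $0<s<1$ with $sp\geq n$, and $1\leq r<q<\infty$. Let $K,V:\mathbf{R}^n\to\mathbf{R}$ be two positive Lebesgue measurable functions such that $K\in L^t_{loc}(\mathbf{R}^n)$ for some $t\in(1,\infty]$, such that $\inf_{\mathbf{R}^n}V\geq V_0>0$ for some constant $V_0$, and such that $K^{\psi_{\tilde q}(\tau)}V^{-\tau}\in L^1(\mathbf{R}^n)$ for some $\tilde q\in(q,\infty)$ and some $\tau\in\bigl(0,\frac{r}{q-r}\bigr]$, where $\psi_{\tilde q}(\tau):=\frac{\tilde q+\tau(\tilde q-q)}{\tilde q-r}$. Then the embedding $M^{s;q,p}_{\mathrm V}(\mathbf{R}^n)\to L^r_{\mathrm K}(\mathbf{R}^n)$ is compact.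
   Context: When $sp\geq n$ (and $V\geq V_0>0$), $M^{s;q,p}_{\mathrm V}(\mathbf{R}^n)$ is the Banach space obtained as the completion of (the functions of finite norm in) $C^1_c(\mathbf{R}^n)$ with respect to the norm $$\|u\|_{M^{s;q,p}_{\mathrm V}(\mathbf{R}^n)}:=\Bigl(\int_{\mathbf{R}^n}|u|^qV\,dx\Bigr)^{1/q}+[u]_{s,p,\mathbf{R}^n},$$ where $[u]^p_{s,p,\mathbf{R}^n}:=\int_{\mathbf{R}^n}\int_{\mathbf{R}^n}\frac{|u(x)-u(y)|^p}{|x-y|^{n+sp}}\,dx\,dy$ for $p<\infty$ and $[u]_{s,\infty,\mathbf{R}^n}:=\sup_{x\neq y}\frac{|u(x)-u(y)|}{|x-y|^s}$; it is a subspace of $M^{s;q,p}(\mathbf{R}^n)$, which is the same completion with $V\equiv 1$. $L^r_{\mathrm K}(\mathbf{R}^n)$ is the weighted Lebesgue space with norm $\bigl(\int_{\mathbf{R}^n}|u|^rK\,dx\bigr)^{1/r}$. *)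

theory Defs
  imports "HOL-Analysis.Analysis"
begin

(* Powers of extended nonnegative reals, only used with a positive exponent. *)

definition enn_powr :: "ennreal \<Rightarrow> real \<Rightarrow> ennreal" where
  "enn_powr x a = (if x = \<infinity> then \<infinity> else ennreal (enn2real x powr a))"

definition C1c :: "(real^'n \<Rightarrow> real) set" where
  "C1c = {u. (\<exists>u' :: real^'n \<Rightarrow> (real^'n) \<Rightarrow>\<^sub>L real.
                (\<forall>x. (u has_derivative blinfun_apply (u' x)) (at x)) \<and> continuous_on UNIV u')
             \<and> compact (closure {x. u x \<noteq> 0})}"

(* For t = \<infinity> this is local essential boundedness. *)

definition Lt_loc :: "ennreal \<Rightarrow> (real^'n \<Rightarrow> real) set" where
  "Lt_loc t = {f \<in> borel_measurable lebesgue. \<forall>B. compact B \<longrightarrow>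
     (if t = \<infinity> then \<exists>C. AE x in lebesgue. x \<in> B \<longrightarrow> \<bar>f x\<bar> \<le> C
      else set_integrable lebesgue B (\<lambda>x. \<bar>f x\<bar> powr enn2real t))}"

definition weighted_norm :: "real \<Rightarrow> (real^'n \<Rightarrow> real) \<Rightarrow> (real^'n \<Rightarrow> real) \<Rightarrow> ennreal" where
  "weighted_norm r K u =
     enn_powr (\<integral>\<^sup>+x. ennreal (\<bar>u x\<bar> powr r * K x) \<partial>lebesgue) (1 / r)"

(* In the double integral the integrand is 0 on the diagonal, since 0 / 0 = 0. *)

definition gagliardo_seminorm :: "real \<Rightarrow> ennreal \<Rightarrow> (real^'n \<Rightarrow> real) \<Rightarrow> ennreal" where
  "gagliardo_seminorm s p u =
     (if p = \<infinity>
      then (SUP (x, y) \<in> {(x, y). x \<noteq> y}. ennreal (\<bar>u x - u y\<bar> / norm (x - y) powr s))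
      else enn_powr
             (\<integral>\<^sup>+x. \<integral>\<^sup>+y. ennreal (\<bar>u x - u y\<bar> powr enn2real p /
                    norm (x - y) powr (real CARD('n) + s * enn2real p)) \<partial>lebesgue \<partial>lebesgue)
             (1 / enn2real p))"

definition M_norm :: "real \<Rightarrow> real \<Rightarrow> ennreal \<Rightarrow> (real^'n \<Rightarrow> real) \<Rightarrow> (real^'n \<Rightarrow> real) \<Rightarrow> ennreal" where
  "M_norm s q p V u = weighted_norm q V u + gagliardo_seminorm s p u"

definition M_test :: "real \<Rightarrow> real \<Rightarrow> ennreal \<Rightarrow> (real^'n \<Rightarrow> real) \<Rightarrow> (real^'n \<Rightarrow> real) set" where
  "M_test s q p V = {u \<in> C1c. M_norm s q p V u < \<infinity>}"

(* The completion of M_test: Cauchy sequences modulo sequences of norm tending to 0. *)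

definition M_cauchy ::
  "real \<Rightarrow> real \<Rightarrow> ennreal \<Rightarrow> (real^'n \<Rightarrow> real) \<Rightarrow> (nat \<Rightarrow> real^'n \<Rightarrow> real) set" where
  "M_cauchy s q p V = {\<phi>. (\<forall>k. \<phi> k \<in> M_test s q p V) \<and>
     (\<forall>e>0. \<exists>N. \<forall>i\<ge>N. \<forall>j\<ge>N. M_norm s q p V (\<lambda>x. \<phi> i x - \<phi> j x) < e)}"

definition M_rel ::
  "real \<Rightarrow> real \<Rightarrow> ennreal \<Rightarrow> (real^'n \<Rightarrow> real) \<Rightarrow> (nat \<Rightarrow> real^'n \<Rightarrow> real) rel" where
  "M_rel s q p V = {(\<phi>, \<eta>). \<phi> \<in> M_cauchy s q p V \<and> \<eta> \<in> M_cauchy s q p V \<and>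
     (\<lambda>k. M_norm s q p V (\<lambda>x. \<phi> k x - \<eta> k x)) \<longlonglongrightarrow> 0}"

definition M_space ::
  "real \<Rightarrow> real \<Rightarrow> ennreal \<Rightarrow> (real^'n \<Rightarrow> real) \<Rightarrow> (nat \<Rightarrow> real^'n \<Rightarrow> real) set set" where
  "M_space s q p V = M_cauchy s q p V // M_rel s q p V"

definition M_space_norm ::
  "real \<Rightarrow> real \<Rightarrow> ennreal \<Rightarrow> (real^'n \<Rightarrow> real) \<Rightarrow> (nat \<Rightarrow> real^'n \<Rightarrow> real) set \<Rightarrow> ennreal" where
  "M_space_norm s q p V U = lim (\<lambda>k. M_norm s q p V ((SOME \<phi>. \<phi> \<in> U) k))"

(* The linear combination a U + b W of two elements of the completion. *)

definition M_space_lincomb ::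
  "real \<Rightarrow> real \<Rightarrow> ennreal \<Rightarrow> (real^'n \<Rightarrow> real) \<Rightarrow>
   real \<Rightarrow> (nat \<Rightarrow> real^'n \<Rightarrow> real) set \<Rightarrow> real \<Rightarrow> (nat \<Rightarrow> real^'n \<Rightarrow> real) set \<Rightarrow>
   (nat \<Rightarrow> real^'n \<Rightarrow> real) set" where
  "M_space_lincomb s q p V a U b W =
     (\<Union>\<phi>\<in>U. \<Union>\<eta>\<in>W. M_rel s q p V `` {\<lambda>k x. a * \<phi> k x + b * \<eta> k x})"

(* The weighted Lebesgue space, as a set of classes of functions modulo equality a.e. *)

definition ae_class :: "(real^'n \<Rightarrow> real) \<Rightarrow> (real^'n \<Rightarrow> real) set" where
  "ae_class u = {v \<in> borel_measurable lebesgue. AE x in lebesgue. v x = u x}"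

definition L_space :: "real \<Rightarrow> (real^'n \<Rightarrow> real) \<Rightarrow> (real^'n \<Rightarrow> real) set set" where
  "L_space r K = ae_class ` {u \<in> borel_measurable lebesgue. weighted_norm r K u < \<infinity>}"

definition L_space_norm :: "real \<Rightarrow> (real^'n \<Rightarrow> real) \<Rightarrow> (real^'n \<Rightarrow> real) set \<Rightarrow> ennreal" where
  "L_space_norm r K A = weighted_norm r K (SOME u. u \<in> A)"

definition L_space_lincomb ::
  "real \<Rightarrow> (real^'n \<Rightarrow> real) set \<Rightarrow> real \<Rightarrow> (real^'n \<Rightarrow> real) set \<Rightarrow> (real^'n \<Rightarrow> real) set" where
  "L_space_lincomb a A b B = (\<Union>u\<in>A. \<Union>v\<in>B. ae_class (\<lambda>x. a * u x + b * v x))"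

(* The a.e. class of the function that an element U of the completion stands for. The norm of
   M_test dominates the L^q norm with weight V, so the sequences in U all converge in that norm,
   and to the same function. *)

definition M_function ::
  "real \<Rightarrow> (real^'n \<Rightarrow> real) \<Rightarrow> (nat \<Rightarrow> real^'n \<Rightarrow> real) set \<Rightarrow> (real^'n \<Rightarrow> real) set" where
  "M_function q V U = {u \<in> borel_measurable lebesgue.
     \<forall>\<phi>\<in>U. (\<lambda>k. weighted_norm q V (\<lambda>x. \<phi> k x - u x)) \<longlonglongrightarrow> 0}"

(* The map sending an element of the completion to the function it stands for is a linear,
   injective, bounded map into L_space r K, and the image of every bounded sequence has a
   convergent subsequence. *)

definition M_compactly_embedded ::
  "real \<Rightarrow> real \<Rightarrow> ennreal \<Rightarrow> (real^'n \<Rightarrow> real) \<Rightarrow> real \<Rightarrow> (real^'n \<Rightarrow> real) \<Rightarrow> bool" where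
  "M_compactly_embedded s q p V r K \<longleftrightarrow>
     M_function q V \<in> M_space s q p V \<rightarrow> L_space r K \<and>
     (\<forall>U\<in>M_space s q p V. \<forall>W\<in>M_space s q p V. \<forall>a b.
        M_function q V (M_space_lincomb s q p V a U b W) =
        L_space_lincomb a (M_function q V U) b (M_function q V W)) \<and>
     inj_on (M_function q V) (M_space s q p V) \<and>
     (\<exists>C::real. \<forall>U\<in>M_space s q p V.
        L_space_norm r K (M_function q V U) \<le> ennreal C * M_space_norm s q p V U) \<and>
     (\<forall>U :: nat \<Rightarrow> (nat \<Rightarrow> real^'n \<Rightarrow> real) set.
        (\<forall>k. U k \<in> M_space s q p V) \<and> (\<exists>B::real. \<forall>k. M_space_norm s q p V (U k) \<le> ennreal B) \<longrightarrow>
        (\<exists>\<rho> :: nat \<Rightarrow> nat. \<exists>A\<in>L_space r K. strict_mono \<rho> \<and>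
           (\<lambda>k. L_space_norm r K (L_space_lincomb 1 (M_function q V (U (\<rho> k))) (-1) A))
             \<longlonglongrightarrow> 0))"

definition psi :: "real \<Rightarrow> real \<Rightarrow> real \<Rightarrow> real \<Rightarrow> real" where
  "psi q r q' \<tau> = (q' + \<tau> * (q' - q)) / (q' - r)"

end

theory Submission
  imports Defs "HOL-Complex_Analysis.Great_Picard"
begin

text \<open>With \<open>h x\<close> the inner Gagliardo integral at \<open>x\<close> and \<open>p < \<infinity>\<close>, \<open>g = h powr (1 / p)\<close> controls the oscillation of \<open>u\<close> on every ball
  around \<open>x\<close>, as in a Hajlasz--Sobolev space. Since \<open>s p \<ge> n\<close>, this forces \<open>\<bar>u\<bar>\<close> to grow at most
  logarithmically in \<open>g\<close>, and as \<open>g\<close> lies in \<open>L\<^sup>p\<close>, the space embeds into every \<open>L\<^sup>m\<close> with \<open>m \<ge> q\<close>. The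
  oscillation bound also makes \<open>u\<close> close to its averages over small balls, so that a diagonal sequence
  along which countably many averages converge has an almost everywhere convergent subsequence. Finally
  Hoelder's inequality with \<open>\<bar>u\<bar>\<^sup>q V\<close>, \<open>\<bar>u\<bar> powr q'\<close> and the integrable function
  \<open>W = K powr \<psi> * V powr -\<tau>\<close> shows that \<open>\<bar>u\<bar>\<^sup>r K\<close> is dominated by \<open>W\<close> up to a small multiple of
  bounded quantities, and dominated convergence upgrades almost everywhere convergence to convergence in
  the target norm. Applied to Cauchy sequences of test functions, the same facts identify the elements of
  the completion with functions.\<close>

subsection \<open>Oscillation on balls\<close>

text \<open>The borderline case s p = n shapes the proof: functions in the space need not be bounded
  there, so no sup bound can replace the logarithmic one. The predicate \<open>hajlasz\<close>
  records only what survives in both cases, finite and infinite p, and lets them share every later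
  estimate. Since \<open>osc\<close> is not divided by the volume of the ball, the radius carries
  the exponent n + s in it. The weights are merely measurable and the domain is the whole space;
  what prevents mass from escaping to infinity is the integrability of W, used through a pointwise
  inequality with a small parameter. A limit function is not a test function and its seminorm is
  never estimated: all bounds on u k - f come from bounds on u k - u j by Fatou's lemma in j. The
  same device settles injectivity, where a Cauchy sequence that tends to 0 in the weighted L^q norm
  must be shown to tend to 0 in the seminorm too; for infinite p this rests on the continuity of the
  test functions.\<close>

definition osc :: "('a::euclidean_space \<Rightarrow> real) \<Rightarrow> 'a \<Rightarrow> real \<Rightarrow> ennreal" where
  "osc u x \<delta> = (\<integral>\<^sup>+y. indicator (ball x \<delta>) y * ennreal \<bar>u x - u y\<bar> \<partial>lborel)"

text \<open>Since \<open>g \<ge> 1\<close> is not integrable, only its part above 1 enters the normalization. For an infinite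
  exponent \<open>p\<close> the predicate is used with \<open>g = 1\<close> and \<open>P = n / s\<close>.\<close>

definition hajlasz ::
    "real \<Rightarrow> real \<Rightarrow> real \<Rightarrow> ('a::euclidean_space \<Rightarrow> real) \<Rightarrow> ('a \<Rightarrow> real) \<Rightarrow> bool" where
  "hajlasz s P C u g \<longleftrightarrow> g \<in> borel_measurable borel \<and> (\<forall>x. 1 \<le> g x) \<and>
     (\<integral>\<^sup>+x. indicator {x. 1 < g x} x * ennreal (g x powr P) \<partial>lborel) \<le> 1 \<and>
     (AE x in lborel. \<forall>\<delta>>0. osc u x \<delta> \<le> ennreal (C * \<delta> powr (real DIM('a) + s) * g x))"

lemma nn_integral_indicator_ball:
  fixes x :: "'a::euclidean_space"
  assumes "0 \<le> c" "0 < \<delta>"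
  shows "(\<integral>\<^sup>+y. indicator (ball x \<delta>) y * ennreal c \<partial>lborel) =
    ennreal (c * (unit_ball_vol (real DIM('a)) * \<delta> powr real DIM('a)))"
proof -
  have "(\<integral>\<^sup>+y. indicator (ball x \<delta>) y * ennreal c \<partial>lborel) = emeasure lborel (ball x \<delta>) * ennreal c"
    by (subst nn_integral_multc) (auto intro!: borel_measurable_indicator)
  then show ?thesis
    using assms by (simp add: emeasure_ball ennreal_mult powr_realpow mult.commute)
qed

text \<open>Stands in for Hoelder's inequality on a ball: once integrated, the free level
  \<open>l\<close> can be tuned to balance the two terms. Above the level the factor
  \<open>(a / l) powr (P - 1)\<close> is at least 1.\<close>

lemma powr_Young:
  fixes a l P :: real
  assumes "1 \<le> P" "0 < l" "0 \<le> a"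
  shows "a \<le> l + l powr (1 - P) * a powr P"
proof (cases "a \<le> l")
  case False
  then have "a = a powr (1 - P) * a powr P"
    using assms by (simp flip: powr_add)
  also have "\<dots> \<le> l powr (1 - P) * a powr P"
    using assms False by (intro mult_right_mono powr_mono2') auto
  finally show ?thesis
    using assms by linarith
qed (use assms in \<open>simp add: add_increasing2\<close>)

text \<open>Off the diagonal the kernel on \<open>ball x \<delta>\<close> is bounded below by a
  power of \<open>\<delta>\<close>, so the inner Gagliardo integral controls the P-th powers of the
  differences there. In the constant, the volume of the unit ball comes from the level term of
  \<open>powr_Young\<close> and the 1 from the other term.\<close>

lemma hajlasz_finite_exponent:
  fixes u :: "'a::euclidean_space \<Rightarrow> real"
  assumes [measurable]: "u \<in> borel_measurable borel" and P: "1 \<le> P" and s: "0 < s"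
    and le1: "(\<integral>\<^sup>+x. \<integral>\<^sup>+y. ennreal (\<bar>u x - u y\<bar> powr P / norm (x - y) powr (real DIM('a) + s * P))
      \<partial>lborel \<partial>lborel) \<le> 1"
  shows "\<exists>g. hajlasz s P (unit_ball_vol (real DIM('a)) + 1) u g"
proof -
  define n where "n = real DIM('a)"
  define \<omega> where "\<omega> = unit_ball_vol n"
  have \<omega>: "0 \<le> \<omega>"
    by (simp add: \<omega>_def n_def unit_ball_vol_nonneg)
  have n: "0 < n" by (simp add: n_def)
  define F where "F x y = \<bar>u x - u y\<bar> powr P / norm (x - y) powr (n + s * P)" for x y
  have F_nonneg: "0 \<le> F x y" for x y by (simp add: F_def)
  have [measurable]: "case_prod F \<in> borel_measurable (borel \<Otimes>\<^sub>M borel)"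
    unfolding F_def by measurable
  have Fx[measurable]: "F x \<in> borel_measurable borel" for x
    unfolding F_def by measurable
  define h where "h x = (\<integral>\<^sup>+y. ennreal (F x y) \<partial>lborel)" for x
  have [measurable]: "h \<in> borel_measurable borel"
    unfolding h_def by measurable
  \<comment> \<open>Where \<open>h\<close> is infinite, \<open>enn2real\<close> returns 0 and
    \<open>g\<close> is 1; this happens on a null set only. Where \<open>1 < g\<close>,
    \<open>g powr P\<close> is exactly \<open>h\<close>.\<close>
  define g where "g x = max 1 (enn2real (h x) powr (1 / P))" for x
  have g1: "1 \<le> g x" for x by (simp add: g_def)
  have h1: "(\<integral>\<^sup>+x. h x \<partial>lborel) \<le> 1"
    using le1 by (simp add: h_def F_def n_def)
  then have fin: "AE x in lborel. h x \<noteq> \<infinity>"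
    by (intro nn_integral_PInf_AE) (auto simp: top_unique)
  have [measurable]: "g \<in> borel_measurable borel"
    unfolding g_def by measurable
  have gP: "h x \<le> ennreal (g x powr P)" if "h x \<noteq> \<infinity>" for x
  proof -
    have "enn2real (h x) = (enn2real (h x) powr (1 / P)) powr P"
      using P by (simp add: powr_powr)
    also have "\<dots> \<le> g x powr P"
      using P by (intro powr_mono2) (auto simp: g_def)
    finally show ?thesis
      using that by (metis ennreal_enn2real ennreal_leI infinity_ennreal_def less_top)
  qed
  have "(\<integral>\<^sup>+x. indicator {x. 1 < g x} x * ennreal (g x powr P) \<partial>lborel) \<le> (\<integral>\<^sup>+x. h x \<partial>lborel)"
  proof (intro nn_integral_mono_AE, use fin in eventually_elim)
    case (elim x)
    show ?case
    proof (cases "1 < g x")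
      case True
      then have "g x = enn2real (h x) powr (1 / P)"
        by (auto simp: g_def)
      then have "g x powr P = enn2real (h x)"
        using P by (simp add: powr_powr)
      then show ?thesis
        using elim True by (simp add: less_top)
    qed simp
  qed
  moreover have "osc u x \<delta> \<le> ennreal ((\<omega> + 1) * \<delta> powr (n + s) * g x)"
    if "h x \<noteq> \<infinity>" "0 < \<delta>" for x \<delta>
  proof -
    \<comment> \<open>This level makes both terms multiples of
      \<open>\<delta> powr (n + s) * g x\<close>.\<close>
    define l where "l = \<delta> powr s * g x"
    have l: "0 < l" using g1[of x] that by (simp add: l_def)
    have "osc u x \<delta> \<le> (\<integral>\<^sup>+y. indicator (ball x \<delta>) y * ennreal l +
       ennreal (l powr (1 - P) * \<delta> powr (n + s * P)) * ennreal (F x y) \<partial>lborel)"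
      unfolding osc_def
    proof (intro nn_integral_mono)
      fix y
      show "indicator (ball x \<delta>) y * ennreal \<bar>u x - u y\<bar> \<le> indicator (ball x \<delta>) y * ennreal l +
       ennreal (l powr (1 - P) * \<delta> powr (n + s * P)) * ennreal (F x y)"
      proof (cases "y \<in> ball x \<delta>")
        case True
        have "\<bar>u x - u y\<bar> powr P \<le> \<delta> powr (n + s * P) * F x y"
        \<comment> \<open>On the diagonal both sides are 0, \<open>F\<close> because 0 / 0 =
          0.\<close>
        proof (cases "x = y")
          case False
          have "\<bar>u x - u y\<bar> powr P = norm (x - y) powr (n + s * P) * F x y"
            using False by (simp add: F_def)
          also have "\<dots> \<le> \<delta> powr (n + s * P) * F x y"
            using True n s P
            by (intro mult_right_mono powr_mono2) (auto simp: F_def dist_norm)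
          finally show ?thesis .
        qed (simp add: F_def)
        then have "\<bar>u x - u y\<bar> \<le> l + l powr (1 - P) * (\<delta> powr (n + s * P) * F x y)"
          using powr_Young[OF P l, of "\<bar>u x - u y\<bar>"] l
          by (smt (verit) mult_left_mono powr_ge_zero)
        then have "ennreal \<bar>u x - u y\<bar> \<le> ennreal (l + l powr (1 - P) * (\<delta> powr (n + s * P) * F x y))"
          by (rule ennreal_leI)
        also have "\<dots> = ennreal l + ennreal (l powr (1 - P) * \<delta> powr (n + s * P)) * ennreal (F x y)"
          using l by (simp add: F_nonneg ennreal_mult mult.assoc)
        finally show ?thesis using True by simp
      qed simp
    qed
    also have "\<dots> = ennreal (l * (\<omega> * \<delta> powr n)) +
       ennreal (l powr (1 - P) * \<delta> powr (n + s * P)) * h x"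
      using l that
      by (subst nn_integral_add) (auto simp: nn_integral_cmult nn_integral_indicator_ball h_def
        \<omega>_def n_def intro!: borel_measurable_times_ennreal borel_measurable_indicator)
    also have "\<dots> \<le> ennreal (l * (\<omega> * \<delta> powr n)) +
       ennreal (l powr (1 - P) * \<delta> powr (n + s * P)) * ennreal (g x powr P)"
      using gP[OF that(1)] by (intro add_mono mult_left_mono) auto
    also have "\<dots> = ennreal (l * (\<omega> * \<delta> powr n) + l powr (1 - P) * \<delta> powr (n + s * P) * g x powr P)"
      using l \<omega> by (simp add: ennreal_mult)
    also have "l * (\<omega> * \<delta> powr n) = \<omega> * \<delta> powr (n + s) * g x"
      by (simp add: l_def powr_add)
    also have "l powr (1 - P) * \<delta> powr (n + s * P) * g x powr P =
        (\<delta> powr (s * (1 - P)) * \<delta> powr (n + s * P)) * (g x powr (1 - P) * g x powr P)"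
      using g1[of x] by (simp add: l_def powr_mult powr_powr)
    also have "\<dots> = \<delta> powr (n + s) * g x"
      using g1[of x] by (simp add: algebra_simps flip: powr_add)
    finally show ?thesis by (simp add: algebra_simps)
  qed
  ultimately have "hajlasz s P (\<omega> + 1) u g"
    unfolding hajlasz_def using fin g1 h1 by (auto simp: n_def)
  then show ?thesis
    by (auto simp: \<omega>_def n_def)
qed

text \<open>\<open>P\<close> is arbitrary: for g = 1 the set \<open>{1 < g}\<close> is empty, so the
  integral condition holds for every exponent. The summand 1 makes the constant agree with the one
  for finite exponents.\<close>

lemma hajlasz_Hoelder:
  fixes u :: "'a::euclidean_space \<Rightarrow> real"
  assumes "\<And>x y. \<bar>u x - u y\<bar> \<le> norm (x - y) powr s" and s: "0 < s"
  shows "hajlasz s P (unit_ball_vol (real DIM('a)) + 1) u (\<lambda>_. 1)"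
proof -
  have "osc u x \<delta> \<le> ennreal ((unit_ball_vol (real DIM('a)) + 1) * \<delta> powr (real DIM('a) + s))"
    if "0 < \<delta>" for x \<delta>
  proof -
    have "osc u x \<delta> \<le> (\<integral>\<^sup>+y. indicator (ball x \<delta>) y * ennreal (\<delta> powr s) \<partial>lborel)"
      unfolding osc_def
    proof (intro nn_integral_mono)
      fix y
      have "\<bar>u x - u y\<bar> \<le> \<delta> powr s" if "y \<in> ball x \<delta>"
        using that s by (intro order_trans[OF assms(1)] powr_mono2) (auto simp: dist_norm)
      then show "indicator (ball x \<delta>) y * ennreal \<bar>u x - u y\<bar> \<le> indicator (ball x \<delta>) y * ennreal (\<delta> powr s)"
        by (cases "y \<in> ball x \<delta>") (auto intro: ennreal_leI)
    qed
    also have "\<dots> \<le> ennreal ((unit_ball_vol (real DIM('a)) + 1) * \<delta> powr (real DIM('a) + s))"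
      using that by (subst nn_integral_indicator_ball)
        (auto simp: powr_add algebra_simps intro!: ennreal_leI)
    finally show ?thesis .
  qed
  then show ?thesis
    unfolding hajlasz_def by auto
qed

text \<open>Turns measure estimates into actual comparison points: a null set together with a set of
  measure below that of the ball cannot cover the ball.\<close>

lemma ex_in_ball_of_small_complement:
  fixes x :: "'a::euclidean_space"
  assumes ae: "AE y in lborel. P y" and meas: "{y. \<not> Q y} \<in> sets borel"
    and small: "emeasure lborel {y. \<not> Q y} < emeasure lborel (ball x R)"
  shows "\<exists>y\<in>ball x R. P y \<and> Q y"
proof (rule ccontr)
  assume "\<not> ?thesis"
  then have "AE y in lborel. y \<in> ball x R \<longrightarrow> y \<in> {y. \<not> Q y}"
    using ae by (auto elim: eventually_mono)
  then have "emeasure lborel (ball x R) \<le> emeasure lborel {y. \<not> Q y}"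
    using meas by (intro emeasure_mono_AE) auto
  with small show False by simp
qed

text \<open>The inequality \<open>\<bar>u x - u y\<bar> \<le> \<bar>u x - u z\<bar> + \<bar>u y - u
  z\<bar>\<close> is integrated over z in the ball around x with radius
  \<open>\<rho> = norm (x - y)\<close>. That ball lies in \<open>ball y (2 * \<rho>)\<close>, and
  the doubled radius yields the factor \<open>2 powr (n + s)\<close>.\<close>

lemma hajlasz_pointwise:
  fixes u :: "'a::euclidean_space \<Rightarrow> real"
  assumes [measurable]: "u \<in> borel_measurable borel" and C: "0 \<le> C"
    and x: "\<And>\<delta>. \<delta> > 0 \<Longrightarrow> osc u x \<delta> \<le> ennreal (C * \<delta> powr (real DIM('a) + s) * g x)"
    and y: "\<And>\<delta>. \<delta> > 0 \<Longrightarrow> osc u y \<delta> \<le> ennreal (C * \<delta> powr (real DIM('a) + s) * g y)"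
    and g: "1 \<le> g x" "1 \<le> g y" and s: "0 < s"
  shows "\<bar>u x - u y\<bar> \<le> C * 2 powr (real DIM('a) + s) / unit_ball_vol (real DIM('a)) *
    norm (x - y) powr s * (g x + g y)"
proof (cases "x = y")
  case False
  define n where "n = real DIM('a)"
  define \<omega> where "\<omega> = unit_ball_vol n"
  define \<rho> where "\<rho> = norm (x - y)"
  have \<omega>: "0 < \<omega>" and n: "0 < n"
    by (auto simp: \<omega>_def n_def)
  have \<rho>: "0 < \<rho>" using False by (simp add: \<rho>_def)
  have [measurable]: "ball a b \<in> sets borel" for a :: 'a and b by auto
  have "ennreal (\<bar>u x - u y\<bar> * (\<omega> * \<rho> powr n)) =
      (\<integral>\<^sup>+z. indicator (ball x \<rho>) z * ennreal \<bar>u x - u y\<bar> \<partial>lborel)"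
    using \<rho> by (simp add: nn_integral_indicator_ball \<omega>_def n_def)
  also have "\<dots> \<le> (\<integral>\<^sup>+z. indicator (ball x \<rho>) z * ennreal \<bar>u x - u z\<bar> +
       indicator (ball y (2 * \<rho>)) z * ennreal \<bar>u y - u z\<bar> \<partial>lborel)"
  proof (intro nn_integral_mono)
    fix z
    show "indicator (ball x \<rho>) z * ennreal \<bar>u x - u y\<bar> \<le>
      indicator (ball x \<rho>) z * ennreal \<bar>u x - u z\<bar> + indicator (ball y (2 * \<rho>)) z * ennreal \<bar>u y - u z\<bar>"
    proof (cases "z \<in> ball x \<rho>")
      case True
      then have "z \<in> ball y (2 * \<rho>)"
        using dist_triangle[of y z x] by (simp add: \<rho>_def dist_norm norm_minus_commute)
      moreover have "ennreal \<bar>u x - u y\<bar> \<le> ennreal (\<bar>u x - u z\<bar> + \<bar>u y - u z\<bar>)"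
        by (intro ennreal_leI) auto
      ultimately show ?thesis using True by simp
    qed simp
  qed
  also have "\<dots> = osc u x \<rho> + osc u y (2 * \<rho>)"
    unfolding osc_def by (subst nn_integral_add) auto
  also have "\<dots> \<le> ennreal (C * \<rho> powr (n + s) * g x) + ennreal (C * (2 * \<rho>) powr (n + s) * g y)"
    using \<rho> unfolding n_def by (intro add_mono x y) auto
  also have "\<dots> = ennreal (C * \<rho> powr (n + s) * g x + C * (2 * \<rho>) powr (n + s) * g y)"
    using C g by simp
  finally have "\<bar>u x - u y\<bar> * (\<omega> * \<rho> powr n) \<le> C * \<rho> powr (n + s) * g x + C * (2 * \<rho>) powr (n + s) * g y"
    using C g by (subst (asm) ennreal_le_iff) auto
  also have "\<dots> \<le> C * 2 powr (n + s) * \<rho> powr (n + s) * (g x + g y)"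
  proof -
    have "1 \<le> (2::real) powr (n + s)"
      using n s by (intro ge_one_powr_ge_zero) auto
    then have "C * \<rho> powr (n + s) * g x * 1 \<le> C * \<rho> powr (n + s) * g x * 2 powr (n + s)"
      using C g by (intro mult_left_mono) auto
    then show ?thesis
      using \<rho> by (simp add: powr_mult algebra_simps)
  qed
  also have "\<dots> = C * 2 powr (n + s) / \<omega> * \<rho> powr s * (g x + g y) * (\<omega> * \<rho> powr n)"
    using \<omega> by (simp add: powr_add)
  finally have "\<bar>u x - u y\<bar> \<le> C * 2 powr (n + s) / \<omega> * \<rho> powr s * (g x + g y)"
    by (rule mult_right_le_imp_le) (use \<omega> \<rho> in auto)
  then show ?thesis
    by (simp add: \<omega>_def n_def \<rho>_def)
qed (use assms in auto)

section \<open>Logarithmic growth and integrability of higher powers\<close>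

lemma emeasure_superlevel_le:
  fixes g :: "'a::euclidean_space \<Rightarrow> real"
  assumes [measurable]: "g \<in> borel_measurable borel"
    and g: "(\<integral>\<^sup>+x. indicator {x. 1 < g x} x * ennreal (g x powr P) \<partial>lborel) \<le> 1"
    and L: "1 \<le> L" and P: "0 < P"
  shows "emeasure lborel {x. L < g x} \<le> ennreal (L powr (- P))"
proof -
  have "ennreal (L powr P) * emeasure lborel {x. L < g x} =
      (\<integral>\<^sup>+x. ennreal (L powr P) * indicator {x. L < g x} x \<partial>lborel)"
    by (subst nn_integral_cmult_indicator) auto
  \<comment> \<open>Chebyshev's inequality: \<open>1 \<le> L\<close> puts the superlevel set inside
    \<open>{1 < g}\<close>, the only part that the normalization controls.\<close>
  also have "\<dots> \<le> (\<integral>\<^sup>+x. indicator {x. 1 < g x} x * ennreal (g x powr P) \<partial>lborel)"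
    using L P by (intro nn_integral_mono)
      (auto simp: indicator_def intro!: ennreal_leI powr_mono2)
  also note g
  finally have *: "ennreal (L powr P) * emeasure lborel {x. L < g x} \<le> 1" .
  have "emeasure lborel {x. L < g x} =
      ennreal (L powr (- P)) * (ennreal (L powr P) * emeasure lborel {x. L < g x})"
    using L by (simp add: mult.assoc[symmetric] ennreal_mult[symmetric] powr_add[symmetric])
  also have "\<dots> \<le> ennreal (L powr (- P)) * 1"
    by (intro mult_left_mono *) auto
  finally show ?thesis by simp
qed

text \<open>The exponent condition \<open>s P \<ge> n\<close> enters here: a point of \<open>{g \<le> 2\<^sup>k\<^sup>+\<^sup>1}\<close> has a point of
  \<open>{g \<le> 2\<^sup>k}\<close> at distance at most a multiple of \<open>2 powr (- k P / n)\<close>, so each doubling of \<open>g\<close> costs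
  only a bounded increase of \<open>\<bar>u\<bar>\<close>.\<close>

lemma hajlasz_log_bound:
  assumes s: "0 < s" and P: "0 < P" and sP: "real DIM('a::euclidean_space) \<le> s * P"
    and C: "0 \<le> C" and Q: "0 < Q" and q: "0 < q"
  shows "\<exists>B\<ge>0. \<forall>(u :: 'a \<Rightarrow> real) g. u \<in> borel_measurable borel \<longrightarrow> hajlasz s P C u g \<longrightarrow>
    (\<integral>\<^sup>+x. ennreal (\<bar>u x\<bar> powr q) \<partial>lborel) \<le> ennreal Q \<longrightarrow>
    (AE x in lborel. \<bar>u x\<bar> \<le> B * (1 + ln (g x)))"
proof -
  define n where "n = real DIM('a)"
  define \<omega> where "\<omega> = unit_ball_vol n"
  have \<omega>: "0 < \<omega>" and n: "0 < n"
    by (auto simp: \<omega>_def n_def)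
  define C1 where "C1 = C * 2 powr (n + s) / \<omega>"
  have C1: "0 \<le> C1" using C \<omega> by (simp add: C1_def)
  \<comment> \<open>A ball of radius \<open>R0\<close> has measure 3. By Chebyshev's inequality the
    points with \<open>1 < g\<close> or \<open>Q < \<bar>u\<bar> powr q\<close> have measure at most
    2, so every such ball contains a point outside them.\<close>
  define R0 where "R0 = (3 / \<omega>) powr (1 / n)"
  define A where "A = Q powr (1 / q) + C1 * R0 powr s * 2"
  define D where "D = C1 * (2 / \<omega>) powr (s / n) * 3"
  have A: "0 \<le> A" using C1 by (simp add: A_def)
  have D: "0 \<le> D" using C1 by (simp add: D_def)
  \<comment> \<open>The dyadic level k is at most \<open>1 + log 2 (g x)\<close>, and then
    \<open>A + k * D\<close> is at most \<open>A + D + D / ln 2 * ln (g x)\<close>.\<close>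
  define B where "B = A + D + D / ln 2"
  have B: "0 \<le> B" using A D by (simp add: B_def)
  have ball: "emeasure lborel (ball x R) = ennreal (\<omega> * R powr n)" if "0 < R" for x :: 'a and R
    using that by (simp add: emeasure_ball \<omega>_def n_def powr_realpow)
  have "AE x in lborel. \<bar>u x\<bar> \<le> B * (1 + ln (g x))"
    if u[measurable]: "u \<in> borel_measurable borel" and h: "hajlasz s P C u g"
      and uQ: "(\<integral>\<^sup>+x. ennreal (\<bar>u x\<bar> powr q) \<partial>lborel) \<le> ennreal Q"
    for u g :: "'a \<Rightarrow> real"
  proof -
    from h have [measurable]: "g \<in> borel_measurable borel" and g1: "\<And>x. 1 \<le> g x"
      and gi: "(\<integral>\<^sup>+x. indicator {x. 1 < g x} x * ennreal (g x powr P) \<partial>lborel) \<le> 1"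
      by (auto simp: hajlasz_def)
    define good where "good x \<longleftrightarrow> (\<forall>\<delta>>0. osc u x \<delta> \<le> ennreal (C * \<delta> powr (n + s) * g x))" for x
    have good: "AE x in lborel. good x"
      using h by (simp add: hajlasz_def good_def n_def)
    have pw: "\<bar>u x - u y\<bar> \<le> C1 * norm (x - y) powr s * (g x + g y)" if "good x" "good y" for x y
      using hajlasz_pointwise[OF u C, of x s g y] that g1 s
      by (simp add: good_def n_def C1_def \<omega>_def)
    have level: "\<bar>u x\<bar> \<le> A + real k * D" if "good x" "g x \<le> 2 ^ k" for x k
      using that
    proof (induction k arbitrary: x)
      case 0
      have R0: "0 < R0" using \<omega> by (simp add: R0_def)
      have "{y. \<not> (g y \<le> 1 \<and> \<bar>u y\<bar> powr q \<le> Q)} = {y. 1 < g y} \<union> {y. Q < \<bar>u y\<bar> powr q}"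
        by auto
      then have "emeasure lborel {y. \<not> (g y \<le> 1 \<and> \<bar>u y\<bar> powr q \<le> Q)} \<le>
          emeasure lborel {y. 1 < g y} + emeasure lborel {y. Q < \<bar>u y\<bar> powr q}"
        by (simp add: emeasure_subadditive)
      also have "\<dots> \<le> ennreal 1 + ennreal 1"
      proof (intro add_mono)
        show "emeasure lborel {y. 1 < g y} \<le> ennreal 1"
          using emeasure_superlevel_le[OF _ gi order.refl P] by simp
        have "ennreal Q * emeasure lborel {y. Q < \<bar>u y\<bar> powr q} =
            (\<integral>\<^sup>+x. ennreal Q * indicator {y. Q < \<bar>u y\<bar> powr q} x \<partial>lborel)"
          by (subst nn_integral_cmult_indicator) auto
        also have "\<dots> \<le> (\<integral>\<^sup>+x. ennreal (\<bar>u x\<bar> powr q) \<partial>lborel)"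
          by (intro nn_integral_mono) (auto simp: indicator_def intro!: ennreal_leI)
        also note uQ
        finally have *: "ennreal Q * emeasure lborel {y. Q < \<bar>u y\<bar> powr q} \<le> ennreal Q" .
        have "emeasure lborel {y. Q < \<bar>u y\<bar> powr q} =
            ennreal (1 / Q) * (ennreal Q * emeasure lborel {y. Q < \<bar>u y\<bar> powr q})"
          using Q by (simp add: mult.assoc[symmetric] ennreal_mult[symmetric])
        also have "\<dots> \<le> ennreal (1 / Q) * ennreal Q"
          by (intro mult_left_mono *) auto
        also have "\<dots> = ennreal 1"
          using Q by (simp flip: ennreal_mult)
        finally show "emeasure lborel {y. Q < \<bar>u y\<bar> powr q} \<le> ennreal 1" .
      qed
      also have "\<dots> = ennreal 2" by (simp flip: ennreal_plus)
      also have "\<dots> < ennreal 3" by (intro ennreal_lessI) auto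
      also have "ennreal 3 = emeasure lborel (ball x R0)"
        using R0 \<omega> n by (simp add: ball R0_def powr_powr)
      finally obtain y where y: "y \<in> ball x R0" "good y" "g y \<le> 1" "\<bar>u y\<bar> powr q \<le> Q"
        using ex_in_ball_of_small_complement[OF good, of "\<lambda>y. g y \<le> 1 \<and> \<bar>u y\<bar> powr q \<le> Q" x R0]
        by auto
      have "\<bar>u y\<bar> = (\<bar>u y\<bar> powr q) powr (1 / q)"
        using q by (simp add: powr_powr)
      also have "\<dots> \<le> Q powr (1 / q)"
        using q y by (intro powr_mono2) auto
      finally have 1: "\<bar>u y\<bar> \<le> Q powr (1 / q)" .
      have "\<bar>u x - u y\<bar> \<le> C1 * norm (x - y) powr s * (g x + g y)"
        by (intro pw 0 y)
      also have "\<dots> \<le> C1 * R0 powr s * 2"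
        using y 0 C1 g1[of x] g1[of y] s
        by (intro mult_mono powr_mono2 mult_nonneg_nonneg) (auto simp: dist_norm)
      finally show ?case using 1 by (simp add: A_def)
    next
      case (Suc k)
      \<comment> \<open>A ball of this radius has measure \<open>2 * (2 ^ k) powr (- P)\<close>,
        twice what Chebyshev's inequality allows for \<open>{2 ^ k < g}\<close>.\<close>
      define R where "R = (2 / \<omega>) powr (1 / n) * (2 ^ k) powr (- P / n)"
      have R: "0 < R" using \<omega> by (simp add: R_def)
      have "emeasure lborel {y. \<not> g y \<le> 2 ^ k} \<le> ennreal ((2 ^ k) powr (- P))"
        using emeasure_superlevel_le[OF _ gi _ P, of "2 ^ k"] by (simp add: not_le)
      also have "\<dots> < ennreal (2 * (2 ^ k) powr (- P))"
        by (intro ennreal_lessI) auto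
      also have "\<dots> = emeasure lborel (ball x R)"
        using R \<omega> n by (simp add: ball R_def powr_powr powr_mult)
      finally obtain y where y: "y \<in> ball x R" "good y" "g y \<le> 2 ^ k"
        using ex_in_ball_of_small_complement[OF good, of "\<lambda>y. g y \<le> 2 ^ k" x R] by auto
      have "\<bar>u x - u y\<bar> \<le> C1 * norm (x - y) powr s * (g x + g y)"
        by (intro pw Suc.prems y)
      also have "\<dots> \<le> C1 * R powr s * (3 * 2 ^ k)"
        using y Suc.prems C1 g1[of x] g1[of y] s
        by (intro mult_mono powr_mono2 mult_nonneg_nonneg) (auto simp: dist_norm)
      also have "\<dots> = C1 * (2 / \<omega>) powr (s / n) * 3 * ((2 ^ k) powr (- (s * P) / n) * (2 ^ k) powr 1)"
        using \<omega> by (simp add: R_def powr_mult powr_powr algebra_simps)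
      also have "(2 ^ k) powr (- (s * P) / n) * (2 ^ k) powr 1 = (2 ^ k) powr (1 - s * P / n)"
        by (subst powr_add[symmetric]) simp
      \<comment> \<open>The exponent \<open>1 - s * P / n\<close> is at most 0, so one step costs at
        most \<open>D\<close>, whatever k is. If it were negative the costs would be summable; at 0
        they are constant, whence the logarithm.\<close>
      also have "C1 * (2 / \<omega>) powr (s / n) * 3 * (2 ^ k) powr (1 - s * P / n) \<le> D * (2 ^ k) powr 0"
        unfolding D_def using C1 sP n
        by (intro mult_left_mono powr_mono) (auto simp: n_def field_simps)
      finally show ?case
        using Suc.IH[OF y(2,3)] by (simp add: algebra_simps)
    qed
    show ?thesis
      using good
    proof eventually_elim
      case (elim x)
      define k where "k = nat \<lceil>log 2 (g x)\<rceil>"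
      have l: "0 \<le> log 2 (g x)" using g1[of x] by simp
      have "g x = 2 powr (log 2 (g x))"
        using g1[of x] by (intro powr_log_cancel[symmetric]) auto
      also have "\<dots> \<le> 2 powr real k"
        using l by (intro powr_mono) (auto simp: k_def)
      finally have "g x \<le> 2 ^ k" by (simp add: powr_realpow)
      from level[OF elim this] have "\<bar>u x\<bar> \<le> A + real k * D" .
      also have "real k \<le> 1 + log 2 (g x)"
        using l by (simp add: k_def) linarith
      then have "A + real k * D \<le> A + (1 + log 2 (g x)) * D"
        using D by (intro add_left_mono mult_right_mono) auto
      also have "\<dots> \<le> B * (1 + ln (g x))"
        using A D g1[of x] by (simp add: B_def log_def field_simps)
      finally show ?case .
    qed
  qed
  then show ?thesis
    using B by auto
qed

text \<open>Where g = 1, \<open>\<bar>u\<bar>\<close> is at most \<open>B\<close> and the surplus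
  power q' - q is absorbed by a constant. Where \<open>1 < g\<close>, the logarithm is at most a
  multiple of a power of g so small that its q'-th power is the integrable
  \<open>g powr P\<close>.\<close>

lemma hajlasz_higher_power:
  assumes s: "0 < s" and P: "0 < P" and sP: "real DIM('a::euclidean_space) \<le> s * P"
    and C: "0 \<le> C" and Q: "0 < Q" and q: "0 < q" "q < q'"
  shows "\<exists>Q'\<ge>0. \<forall>(u :: 'a \<Rightarrow> real) g. u \<in> borel_measurable borel \<longrightarrow> hajlasz s P C u g \<longrightarrow>
    (\<integral>\<^sup>+x. ennreal (\<bar>u x\<bar> powr q) \<partial>lborel) \<le> ennreal Q \<longrightarrow>
    (\<integral>\<^sup>+x. ennreal (\<bar>u x\<bar> powr q') \<partial>lborel) \<le> ennreal Q'"
proof -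
  obtain B where B: "0 \<le> B" and *: "\<And>(u :: 'a \<Rightarrow> real) g. u \<in> borel_measurable borel \<Longrightarrow>
    hajlasz s P C u g \<Longrightarrow> (\<integral>\<^sup>+x. ennreal (\<bar>u x\<bar> powr q) \<partial>lborel) \<le> ennreal Q \<Longrightarrow>
    (AE x in lborel. \<bar>u x\<bar> \<le> B * (1 + ln (g x)))"
    using hajlasz_log_bound[OF s P sP C Q q(1)] by blast
  \<comment> \<open>Makes \<open>(g powr \<epsilon>) powr q'\<close> equal to
    \<open>g powr P\<close>. The term \<open>1 / \<epsilon>\<close> in \<open>c\<close> stems from
    \<open>ln g \<le> g powr \<epsilon> / \<epsilon>\<close>.\<close>
  define \<epsilon> where "\<epsilon> = P / q'"
  have \<epsilon>: "0 < \<epsilon>" using P q by (simp add: \<epsilon>_def)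
  define c where "c = B * (1 + 1 / \<epsilon>)"
  have c: "0 \<le> c" using B \<epsilon> by (simp add: c_def)
  have "(\<integral>\<^sup>+x. ennreal (\<bar>u x\<bar> powr q') \<partial>lborel) \<le> ennreal (B powr (q' - q) * Q + c powr q')"
    if [measurable]: "u \<in> borel_measurable borel" and h: "hajlasz s P C u g"
      and uQ: "(\<integral>\<^sup>+x. ennreal (\<bar>u x\<bar> powr q) \<partial>lborel) \<le> ennreal Q" for u g :: "'a \<Rightarrow> real"
  proof -
    from h have [measurable]: "g \<in> borel_measurable borel" and g1: "\<And>x. 1 \<le> g x"
      and gi: "(\<integral>\<^sup>+x. indicator {x. 1 < g x} x * ennreal (g x powr P) \<partial>lborel) \<le> 1"
      by (auto simp: hajlasz_def)
    have "(\<integral>\<^sup>+x. ennreal (\<bar>u x\<bar> powr q') \<partial>lborel) \<le>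
      (\<integral>\<^sup>+x. ennreal (B powr (q' - q)) * ennreal (\<bar>u x\<bar> powr q) +
        ennreal (c powr q') * (indicator {x. 1 < g x} x * ennreal (g x powr P)) \<partial>lborel)"
    proof (intro nn_integral_mono_AE, use *[OF that] in eventually_elim)
      case (elim x)
      show ?case
      proof (cases "1 < g x")
        case True
        have "ln (g x) \<le> g x powr \<epsilon> / \<epsilon>"
          using g1 \<epsilon> by (intro ln_powr_bound) auto
        moreover have "1 \<le> g x powr \<epsilon>"
          using g1[of x] \<epsilon> by (intro ge_one_powr_ge_zero) auto
        ultimately have "1 + ln (g x) \<le> (1 + 1 / \<epsilon>) * g x powr \<epsilon>"
          by (simp add: algebra_simps)
        then have "B * (1 + ln (g x)) \<le> c * g x powr \<epsilon>"
          using B unfolding c_def by (simp add: mult_left_mono mult.assoc)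
        with elim have "\<bar>u x\<bar> powr q' \<le> (c * g x powr \<epsilon>) powr q'"
          using q by (intro powr_mono2) auto
        also have "\<dots> = c powr q' * g x powr P"
          using c q by (simp add: powr_mult powr_powr \<epsilon>_def)
        finally have "ennreal (\<bar>u x\<bar> powr q') \<le> ennreal (c powr q') * ennreal (g x powr P)"
          by (simp add: ennreal_leI flip: ennreal_mult)
        then show ?thesis using True by (simp add: add_increasing)
      next
        case False
        then have "g x = 1" using g1[of x] by simp
        with elim have u: "\<bar>u x\<bar> \<le> B" by simp
        have "\<bar>u x\<bar> powr q' = \<bar>u x\<bar> powr (q' - q) * \<bar>u x\<bar> powr q"
          by (simp flip: powr_add)
        also have "\<dots> \<le> B powr (q' - q) * \<bar>u x\<bar> powr q"
          using u q by (intro mult_right_mono powr_mono2) auto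
        finally show ?thesis using False by (simp add: ennreal_leI flip: ennreal_mult)
      qed
    qed
    also have "\<dots> = ennreal (B powr (q' - q)) * (\<integral>\<^sup>+x. ennreal (\<bar>u x\<bar> powr q) \<partial>lborel) +
        ennreal (c powr q') * (\<integral>\<^sup>+x. indicator {x. 1 < g x} x * ennreal (g x powr P) \<partial>lborel)"
      by (simp add: nn_integral_add nn_integral_cmult)
    also have "\<dots> \<le> ennreal (B powr (q' - q)) * ennreal Q + ennreal (c powr q') * 1"
      by (intro add_mono mult_left_mono uQ gi) auto
    also have "\<dots> = ennreal (B powr (q' - q) * Q + c powr q')"
      using Q by (simp add: ennreal_mult)
    finally show ?thesis .
  qed
  then show ?thesis
    using Q by (intro exI[of _ "B powr (q' - q) * Q + c powr q'"]) auto
qed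

subsection \<open>Almost everywhere convergent subsequences\<close>

text \<open>The Riesz-Fischer argument. As \<open>w\<close> is positive at every point, it can be
  cancelled once the weighted series of increments is finite.\<close>

lemma AE_convergent_subseq_of_L1_Cauchy:
  fixes u :: "nat \<Rightarrow> 'a \<Rightarrow> real" and w :: "'a \<Rightarrow> ennreal"
  assumes [measurable]: "\<And>k. u k \<in> borel_measurable M" "w \<in> borel_measurable M"
    and w: "\<And>x. 0 < w x"
    and Cauchy: "\<And>e::real. 0 < e \<Longrightarrow> \<exists>N. \<forall>i\<ge>N. \<forall>j\<ge>N. (\<integral>\<^sup>+x. ennreal \<bar>u i x - u j x\<bar> * w x \<partial>M) \<le> ennreal e"
  shows "\<exists>\<rho>. strict_mono \<rho> \<and> (AE x in M. convergent (\<lambda>k. u (\<rho> k) x))"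
proof -
  have "\<exists>N. \<forall>i\<ge>N. \<forall>j\<ge>N. (\<integral>\<^sup>+x. ennreal \<bar>u i x - u j x\<bar> * w x \<partial>M) \<le> ennreal ((1 / 2) ^ k)" for k :: nat
    by (intro Cauchy) auto
  then obtain N where N: "\<And>k i j. N k \<le> i \<Longrightarrow> N k \<le> j \<Longrightarrow>
      (\<integral>\<^sup>+x. ennreal \<bar>u i x - u j x\<bar> * w x \<partial>M) \<le> ennreal ((1 / 2) ^ k)"
    by metis
  \<comment> \<open>The partial sums dominate \<open>N k\<close>, and the added k makes the sequence
    strictly increasing.\<close>
  define \<rho> where "\<rho> k = k + (\<Sum>i\<le>k. N i)" for k
  have mono: "strict_mono \<rho>"
    by (auto simp: strict_mono_Suc_iff \<rho>_def)
  have N\<rho>: "N k \<le> \<rho> k" for k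
    using member_le_sum[of k "{..k}" N] by (simp add: \<rho>_def trans_le_add2)
  define a where "a k x = \<bar>u (\<rho> (Suc k)) x - u (\<rho> k) x\<bar>" for k x
  have [measurable]: "a k \<in> borel_measurable M" for k
    unfolding a_def by measurable
  have "(\<integral>\<^sup>+x. (\<Sum>k. ennreal (a k x) * w x) \<partial>M) = (\<Sum>k. \<integral>\<^sup>+x. ennreal (a k x) * w x \<partial>M)"
    by (rule nn_integral_suminf) auto
  also have "\<dots> \<le> (\<Sum>k. ennreal ((1 / 2) ^ k))"
  proof (intro suminf_le)
    show "(\<integral>\<^sup>+x. ennreal (a k x) * w x \<partial>M) \<le> ennreal ((1 / 2) ^ k)" for k
      unfolding a_def using N\<rho>[of k] strict_mono_less_eq[OF mono, of k "Suc k"]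
      by (intro N) auto
  qed auto
  also have "\<dots> = ennreal (\<Sum>k. (1 / 2) ^ k)"
    by (rule suminf_ennreal2) (auto intro: summable_geometric)
  finally have "(\<integral>\<^sup>+x. (\<Sum>k. ennreal (a k x) * w x) \<partial>M) \<noteq> \<infinity>"
    by (auto simp: top_unique)
  then have "AE x in M. (\<Sum>k. ennreal (a k x) * w x) \<noteq> \<infinity>"
    by (intro nn_integral_PInf_AE) auto
  then have "AE x in M. convergent (\<lambda>k. u (\<rho> k) x)"
  proof eventually_elim
    case (elim x)
    then have "(\<Sum>k. ennreal (a k x)) \<noteq> top"
      using w[of x] by (auto simp: ennreal_top_mult split: if_splits)
    then have "summable (\<lambda>k. a k x)"
      by (intro summable_suminf_not_top) (auto simp: a_def)
    then have "summable (\<lambda>k. u (\<rho> (Suc k)) x - u (\<rho> k) x)"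
      unfolding a_def by (rule summable_rabs_cancel)
    then have "convergent (\<lambda>k. u (\<rho> k) x - u (\<rho> 0) x)"
      unfolding summable_iff_convergent by (simp add: sum_lessThan_telescope[of "\<lambda>k. u (\<rho> k) x"])
    then show ?case
      by (simp add: convergent_diff_const_right_iff)
  qed
  with mono show ?thesis by blast
qed

text \<open>The balls are centred at countably many points, so that one diagonal sequence serves all
  averages. The comparison takes place in L^1 with a weight \<open>w\<close>, because
  \<open>g k\<close>, being at least 1, is not integrable over the whole space.\<close>

lemma hajlasz_AE_convergent_subseq:
  fixes u :: "nat \<Rightarrow> 'a::euclidean_space \<Rightarrow> real"
  assumes u[measurable]: "\<And>k. u k \<in> borel_measurable borel"
    and h: "\<And>k. hajlasz s P C (u k) (g k)"
    and uQ: "\<And>k. (\<integral>\<^sup>+x. ennreal (\<bar>u k x\<bar> powr q) \<partial>lborel) \<le> ennreal Q"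
    and s: "0 < s" and P: "1 \<le> P" and C: "0 \<le> C" and Q: "0 < Q" and q: "1 \<le> q"
  shows "\<exists>\<rho>. strict_mono \<rho> \<and> (AE x in lborel. convergent (\<lambda>k. u (\<rho> k) x))"
proof -
  define n where "n = real DIM('a)"
  define \<omega> where "\<omega> = unit_ball_vol n"
  have \<omega>: "0 < \<omega>" and n: "0 < n"
    by (auto simp: \<omega>_def n_def)
  have [measurable]: "ball a b \<in> sets borel" for a :: 'a and b by auto
  have [measurable]: "g k \<in> borel_measurable borel" and g1: "\<And>x. 1 \<le> g k x"
    and gi: "(\<integral>\<^sup>+x. indicator {x. 1 < g k x} x * ennreal (g k x powr P) \<partial>lborel) \<le> 1"
    and good: "AE x in lborel. \<forall>\<delta>>0. osc (u k) x \<delta> \<le> ennreal (C * \<delta> powr (n + s) * g k x)" for k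
    using h[of k] by (auto simp: hajlasz_def n_def)
  obtain h0 :: "'a \<Rightarrow> ennreal" where [measurable]: "h0 \<in> borel_measurable borel"
    and h0: "(\<integral>\<^sup>+x. h0 x \<partial>lborel) \<noteq> \<infinity>" "\<And>x. 0 < h0 x"
    using sigma_finite_measure.Ex_finite_integrable_function[OF sigma_finite_lborel] by auto
  \<comment> \<open>The integrable \<open>h0\<close> takes care of the points with g = 1, the bound
    1 of those with \<open>1 < g\<close>, where \<open>g\<close> is at most
    \<open>g powr P\<close>.\<close>
  define w where "w x = min 1 (h0 x)" for x
  have [measurable]: "w \<in> borel_measurable borel" unfolding w_def by measurable
  have w: "0 < w x" "w x \<le> 1" for x
    using h0 by (auto simp: w_def)
  have "(\<integral>\<^sup>+x. w x \<partial>lborel) \<le> (\<integral>\<^sup>+x. h0 x \<partial>lborel)"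
    by (intro nn_integral_mono) (auto simp: w_def)
  then obtain W where W: "0 \<le> W" "(\<integral>\<^sup>+x. w x \<partial>lborel) = ennreal W"
    using h0 by (cases "\<integral>\<^sup>+x. w x \<partial>lborel") (auto simp: top_unique)
  have gw: "(\<integral>\<^sup>+x. ennreal (g k x) * w x \<partial>lborel) \<le> ennreal (W + 1)" for k
  proof -
    have "(\<integral>\<^sup>+x. ennreal (g k x) * w x \<partial>lborel) \<le>
        (\<integral>\<^sup>+x. w x + indicator {x. 1 < g k x} x * ennreal (g k x powr P) \<partial>lborel)"
    proof (intro nn_integral_mono)
      fix x
      show "ennreal (g k x) * w x \<le> w x + indicator {x. 1 < g k x} x * ennreal (g k x powr P)"
      proof (cases "1 < g k x")
        case True
        have "ennreal (g k x) * w x \<le> ennreal (g k x) * 1"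
          using w by (intro mult_left_mono) auto
        also have "\<dots> \<le> ennreal (g k x powr P)"
          using True P powr_mono[of 1 P "g k x"] by (auto intro!: ennreal_leI)
        finally show ?thesis using True by (simp add: add_increasing)
      next
        case False
        then have "g k x = 1" using g1[of k x] by simp
        then show ?thesis by simp
      qed
    qed
    also have "\<dots> = ennreal W + (\<integral>\<^sup>+x. indicator {x. 1 < g k x} x * ennreal (g k x powr P) \<partial>lborel)"
      by (subst nn_integral_add) (auto simp: W)
    also have "\<dots> \<le> ennreal W + ennreal 1"
      using gi by (intro add_left_mono) auto
    finally show ?thesis using W by simp
  qed
  obtain D :: "'a set" where D: "countable D" "\<And>X. open X \<Longrightarrow> X \<noteq> {} \<Longrightarrow> \<exists>d\<in>D. d \<in> X"
    using countable_dense_exists by metis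
  define d where "d = from_nat_into D"
  have dense: "\<exists>i. dist (d i) x < e" if e: "0 < e" for x e
  proof -
    obtain y where y: "y \<in> D" "y \<in> ball x e"
      using D(2)[of "ball x e"] e by auto
    then show ?thesis
      using from_nat_into_surj[OF D(1) y(1)] by (auto simp: d_def dist_commute)
  qed
  define \<delta> where "\<delta> m = 1 / real (Suc m)" for m
  have \<delta>: "0 < \<delta> m" for m by (simp add: \<delta>_def)
  define vol where "vol m = \<omega> * \<delta> m powr n" for m
  have vol: "0 < vol m" for m using \<omega> \<delta>[of m] by (simp add: vol_def)
  have emb: "emeasure lborel (ball x (\<delta> m)) = ennreal (vol m)" for x :: 'a and m
    using \<delta>[of m] by (simp add: emeasure_ball vol_def \<omega>_def n_def powr_realpow)
  define I where "I k m i = (\<integral>y. indicator (ball (d i) (\<delta> m)) y * u k y \<partial>lborel)" for k m i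
  \<comment> \<open>On the ball \<open>\<bar>u\<bar>\<close> is at most
    \<open>1 + \<bar>u\<bar> powr q\<close>, which bounds the integrals uniformly in k and in the
    centre.\<close>
  have abs_int: "(\<integral>\<^sup>+y. ennreal (norm (indicator (ball x (\<delta> m)) y * u k y)) \<partial>lborel) \<le> ennreal (vol m + Q)"
    for x :: 'a and k m
  proof -
    have "(\<integral>\<^sup>+y. ennreal (norm (indicator (ball x (\<delta> m)) y * u k y)) \<partial>lborel) \<le>
       (\<integral>\<^sup>+y. indicator (ball x (\<delta> m)) y + ennreal (\<bar>u k y\<bar> powr q) \<partial>lborel)"
    proof (intro nn_integral_mono)
      fix y
      have "\<bar>u k y\<bar> \<le> 1 + \<bar>u k y\<bar> powr q"
        using powr_Young[of q 1 "\<bar>u k y\<bar>"] q by simp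
      then have "ennreal \<bar>u k y\<bar> \<le> ennreal (1 + \<bar>u k y\<bar> powr q)"
        by (rule ennreal_leI)
      then show "ennreal (norm (indicator (ball x (\<delta> m)) y * u k y)) \<le>
          indicator (ball x (\<delta> m)) y + ennreal (\<bar>u k y\<bar> powr q)"
        by (auto simp: indicator_def)
    qed
    also have "\<dots> = ennreal (vol m) + (\<integral>\<^sup>+y. ennreal (\<bar>u k y\<bar> powr q) \<partial>lborel)"
      by (subst nn_integral_add) (auto simp: emb)
    also have "\<dots> \<le> ennreal (vol m) + ennreal Q"
      by (intro add_left_mono uQ)
    finally show ?thesis using vol[of m] Q by simp
  qed
  have int: "integrable lborel (\<lambda>y. indicator (ball x (\<delta> m)) y * u k y)" for x :: 'a and k m
    using abs_int[of x m k] by (intro integrableI_bounded) (auto simp: le_less_trans)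
  have I: "\<bar>I k m i\<bar> \<le> vol m + Q" for k m i
  proof -
    have "ennreal (norm (I k m i)) \<le> ennreal (vol m + Q)"
      unfolding I_def using integral_norm_bound_ennreal[OF int] abs_int order_trans by blast
    then show ?thesis using vol[of m] Q by (subst (asm) ennreal_le_iff) auto
  qed
  \<comment> \<open>Dividing by \<open>vol m + Q\<close> makes the bound uniform in m as well, as
    the diagonal argument for countable families requires. The factor is undone below.\<close>
  have "norm (case mi of (m, i) \<Rightarrow> I k m i / (vol m + Q)) \<le> 1" for k mi
    using I[of k "fst mi" "snd mi"] vol[of "fst mi"] Q by (auto simp: split_beta)
  then have "\<exists>\<kappa>. strict_mono \<kappa> \<and>
      (\<forall>mi. \<exists>l. (\<lambda>k. case mi of (m, i) \<Rightarrow> I (\<kappa> k) m i / (vol m + Q)) \<longlonglongrightarrow> l)"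
    by (rule_tac function_convergent_subsequence[of UNIV
          "\<lambda>k mi. case mi of (m, i) \<Rightarrow> I k m i / (vol m + Q)" 1]) blast+
  then obtain \<kappa> where \<kappa>: "strict_mono \<kappa>"
    and conv: "\<And>mi. \<exists>l. (\<lambda>k. case mi of (m, i) \<Rightarrow> I (\<kappa> k) m i / (vol m + Q)) \<longlonglongrightarrow> l"
    by blast
  have "\<exists>l. (\<lambda>k. I (\<kappa> k) m i / vol m) \<longlonglongrightarrow> l" for m i
  proof -
    obtain l where "(\<lambda>k. I (\<kappa> k) m i / (vol m + Q)) \<longlonglongrightarrow> l"
      using conv[of "(m, i)"] by auto
    then have "(\<lambda>k. I (\<kappa> k) m i / (vol m + Q) * ((vol m + Q) / vol m)) \<longlonglongrightarrow> l * ((vol m + Q) / vol m)"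
      by (rule tendsto_mult_right)
    then show ?thesis using vol[of m] Q by auto
  qed
  then obtain l where l: "\<And>m i. (\<lambda>k. I (\<kappa> k) m i / vol m) \<longlonglongrightarrow> l m i"
    by metis
  \<comment> \<open>Taking the first suitable centre makes \<open>idx m\<close> a measurable
    function of x with countably many values. The ball around this centre lies in
    \<open>ball x (2 * \<delta> m)\<close>.\<close>
  define idx where "idx m x = (LEAST i. dist (d i) x < \<delta> m)" for m x
  have idx: "dist (d (idx m x)) x < \<delta> m" for m x
    unfolding idx_def using dense[OF \<delta>] by (rule LeastI_ex)
  have [measurable]: "idx m \<in> measurable borel (count_space UNIV)" for m
    unfolding idx_def by measurable
  define T where "T k m x = I k m (idx m x) / vol m" for k m x
  define L where "L m x = l m (idx m x)" for m x
  have [measurable]: "T k m \<in> borel_measurable borel" "L m \<in> borel_measurable borel" for k m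
    unfolding T_def L_def by measurable
  define c where "c = C * 2 powr (n + s) / \<omega>"
  have c: "0 \<le> c" using C \<omega> by (simp add: c_def)
  have dev: "\<bar>u k x - T k m x\<bar> \<le> c * \<delta> m powr s * g k x"
    if good_x: "\<forall>\<delta>>0. osc (u k) x \<delta> \<le> ennreal (C * \<delta> powr (n + s) * g k x)" for k m x
  proof -
    define Bx where "Bx = ball (d (idx m x)) (\<delta> m)"
    have [measurable]: "Bx \<in> sets borel" by (simp add: Bx_def)
    have Bsub: "Bx \<subseteq> ball x (2 * \<delta> m)"
    proof
      fix y assume "y \<in> Bx"
      then show "y \<in> ball x (2 * \<delta> m)"
        using idx[of m x] dist_triangle[of x y "d (idx m x)"] by (simp add: Bx_def dist_commute)
    qed
    have intB: "integrable lborel (\<lambda>y. indicator Bx y :: real)"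
      by (simp add: Bx_def emb integrable_indicator_iff)
    have "u k x * vol m - I k m (idx m x) = (\<integral>y. indicator Bx y * u k x - indicator Bx y * u k y \<partial>lborel)"
      using int[of "d (idx m x)" m k] intB vol[of m]
      by (subst Bochner_Integration.integral_diff)
        (auto simp: I_def Bx_def measure_def emb)
    also have "\<dots> = (\<integral>y. indicator Bx y * (u k x - u k y) \<partial>lborel)"
      by (simp add: algebra_simps)
    finally have eq: "u k x * vol m - I k m (idx m x) = (\<integral>y. indicator Bx y * (u k x - u k y) \<partial>lborel)" .
    have "integrable lborel (\<lambda>y. indicator Bx y * u k x - indicator Bx y * u k y)"
      using int[of "d (idx m x)" m k] intB
      by (intro Bochner_Integration.integrable_diff integrable_mult_left) (auto simp: Bx_def)
    then have int': "integrable lborel (\<lambda>y. indicator Bx y * (u k x - u k y))"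
      by (simp add: algebra_simps)
    have "ennreal \<bar>u k x * vol m - I k m (idx m x)\<bar> \<le>
        (\<integral>\<^sup>+y. ennreal (norm (indicator Bx y * (u k x - u k y))) \<partial>lborel)"
      unfolding eq using integral_norm_bound_ennreal[OF int'] by simp
    also have "\<dots> \<le> osc (u k) x (2 * \<delta> m)"
      unfolding osc_def using Bsub
      by (intro nn_integral_mono) (auto simp: indicator_def subset_iff)
    also have "\<dots> \<le> ennreal (C * (2 * \<delta> m) powr (n + s) * g k x)"
      using good_x \<delta>[of m] by simp
    finally have "\<bar>u k x * vol m - I k m (idx m x)\<bar> \<le> C * (2 * \<delta> m) powr (n + s) * g k x"
      using C g1[of k x] by (subst (asm) ennreal_le_iff) auto
    then have "\<bar>u k x * vol m - I k m (idx m x)\<bar> / vol m \<le> C * (2 * \<delta> m) powr (n + s) * g k x / vol m"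
      using vol[of m] by (intro divide_right_mono) auto
    moreover have "u k x - T k m x = (u k x * vol m - I k m (idx m x)) / vol m"
      using vol[of m] by (simp add: T_def diff_divide_distrib)
    then have "\<bar>u k x * vol m - I k m (idx m x)\<bar> / vol m = \<bar>u k x - T k m x\<bar>"
      using vol[of m] by simp
    moreover have "C * (2 * \<delta> m) powr (n + s) * g k x / vol m = c * \<delta> m powr s * g k x"
      using vol[of m] \<delta>[of m] \<omega> by (simp add: c_def vol_def powr_mult powr_add field_simps)
    ultimately show ?thesis by simp
  qed
  have devw: "(\<integral>\<^sup>+x. ennreal \<bar>u k x - T k m x\<bar> * w x \<partial>lborel) \<le> ennreal (c * \<delta> m powr s * (W + 1))" for k m
  proof -
    have "(\<integral>\<^sup>+x. ennreal \<bar>u k x - T k m x\<bar> * w x \<partial>lborel) \<le>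
        (\<integral>\<^sup>+x. ennreal (c * \<delta> m powr s) * (ennreal (g k x) * w x) \<partial>lborel)"
    proof (intro nn_integral_mono_AE, use good[of k] in eventually_elim)
      case (elim x)
      have "ennreal \<bar>u k x - T k m x\<bar> \<le> ennreal (c * \<delta> m powr s) * ennreal (g k x)"
        using dev[OF elim, of m] c by (simp add: ennreal_leI flip: ennreal_mult')
      then show ?case
        by (simp add: mult_right_mono flip: mult.assoc)
    qed
    also have "\<dots> = ennreal (c * \<delta> m powr s) * (\<integral>\<^sup>+x. ennreal (g k x) * w x \<partial>lborel)"
      by (rule nn_integral_cmult) auto
    also have "\<dots> \<le> ennreal (c * \<delta> m powr s) * ennreal (W + 1)"
      by (intro mult_left_mono gw) auto
    also have "\<dots> = ennreal (c * \<delta> m powr s * (W + 1))"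
      using c W by (intro ennreal_mult[symmetric]) auto
    finally show ?thesis .
  qed
  have T_le: "\<bar>T k m x\<bar> \<le> (vol m + Q) / vol m" for k m x
    using I[of k m "idx m x"] vol[of m] by (simp add: T_def divide_right_mono)
  have T_lim: "(\<lambda>k. T (\<kappa> k) m x) \<longlonglongrightarrow> L m x" for m x
    unfolding T_def L_def by (rule l)
  have L_le: "\<bar>L m x\<bar> \<le> (vol m + Q) / vol m" for m x
    using T_le by (intro tendsto_upperbound[OF tendsto_rabs[OF T_lim]]) auto
  have Tw: "(\<lambda>k. \<integral>\<^sup>+x. ennreal \<bar>T (\<kappa> k) m x - L m x\<bar> * w x \<partial>lborel) \<longlonglongrightarrow> 0" for m
  proof -
    have "(\<lambda>k. \<integral>\<^sup>+x. ennreal \<bar>T (\<kappa> k) m x - L m x\<bar> * w x \<partial>lborel) \<longlonglongrightarrow> (\<integral>\<^sup>+x. 0 \<partial>(lborel :: 'a measure))"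
    proof (rule nn_integral_dominated_convergence[where w = "\<lambda>x. ennreal (2 * ((vol m + Q) / vol m)) * w x"])
      show "(\<integral>\<^sup>+x. ennreal (2 * ((vol m + Q) / vol m)) * w x \<partial>lborel) < \<infinity>"
        by (subst nn_integral_cmult) (auto simp: W ennreal_mult_less_top)
      show "AE x in lborel. ennreal \<bar>T (\<kappa> k) m x - L m x\<bar> * w x \<le> ennreal (2 * ((vol m + Q) / vol m)) * w x" for k
      proof (intro always_eventually allI mult_right_mono ennreal_leI)
        show "\<bar>T (\<kappa> k) m x - L m x\<bar> \<le> 2 * ((vol m + Q) / vol m)" for x
          using T_le[of "\<kappa> k" m x] L_le[of m x] by linarith
      qed auto
      show "AE x in lborel. (\<lambda>k. ennreal \<bar>T (\<kappa> k) m x - L m x\<bar> * w x) \<longlonglongrightarrow> 0"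
      proof (intro always_eventually allI)
        fix x
        have "(\<lambda>k. \<bar>T (\<kappa> k) m x - L m x\<bar>) \<longlonglongrightarrow> 0"
          using T_lim by (simp add: LIM_zero tendsto_rabs_zero)
        then have "(\<lambda>k. ennreal \<bar>T (\<kappa> k) m x - L m x\<bar>) \<longlonglongrightarrow> ennreal 0"
          by (rule tendsto_ennrealI)
        moreover have "w x \<noteq> \<infinity>"
          using w[of x] by (metis ennreal_one_neq_top infinity_ennreal_def top_unique)
        ultimately have "(\<lambda>k. w x * ennreal \<bar>T (\<kappa> k) m x - L m x\<bar>) \<longlonglongrightarrow> w x * ennreal 0"
          by (intro ennreal_tendsto_cmult) (auto simp: less_top)
        then show "(\<lambda>k. ennreal \<bar>T (\<kappa> k) m x - L m x\<bar> * w x) \<longlonglongrightarrow> 0"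
          by (simp add: mult.commute)
      qed
    qed auto
    then show ?thesis by simp
  qed
  \<comment> \<open>The scale m is fixed first, from a bound uniform in k; \<open>N\<close> may then
    depend on m. Each of the four terms receives e / 4.\<close>
  have "\<exists>N. \<forall>i\<ge>N. \<forall>j\<ge>N. (\<integral>\<^sup>+x. ennreal \<bar>(u \<circ> \<kappa>) i x - (u \<circ> \<kappa>) j x\<bar> * w x \<partial>lborel) \<le> ennreal e"
    if e: "0 < e" for e :: real
  proof -
    have "(\<lambda>m. c * \<delta> m powr s * (W + 1)) \<longlonglongrightarrow> c * 0 powr s * (W + 1)"
      unfolding \<delta>_def using s
      by (intro tendsto_intros tendsto_powr' LIMSEQ_Suc[OF lim_1_over_n]) auto
    then have "\<forall>\<^sub>F m in sequentially. c * \<delta> m powr s * (W + 1) < e / 4"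
      using e by (intro order_tendstoD(2)) auto
    then obtain m where m: "c * \<delta> m powr s * (W + 1) < e / 4"
      by (auto simp: eventually_sequentially)
    have "\<forall>\<^sub>F k in sequentially. (\<integral>\<^sup>+x. ennreal \<bar>T (\<kappa> k) m x - L m x\<bar> * w x \<partial>lborel) < ennreal (e / 4)"
      using e by (intro order_tendstoD(2)[OF Tw]) auto
    then obtain N where N: "\<And>k. N \<le> k \<Longrightarrow> (\<integral>\<^sup>+x. ennreal \<bar>T (\<kappa> k) m x - L m x\<bar> * w x \<partial>lborel) < ennreal (e / 4)"
      by (auto simp: eventually_sequentially)
    define a where "a i x = ennreal \<bar>u (\<kappa> i) x - T (\<kappa> i) m x\<bar> * w x" for i x
    define b where "b i x = ennreal \<bar>T (\<kappa> i) m x - L m x\<bar> * w x" for i x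
    have [measurable]: "a i \<in> borel_measurable borel" "b i \<in> borel_measurable borel" for i
      unfolding a_def b_def by measurable
    have a_le: "(\<integral>\<^sup>+x. a i x \<partial>lborel) \<le> ennreal (e / 4)" for i
      unfolding a_def using devw[of "\<kappa> i" m] m by (meson ennreal_leI less_imp_le order_trans)
    have b_le: "(\<integral>\<^sup>+x. b i x \<partial>lborel) \<le> ennreal (e / 4)" if "N \<le> i" for i
      unfolding b_def using N[OF that] by simp
    show ?thesis
    proof (intro exI allI impI)
      fix i j assume ij: "N \<le> i" "N \<le> j"
      have "(\<integral>\<^sup>+x. ennreal \<bar>(u \<circ> \<kappa>) i x - (u \<circ> \<kappa>) j x\<bar> * w x \<partial>lborel) \<le>
          (\<integral>\<^sup>+x. (a i x + b i x) + (a j x + b j x) \<partial>lborel)"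
      proof (intro nn_integral_mono)
        fix x
        have "ennreal \<bar>(u \<circ> \<kappa>) i x - (u \<circ> \<kappa>) j x\<bar> \<le> ennreal ((\<bar>u (\<kappa> i) x - T (\<kappa> i) m x\<bar> + \<bar>T (\<kappa> i) m x - L m x\<bar>) +
           (\<bar>u (\<kappa> j) x - T (\<kappa> j) m x\<bar> + \<bar>T (\<kappa> j) m x - L m x\<bar>))"
          unfolding o_def by (intro ennreal_leI) linarith
        then have "ennreal \<bar>(u \<circ> \<kappa>) i x - (u \<circ> \<kappa>) j x\<bar> * w x \<le> ennreal ((\<bar>u (\<kappa> i) x - T (\<kappa> i) m x\<bar> + \<bar>T (\<kappa> i) m x - L m x\<bar>) +
           (\<bar>u (\<kappa> j) x - T (\<kappa> j) m x\<bar> + \<bar>T (\<kappa> j) m x - L m x\<bar>)) * w x"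
          by (rule mult_right_mono) simp
        then show "ennreal \<bar>(u \<circ> \<kappa>) i x - (u \<circ> \<kappa>) j x\<bar> * w x \<le> (a i x + b i x) + (a j x + b j x)"
          by (simp add: a_def b_def distrib_right)
      qed
      also have "\<dots> = ((\<integral>\<^sup>+x. a i x \<partial>lborel) + (\<integral>\<^sup>+x. b i x \<partial>lborel)) +
          ((\<integral>\<^sup>+x. a j x \<partial>lborel) + (\<integral>\<^sup>+x. b j x \<partial>lborel))"
        by (simp add: nn_integral_add)
      also have "\<dots> \<le> (ennreal (e / 4) + ennreal (e / 4)) + (ennreal (e / 4) + ennreal (e / 4))"
        by (intro add_mono a_le b_le ij)
      also have "\<dots> = ennreal e"
        using e by (simp flip: ennreal_plus)
      finally show "(\<integral>\<^sup>+x. ennreal \<bar>(u \<circ> \<kappa>) i x - (u \<circ> \<kappa>) j x\<bar> * w x \<partial>lborel) \<le> ennreal e" .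
    qed
  qed
  then obtain \<rho> where "strict_mono \<rho>" "AE x in lborel. convergent (\<lambda>k. (u \<circ> \<kappa>) (\<rho> k) x)"
    using AE_convergent_subseq_of_L1_Cauchy[of "u \<circ> \<kappa>" lborel w] w by auto
  with \<kappa> show ?thesis
    by (intro exI[of _ "\<kappa> \<circ> \<rho>"]) (auto simp: strict_mono_o)
qed

subsection \<open>Weighted Lebesgue norms and the Gagliardo seminorm\<close>

lemma enn_powr_ennreal: "0 \<le> x \<Longrightarrow> enn_powr (ennreal x) a = ennreal (x powr a)"
  by (simp add: enn_powr_def)

lemma enn_powr_le_iff:
  assumes "0 < a" "0 \<le> c"
  shows "enn_powr x (1 / a) \<le> ennreal c \<longleftrightarrow> x \<le> ennreal (c powr a)"
proof (cases x)
  case (real y)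
  have "y powr (1 / a) \<le> c \<longleftrightarrow> y \<le> c powr a"
  proof
    assume "y powr (1 / a) \<le> c"
    then have "(y powr (1 / a)) powr a \<le> c powr a"
      using assms by (intro powr_mono2) auto
    then show "y \<le> c powr a" using assms real by (simp add: powr_powr)
  next
    assume "y \<le> c powr a"
    then have "y powr (1 / a) \<le> (c powr a) powr (1 / a)"
      using assms real by (intro powr_mono2) auto
    then show "y powr (1 / a) \<le> c" using assms by (simp add: powr_powr)
  qed
  then show ?thesis
    using real assms by (simp add: enn_powr_ennreal)
qed (simp add: enn_powr_def top_unique)

text \<open>Common form of the weighted norms and, with differences
  \<open>u (fst z) - u (snd z)\<close> on the product space, of the Gagliardo seminorm for finite p.
  The triangle inequality, homogeneity and Fatou's lemma are thus proved once for both.\<close>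

definition lpn :: "'a measure \<Rightarrow> real \<Rightarrow> ('a \<Rightarrow> real) \<Rightarrow> ('a \<Rightarrow> real) \<Rightarrow> ennreal" where
  "lpn M p k f = enn_powr (\<integral>\<^sup>+x. ennreal (\<bar>f x\<bar> powr p * k x) \<partial>M) (1 / p)"

lemma weighted_norm_eq_lpn: "weighted_norm r K u = lpn lebesgue r K u"
  by (simp add: weighted_norm_def lpn_def)

lemma lpn_le_iff:
  "0 < p \<Longrightarrow> 0 \<le> c \<Longrightarrow>
    lpn M p k f \<le> ennreal c \<longleftrightarrow> (\<integral>\<^sup>+x. ennreal (\<bar>f x\<bar> powr p * k x) \<partial>M) \<le> ennreal (c powr p)"
  unfolding lpn_def by (rule enn_powr_le_iff)

lemma lpn_le_1_iff:
  "0 < p \<Longrightarrow> lpn M p k f \<le> 1 \<longleftrightarrow> (\<integral>\<^sup>+x. ennreal (\<bar>f x\<bar> powr p * k x) \<partial>M) \<le> 1"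
  using lpn_le_iff[of p 1] by simp

lemma lpn_cong_AE:
  assumes "AE x in M. f x = g x"
  shows "lpn M p k f = lpn M p k g"
  using assms unfolding lpn_def
  by (intro arg_cong[where f = "\<lambda>I. enn_powr I (1 / p)"] nn_integral_cong_AE) auto

lemma lpn_zero_fun [simp]: "0 < p \<Longrightarrow> lpn M p k (\<lambda>_. 0) = 0"
  by (simp add: lpn_def enn_powr_def)

lemma lpn_cmult_le:
  assumes [measurable]: "f \<in> borel_measurable M" "k \<in> borel_measurable M" and p: "0 < p"
  shows "lpn M p k (\<lambda>x. c * f x) \<le> ennreal \<bar>c\<bar> * lpn M p k f"
proof (cases "lpn M p k f")
  case (real a)
  have "(\<integral>\<^sup>+x. ennreal (\<bar>c * f x\<bar> powr p * k x) \<partial>M) =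
      (\<integral>\<^sup>+x. ennreal (\<bar>c\<bar> powr p) * ennreal (\<bar>f x\<bar> powr p * k x) \<partial>M)"
    by (intro nn_integral_cong) (simp add: abs_mult powr_mult mult.assoc flip: ennreal_mult')
  also have "\<dots> = ennreal (\<bar>c\<bar> powr p) * (\<integral>\<^sup>+x. ennreal (\<bar>f x\<bar> powr p * k x) \<partial>M)"
    by (rule nn_integral_cmult) measurable
  also have "\<dots> \<le> ennreal (\<bar>c\<bar> powr p) * ennreal (a powr p)"
    using real p lpn_le_iff[of p a M k f] by (intro mult_left_mono) auto
  also have "\<dots> = ennreal ((\<bar>c\<bar> * a) powr p)"
    using real by (simp add: powr_mult ennreal_mult)
  finally have "lpn M p k (\<lambda>x. c * f x) \<le> ennreal (\<bar>c\<bar> * a)"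
    using real p by (subst lpn_le_iff) auto
  then show ?thesis
    using real by (simp add: ennreal_mult)
next
  case top
  show ?thesis
  proof (cases "c = 0")
    case False
    then show ?thesis using top by (simp add: ennreal_mult_top)
  qed (use p in simp)
qed

text \<open>Convexity of the p-th power at the points \<open>x / a\<close> and \<open>y / b\<close>
  with weights \<open>a / (a + b)\<close> and \<open>b / (a + b)\<close>. If a and b bound the norms
  of two functions, integration turns the right side into \<open>(a + b) powr p\<close>, which is
  Minkowski's inequality.\<close>

lemma powr_add_le_weighted:
  fixes a b x y p :: real
  assumes "1 \<le> p" "0 < a" "0 < b" "0 \<le> x" "0 \<le> y"
  shows "(x + y) powr p \<le> (a + b) powr (p - 1) * (a powr (1 - p) * x powr p + b powr (1 - p) * y powr p)"
proof -
  \<comment> \<open>Settles x = 0 and y = 0, where one term suffices; convexity is then applied at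
    positive points only.\<close>
  have single: "z powr p \<le> (a + b) powr (p - 1) * (d powr (1 - p) * z powr p)"
    if "d = a \<or> d = b" for z d
  proof -
    have d: "0 < d" "d \<le> a + b" using that assms by auto
    have "1 = d powr (p - 1) * d powr (1 - p)"
      using d by (simp flip: powr_add)
    also have "\<dots> \<le> (a + b) powr (p - 1) * d powr (1 - p)"
      using d assms by (intro mult_right_mono powr_mono2) auto
    finally have "1 * z powr p \<le> (a + b) powr (p - 1) * d powr (1 - p) * z powr p"
      by (intro mult_right_mono) auto
    then show ?thesis by (simp add: mult.assoc)
  qed
  consider "x = 0" | "y = 0" | "0 < x" "0 < y"
    using assms by linarith
  then show ?thesis
  proof cases
    case 3
    define t where "t = b / (a + b)"
    have t: "0 \<le> t" "t \<le> 1" "1 - t = a / (a + b)"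
      using assms by (auto simp: t_def field_simps)
    have "((1 - t) *\<^sub>R (x / a) + t *\<^sub>R (y / b)) powr p \<le> (1 - t) * (x / a) powr p + t * (y / b) powr p"
      using convex_onD[OF powr_convex[OF assms(1)] t(1,2), of "x / a" "y / b"] 3 assms by simp
    also have "(1 - t) *\<^sub>R (x / a) + t *\<^sub>R (y / b) = (x + y) / (a + b)"
      unfolding t(3) using assms by (simp add: t_def add_divide_distrib)
    finally have "(x + y) powr p / (a + b) powr p \<le> (1 - t) * (x / a) powr p + t * (y / b) powr p"
      using assms by (simp add: powr_divide)
    then have "(x + y) powr p \<le> (a + b) powr p * ((1 - t) * (x / a) powr p + t * (y / b) powr p)"
      using assms by (simp add: field_simps)
    also have "\<dots> = (a + b) powr (p - 1) * (a * (x / a) powr p + b * (y / b) powr p)"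
    proof -
      have "(a + b) * (a / (a + b) * X + b / (a + b) * Y) = a * X + b * Y" for X Y
        using assms by (simp add: distrib_left)
      moreover have "(a + b) powr p = (a + b) powr (p - 1) * (a + b)"
        using assms by (simp add: powr_diff)
      ultimately show ?thesis
        unfolding t(3) unfolding t_def by (simp only: mult.assoc)
    qed
    also have "a * (x / a) powr p = a powr (1 - p) * x powr p"
      using assms by (simp add: powr_divide powr_diff)
    also have "b * (y / b) powr p = b powr (1 - p) * y powr p"
      using assms by (simp add: powr_divide powr_diff)
    finally show ?thesis .
  qed (use single[of a x] single[of b y] assms in auto)
qed

lemma lpn_triangle:
  assumes [measurable]: "f \<in> borel_measurable M" "g \<in> borel_measurable M" "k \<in> borel_measurable M"
    and k: "\<And>x. 0 \<le> k x" and p: "1 \<le> p"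
  shows "lpn M p k (\<lambda>x. f x + g x) \<le> lpn M p k f + lpn M p k g"
proof (cases "lpn M p k f = \<infinity> \<or> lpn M p k g = \<infinity>")
  case False
  then obtain a0 b0 where ab: "0 \<le> a0" "lpn M p k f = ennreal a0" "0 \<le> b0" "lpn M p k g = ennreal b0"
    by (metis ennreal_cases infinity_ennreal_def)
  show ?thesis
  proof (rule ennreal_le_epsilon)
    fix e :: real assume e: "0 < e"
    \<comment> \<open>The norms may be 0, whereas \<open>powr_add_le_weighted\<close> needs positive
      weights; hence the extra e / 2.\<close>
    define a where "a = a0 + e / 2"
    define b where "b = b0 + e / 2"
    have a: "0 < a" and b: "0 < b" using ab e by (auto simp: a_def b_def)
    have fa: "(\<integral>\<^sup>+x. ennreal (\<bar>f x\<bar> powr p * k x) \<partial>M) \<le> ennreal (a powr p)"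
      using ab a e p by (subst lpn_le_iff[symmetric]) (auto simp: a_def intro: ennreal_leI)
    have gb: "(\<integral>\<^sup>+x. ennreal (\<bar>g x\<bar> powr p * k x) \<partial>M) \<le> ennreal (b powr p)"
      using ab b e p by (subst lpn_le_iff[symmetric]) (auto simp: b_def intro: ennreal_leI)
    define A where "A = (a + b) powr (p - 1) * a powr (1 - p)"
    define B where "B = (a + b) powr (p - 1) * b powr (1 - p)"
    have AB: "0 \<le> A" "0 \<le> B" by (auto simp: A_def B_def)
    have "(\<integral>\<^sup>+x. ennreal (\<bar>f x + g x\<bar> powr p * k x) \<partial>M) \<le>
      (\<integral>\<^sup>+x. ennreal A * ennreal (\<bar>f x\<bar> powr p * k x) + ennreal B * ennreal (\<bar>g x\<bar> powr p * k x) \<partial>M)"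
    proof (intro nn_integral_mono)
      fix x
      have "\<bar>f x + g x\<bar> powr p \<le> (\<bar>f x\<bar> + \<bar>g x\<bar>) powr p"
        using p by (intro powr_mono2) auto
      also have "\<dots> \<le> A * \<bar>f x\<bar> powr p + B * \<bar>g x\<bar> powr p"
        using powr_add_le_weighted[OF p a b, of "\<bar>f x\<bar>" "\<bar>g x\<bar>"]
        by (simp add: A_def B_def algebra_simps)
      finally have "\<bar>f x + g x\<bar> powr p * k x \<le> (A * \<bar>f x\<bar> powr p + B * \<bar>g x\<bar> powr p) * k x"
        using k by (rule mult_right_mono)
      then have "ennreal (\<bar>f x + g x\<bar> powr p * k x) \<le>
          ennreal (A * (\<bar>f x\<bar> powr p * k x) + B * (\<bar>g x\<bar> powr p * k x))"
        by (intro ennreal_leI) (simp add: algebra_simps)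
      also have "\<dots> = ennreal A * ennreal (\<bar>f x\<bar> powr p * k x) + ennreal B * ennreal (\<bar>g x\<bar> powr p * k x)"
        using AB k by (simp add: ennreal_mult)
      finally show "ennreal (\<bar>f x + g x\<bar> powr p * k x) \<le>
          ennreal A * ennreal (\<bar>f x\<bar> powr p * k x) + ennreal B * ennreal (\<bar>g x\<bar> powr p * k x)" .
    qed
    also have "\<dots> = ennreal A * (\<integral>\<^sup>+x. ennreal (\<bar>f x\<bar> powr p * k x) \<partial>M) +
        ennreal B * (\<integral>\<^sup>+x. ennreal (\<bar>g x\<bar> powr p * k x) \<partial>M)"
      by (simp add: nn_integral_add nn_integral_cmult)
    also have "\<dots> \<le> ennreal A * ennreal (a powr p) + ennreal B * ennreal (b powr p)"
      by (intro add_mono mult_left_mono fa gb) auto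
    also have "\<dots> = ennreal (A * a powr p + B * b powr p)"
      using AB by (simp add: ennreal_mult)
    also have "A * a powr p + B * b powr p =
        (a + b) powr (p - 1) * (a powr (1 - p) * a powr p + b powr (1 - p) * b powr p)"
      by (simp add: A_def B_def algebra_simps)
    also have "\<dots> = (a + b) powr (p - 1) * (a + b) powr 1"
      using a b by (simp flip: powr_add)
    also have "\<dots> = (a + b) powr p"
      by (subst powr_add[symmetric]) simp
    finally have "lpn M p k (\<lambda>x. f x + g x) \<le> ennreal (a + b)"
      using p a b by (subst lpn_le_iff) auto
    also have "ennreal (a + b) = lpn M p k f + lpn M p k g + ennreal e"
      using ab e by (simp add: a_def b_def flip: ennreal_plus)
    finally show "lpn M p k (\<lambda>x. f x + g x) \<le> lpn M p k f + lpn M p k g + ennreal e" .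
  qed
qed auto

text \<open>Carries norm bounds over to almost everywhere limits, which are not test functions
  themselves.\<close>

lemma lpn_Fatou:
  assumes [measurable]: "\<And>j. f j \<in> borel_measurable M" "k \<in> borel_measurable M" and p: "0 < p"
    and lim: "AE x in M. (\<lambda>j. f j x) \<longlonglongrightarrow> g x"
    and le: "\<forall>\<^sub>F j in sequentially. lpn M p k (f j) \<le> c"
  shows "lpn M p k g \<le> c"
proof (cases c)
  case (real a)
  have "(\<integral>\<^sup>+x. ennreal (\<bar>g x\<bar> powr p * k x) \<partial>M) =
      (\<integral>\<^sup>+x. liminf (\<lambda>j. ennreal (\<bar>f j x\<bar> powr p * k x)) \<partial>M)"
  proof (intro nn_integral_cong_AE, use lim in eventually_elim)
    case (elim x)
    then have "(\<lambda>j. ennreal (\<bar>f j x\<bar> powr p * k x)) \<longlonglongrightarrow> ennreal (\<bar>g x\<bar> powr p * k x)"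
      using p by (intro tendsto_ennrealI tendsto_intros tendsto_powr') auto
    then show ?case
      by (simp add: lim_imp_Liminf)
  qed
  also have "\<dots> \<le> liminf (\<lambda>j. \<integral>\<^sup>+x. ennreal (\<bar>f j x\<bar> powr p * k x) \<partial>M)"
    by (rule nn_integral_liminf) measurable
  also have "\<dots> \<le> liminf (\<lambda>j :: nat. ennreal (a powr p))"
    using le real p by (intro Liminf_mono) (auto simp: lpn_le_iff elim: eventually_mono)
  also have "\<dots> = ennreal (a powr p)"
    by (simp add: Liminf_const)
  finally show ?thesis
    using real p by (simp add: lpn_le_iff)
qed simp

lemma lpn_eq_0_iff:
  assumes [measurable]: "f \<in> borel_measurable M" "k \<in> borel_measurable M"
    and k: "\<And>x. 0 < k x" and p: "0 < p"
  shows "lpn M p k f = 0 \<longleftrightarrow> (AE x in M. f x = 0)"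
proof -
  have "lpn M p k f = 0 \<longleftrightarrow> (\<integral>\<^sup>+x. ennreal (\<bar>f x\<bar> powr p * k x) \<partial>M) = 0"
    using lpn_le_iff[of p 0 M k f] p by simp
  also have "\<dots> \<longleftrightarrow> (AE x in M. ennreal (\<bar>f x\<bar> powr p * k x) = 0)"
    by (rule nn_integral_0_iff_AE) measurable
  also have "\<dots> \<longleftrightarrow> (AE x in M. f x = 0)"
  proof (intro AE_cong)
    fix x
    show "ennreal (\<bar>f x\<bar> powr p * k x) = 0 \<longleftrightarrow> f x = 0"
      using k[of x] by (cases "f x = 0") (auto simp: ennreal_eq_0_iff mult_le_0_iff)
  qed
  finally show ?thesis .
qed

section \<open>The Gagliardo seminorm: norm rules and lower semicontinuity\<close>

lemma borel_measurable_lebesgueI: "f \<in> borel_measurable borel \<Longrightarrow> f \<in> borel_measurable lebesgue"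
  by (intro measurable_completion) simp

lemma gagliardo_seminorm_finite:
  fixes u :: "real^'n \<Rightarrow> real"
  assumes [measurable]: "u \<in> borel_measurable borel" and p: "p \<noteq> \<infinity>"
  shows "gagliardo_seminorm s p u = lpn (lborel \<Otimes>\<^sub>M lborel) (enn2real p)
    (\<lambda>z. 1 / norm (fst z - snd z) powr (real CARD('n) + s * enn2real p))
    (\<lambda>z. u (fst z) - u (snd z))"
proof -
  define F where "F z = ennreal (\<bar>u (fst z) - u (snd z)\<bar> powr enn2real p *
     (1 / norm (fst z - snd z) powr (real CARD('n) + s * enn2real p)))" for z
  have [measurable]: "F \<in> borel_measurable (lborel \<Otimes>\<^sub>M lborel)"
    unfolding F_def by measurable
  have "(\<integral>\<^sup>+x. \<integral>\<^sup>+y. F (x, y) \<partial>lebesgue \<partial>lebesgue) = (\<integral>\<^sup>+z. F z \<partial>(lborel \<Otimes>\<^sub>M lborel))"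
    unfolding nn_integral_completion
    by (rule sigma_finite_measure.nn_integral_fst[OF sigma_finite_lborel]) measurable
  then show ?thesis
    using p by (simp add: gagliardo_seminorm_def lpn_def F_def)
qed

lemma gagliardo_seminorm_infinity_le_iff:
  assumes "0 \<le> c"
  shows "gagliardo_seminorm s \<infinity> u \<le> ennreal c \<longleftrightarrow> (\<forall>x y. \<bar>u x - u y\<bar> \<le> c * norm (x - y) powr s)"
proof -
  have "gagliardo_seminorm s \<infinity> u \<le> ennreal c \<longleftrightarrow>
      (\<forall>x y. x \<noteq> y \<longrightarrow> \<bar>u x - u y\<bar> / norm (x - y) powr s \<le> c)"
    using assms by (auto simp: gagliardo_seminorm_def SUP_le_iff)
  also have "\<dots> \<longleftrightarrow> (\<forall>x y. x \<noteq> y \<longrightarrow> \<bar>u x - u y\<bar> \<le> c * norm (x - y) powr s)"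
    by (simp add: pos_divide_le_eq)
  also have "\<dots> \<longleftrightarrow> (\<forall>x y. \<bar>u x - u y\<bar> \<le> c * norm (x - y) powr s)"
    by (metis abs_zero diff_self norm_zero powr_0 mult_zero_right order.refl)
  finally show ?thesis .
qed

lemma enn2real_ge_1: "1 \<le> p \<Longrightarrow> p \<noteq> \<infinity> \<Longrightarrow> 1 \<le> enn2real p"
  by (cases p) (auto simp: top_unique)

lemma gagliardo_seminorm_triangle:
  fixes u v :: "real^'n \<Rightarrow> real"
  assumes [measurable]: "u \<in> borel_measurable borel" "v \<in> borel_measurable borel" and p: "1 \<le> p"
  shows "gagliardo_seminorm s p (\<lambda>x. u x + v x) \<le> gagliardo_seminorm s p u + gagliardo_seminorm s p v"
proof (cases "p = \<infinity>")
  case True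
  show ?thesis
  proof (cases "gagliardo_seminorm s p u = \<infinity> \<or> gagliardo_seminorm s p v = \<infinity>")
    case False
    then obtain a b where ab: "0 \<le> a" "gagliardo_seminorm s p u = ennreal a"
        "0 \<le> b" "gagliardo_seminorm s p v = ennreal b"
      by (metis ennreal_cases infinity_ennreal_def)
    then have uv: "\<bar>u x - u y\<bar> \<le> a * norm (x - y) powr s" "\<bar>v x - v y\<bar> \<le> b * norm (x - y) powr s" for x y
      using gagliardo_seminorm_infinity_le_iff[of a s u] gagliardo_seminorm_infinity_le_iff[of b s v]
      unfolding True by auto
    have "\<bar>(u x + v x) - (u y + v y)\<bar> \<le> (a + b) * norm (x - y) powr s" for x y
      using uv[of x y] by (simp add: algebra_simps)
    then have "gagliardo_seminorm s p (\<lambda>x. u x + v x) \<le> ennreal (a + b)"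
      unfolding True using ab by (subst gagliardo_seminorm_infinity_le_iff) auto
    then show ?thesis using ab by simp
  qed auto
next
  case False
  have "lpn (lborel \<Otimes>\<^sub>M lborel) (enn2real p) (\<lambda>z. 1 / norm (fst z - snd z) powr (real CARD('n) + s * enn2real p))
    (\<lambda>z. (u (fst z) - u (snd z)) + (v (fst z) - v (snd z))) \<le>
    gagliardo_seminorm s p u + gagliardo_seminorm s p v"
    unfolding gagliardo_seminorm_finite[OF assms(1) False] gagliardo_seminorm_finite[OF assms(2) False]
  proof (rule lpn_triangle)
    show "1 \<le> enn2real p" using enn2real_ge_1[OF p False] .
    show "0 \<le> 1 / norm (fst z - snd z) powr (real CARD('n) + s * enn2real p)" for z :: "(real^'n) \<times> (real^'n)"
      by simp
  qed measurable
  then show ?thesis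
    by (subst gagliardo_seminorm_finite) (use False in \<open>auto simp: algebra_simps\<close>)
qed

lemma gagliardo_seminorm_cmult_le:
  fixes u :: "real^'n \<Rightarrow> real"
  assumes [measurable]: "u \<in> borel_measurable borel" and p: "1 \<le> p"
  shows "gagliardo_seminorm s p (\<lambda>x. c * u x) \<le> ennreal \<bar>c\<bar> * gagliardo_seminorm s p u"
proof (cases "p = \<infinity>")
  case True
  show ?thesis
  proof (cases "gagliardo_seminorm s p u")
    case (real a)
    then have u: "\<bar>u x - u y\<bar> \<le> a * norm (x - y) powr s" for x y
      using gagliardo_seminorm_infinity_le_iff[of a s u] unfolding True by auto
    have "\<bar>c * u x - c * u y\<bar> \<le> \<bar>c\<bar> * a * norm (x - y) powr s" for x y
      using mult_left_mono[OF u[of x y], of "\<bar>c\<bar>"]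
      by (simp add: mult.assoc flip: abs_mult right_diff_distrib)
    then have "gagliardo_seminorm s p (\<lambda>x. c * u x) \<le> ennreal (\<bar>c\<bar> * a)"
      unfolding True using real by (subst gagliardo_seminorm_infinity_le_iff) auto
    then show ?thesis using real by (simp add: ennreal_mult)
  next
    case top
    show ?thesis
    proof (cases "c = 0")
      case True': True
      have "gagliardo_seminorm s p (\<lambda>x. c * u x) \<le> ennreal 0"
        unfolding True by (subst gagliardo_seminorm_infinity_le_iff) (auto simp: True')
      then show ?thesis by (simp add: True')
    qed (use top in \<open>simp add: ennreal_mult_top\<close>)
  qed
next
  case False
  have "lpn (lborel \<Otimes>\<^sub>M lborel) (enn2real p) (\<lambda>z. 1 / norm (fst z - snd z) powr (real CARD('n) + s * enn2real p))
    (\<lambda>z. c * (u (fst z) - u (snd z))) \<le> ennreal \<bar>c\<bar> * gagliardo_seminorm s p u"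
    unfolding gagliardo_seminorm_finite[OF assms(1) False]
  proof (rule lpn_cmult_le)
    show "0 < enn2real p" using enn2real_ge_1[OF p False] by simp
  qed measurable
  then show ?thesis
    by (subst gagliardo_seminorm_finite) (use False in \<open>auto simp: algebra_simps\<close>)
qed

lemma closure_eq_UNIV_of_AE:
  assumes "AE x in lborel. x \<in> (S :: 'a::euclidean_space set)"
  shows "closure S = UNIV"
proof (rule ccontr)
  assume "closure S \<noteq> UNIV"
  then obtain x where "x \<in> - closure S" by auto
  then obtain e where "0 < e" "ball x e \<subseteq> - closure S"
    using openE[of "- closure S" x] by (auto simp: open_Compl)
  then have "ball x e \<inter> S = {}"
    using closure_subset[of S] by blast
  then have "\<exists>y\<in>ball x e. y \<in> S \<and> True \<Longrightarrow> False" by auto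
  moreover have "\<exists>y\<in>ball x e. y \<in> S \<and> True"
    using \<open>0 < e\<close> by (intro ex_in_ball_of_small_complement assms) (auto simp: emeasure_ball)
  ultimately show False by blast
qed

text \<open>For finite p this is Fatou's lemma on the product space. For infinite p the bound is
  first known on pairs of points of convergence; these points form a dense set, and by continuity of
  \<open>v\<close> the bound is a closed condition on pairs.\<close>

lemma gagliardo_seminorm_Fatou:
  fixes w :: "nat \<Rightarrow> real^'n \<Rightarrow> real"
  assumes cont: "\<And>j. continuous_on UNIV (w j)" "continuous_on UNIV v" and p: "1 \<le> p"
    and lim: "AE x in lborel. (\<lambda>j. w j x) \<longlonglongrightarrow> v x"
    and le: "\<forall>\<^sub>F j in sequentially. gagliardo_seminorm s p (w j) \<le> c" and s: "0 < s"
  shows "gagliardo_seminorm s p v \<le> c"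
proof (cases "p = \<infinity>")
  case True
  show ?thesis
  proof (cases c)
    case (real a)
    then have a: "0 \<le> a" "c = ennreal a" by auto
    define S where "S = {x. (\<lambda>j. w j x) \<longlonglongrightarrow> v x}"
    have "\<forall>\<^sub>F j in sequentially. \<forall>x y. \<bar>w j x - w j y\<bar> \<le> a * norm (x - y) powr s"
      using le unfolding True a(2) gagliardo_seminorm_infinity_le_iff[OF a(1)] .
    then have *: "\<forall>\<^sub>F j in sequentially. \<bar>w j x - w j y\<bar> \<le> a * norm (x - y) powr s" for x y
      by eventually_elim auto
    have "\<bar>v (fst z) - v (snd z)\<bar> \<le> a * norm (fst z - snd z) powr s" if "z \<in> S \<times> S" for z
    proof (rule tendsto_upperbound)
      show "(\<lambda>j. \<bar>w j (fst z) - w j (snd z)\<bar>) \<longlonglongrightarrow> \<bar>v (fst z) - v (snd z)\<bar>"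
        using that by (intro tendsto_rabs tendsto_diff) (auto simp: S_def)
    qed (use * in auto)
    then have "S \<times> S \<subseteq> {z. \<bar>v (fst z) - v (snd z)\<bar> \<le> a * norm (fst z - snd z) powr s}"
      by auto
    moreover have "closed {z. \<bar>v (fst z) - v (snd z)\<bar> \<le> a * norm (fst z - snd z) powr s}"
    proof (intro closed_Collect_le)
      have "continuous_on UNIV (\<lambda>z. v (fst z))" "continuous_on UNIV (\<lambda>z. v (snd z))"
        by (rule continuous_on_compose2[OF cont(2)]; auto intro!: continuous_intros)+
      then show "continuous_on UNIV (\<lambda>z. \<bar>v (fst z) - v (snd z)\<bar>)"
        by (intro continuous_intros)
      show "continuous_on UNIV (\<lambda>z :: (real^'n) \<times> (real^'n). a * norm (fst z - snd z) powr s)"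
        \<comment> \<open>With \<open>0 < s\<close> the power is continuous also where the norm
          vanishes.\<close>
        using s by (intro continuous_on_mult continuous_on_const continuous_on_powr' continuous_intros) auto
    qed
    ultimately have "closure (S \<times> S) \<subseteq> {z. \<bar>v (fst z) - v (snd z)\<bar> \<le> a * norm (fst z - snd z) powr s}"
      by (rule closure_minimal)
    moreover have "closure S = UNIV"
      using lim by (intro closure_eq_UNIV_of_AE) (simp add: S_def)
    ultimately have "\<forall>x y. \<bar>v x - v y\<bar> \<le> a * norm (x - y) powr s"
      by (auto simp: closure_Times subset_iff)
    then show ?thesis
      unfolding True a(2) gagliardo_seminorm_infinity_le_iff[OF a(1)] .
  qed simp
next
  case False
  have [measurable]: "w j \<in> borel_measurable borel" "v \<in> borel_measurable borel" for j
    using cont by (auto intro: borel_measurable_continuous_onI)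
  have pr: "pair_sigma_finite (lborel :: (real^'n) measure) (lborel :: (real^'n) measure)"
    by (simp add: pair_sigma_finite_def sigma_finite_lborel)
  have ae: "AE z in lborel \<Otimes>\<^sub>M lborel. (\<lambda>j. w j (fst z)) \<longlonglongrightarrow> v (fst z) \<and> (\<lambda>j. w j (snd z)) \<longlonglongrightarrow> v (snd z)"
  proof (rule pair_sigma_finite.AE_pair_measure[OF pr])
    show "AE x in lborel. AE y in lborel. (\<lambda>j. w j (fst (x, y))) \<longlonglongrightarrow> v (fst (x, y)) \<and>
        (\<lambda>j. w j (snd (x, y))) \<longlonglongrightarrow> v (snd (x, y))"
      using lim by eventually_elim (use lim in auto)
  qed measurable
  show ?thesis
    unfolding gagliardo_seminorm_finite[OF \<open>v \<in> borel_measurable borel\<close> False]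
  proof (rule lpn_Fatou[where f = "\<lambda>j z. w j (fst z) - w j (snd z)"])
    show "AE z in lborel \<Otimes>\<^sub>M lborel. (\<lambda>j. w j (fst z) - w j (snd z)) \<longlonglongrightarrow> v (fst z) - v (snd z)"
      using ae by eventually_elim (auto intro: tendsto_diff)
    show "\<forall>\<^sub>F j in sequentially. lpn (lborel \<Otimes>\<^sub>M lborel) (enn2real p)
        (\<lambda>z. 1 / norm (fst z - snd z) powr (real CARD('n) + s * enn2real p))
        (\<lambda>z. w j (fst z) - w j (snd z)) \<le> c"
      using le by (subst (asm) gagliardo_seminorm_finite) (use False in auto)
    show "0 < enn2real p" using enn2real_ge_1[OF p False] by simp
  qed measurable
qed

subsection \<open>The weighted embedding\<close>

text \<open>The left-hand side is \<open>X powr a * Y powr b * W powr c\<close>, where \<open>X = z powr q * V\<close>, \<open>Y = z powr q'\<close>,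
  \<open>W = K powr \<psi> * V powr -\<tau>\<close> and \<open>a = \<tau> / \<psi>\<close>, \<open>c = 1 / \<psi>\<close>, \<open>a + b + c = 1\<close>; the bound on \<open>\<tau>\<close> says
  that \<open>b \<ge> 0\<close>.\<close>

lemma weighted_power_le:
  fixes K V z e :: real
  assumes K: "0 < K" and V: "0 < V" and z: "0 \<le> z" and e: "0 < e"
    and r: "0 < r" "r < q" and q': "q < q'" and \<tau>: "0 < \<tau>" "\<tau> \<le> r / (q - r)"
  defines "\<psi> \<equiv> psi q r q' \<tau>"
  shows "z powr r * K \<le> e * (z powr q * V + z powr q') + e powr (1 - \<psi>) * (K powr \<psi> * V powr (-\<tau>))"
proof (cases "z = 0")
  case True
  then show ?thesis using r q' K V e by simp
next
  case False
  then have z: "0 < z" using z by simp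
  have qr: "0 < q' - r" using r q' by simp
  have \<psi>_mult: "\<psi> * (q' - r) = q' + \<tau> * (q' - q)"
    using qr by (simp add: \<psi>_def psi_def)
  have "\<tau> * (q - r) \<le> r"
    using \<tau> r by (simp add: pos_le_divide_eq)
  then have "(1 + \<tau>) * (q' - r) \<le> \<psi> * (q' - r)"
    unfolding \<psi>_mult by (simp add: algebra_simps)
  then have \<psi>: "1 + \<tau> \<le> \<psi>"
    using qr by simp
  then have \<psi>0: "0 < \<psi>" "1 < \<psi>" using \<tau> by auto
  define a where "a = \<tau> / \<psi>"
  define b where "b = 1 - (1 + \<tau>) / \<psi>"
  define c where "c = 1 / \<psi>"
  have ab: "0 \<le> a" "0 \<le> b" "a + b = 1 - c" and c: "0 < c" "c < 1"
    using \<psi> \<psi>0 \<tau> by (auto simp: a_def b_def c_def field_simps)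
  have "\<psi> * (q * a + q' * b) = q * \<tau> + q' * (\<psi> - (1 + \<tau>))"
    using \<psi>0 by (simp add: a_def b_def field_simps)
  also have "\<dots> = \<psi> * r"
    using \<psi>_mult by (simp add: algebra_simps)
  \<comment> \<open>The formula for \<open>\<psi>\<close> is forced: the powers of z, V and K must
    come out as r, 0 and 1, and together with a + b + c = 1 this leaves
    \<open>c = (q' - r) / (q' + \<tau> * (q' - q))\<close>.\<close>
  finally have r_eq: "q * a + q' * b = r"
    using \<psi>0 by simp
  define X where "X = z powr q * V"
  define Y where "Y = z powr q'"
  define W where "W = K powr \<psi> * V powr (-\<tau>)"
  have X: "0 < X" and Y: "0 < Y" and W: "0 < W"
    using z K V by (auto simp: X_def Y_def W_def)
  have "X powr a * Y powr b * W powr c =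
      (z powr (q * a) * z powr (q' * b)) * (V powr a * V powr (- \<tau> * c)) * K powr (\<psi> * c)"
    using z K V by (simp add: X_def Y_def W_def powr_mult powr_powr)
  also have "z powr (q * a) * z powr (q' * b) = z powr r"
    by (simp add: r_eq flip: powr_add)
  also have "V powr a * V powr (- \<tau> * c) = 1"
    using V by (simp add: a_def c_def flip: powr_add)
  also have "K powr (\<psi> * c) = K"
    using K \<psi>0 by (simp add: c_def)
  finally have "z powr r * K = X powr a * Y powr b * W powr c"
    by simp
  also have "\<dots> \<le> (X + Y) powr a * (X + Y) powr b * W powr c"
    using X Y W ab c by (intro mult_mono powr_mono2 mult_nonneg_nonneg) auto
  also have "\<dots> = (X + Y) powr (1 - c) * W powr c"
    by (simp add: ab flip: powr_add)
  also have "\<dots> \<le> e * (X + Y) + e powr (1 - \<psi>) * W"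
  \<comment> \<open>Young's inequality with a small parameter. At the threshold
    \<open>W = e powr \<psi> * (X + Y)\<close> the product equals \<open>e * (X + Y)\<close>, since
    \<open>(e powr \<psi>) powr c = e\<close>.\<close>
  proof (cases "W \<le> e powr \<psi> * (X + Y)")
    case True
    have "(X + Y) powr (1 - c) * W powr c \<le> (X + Y) powr (1 - c) * (e powr \<psi> * (X + Y)) powr c"
      using True W c by (intro mult_left_mono powr_mono2) auto
    also have "\<dots> = e powr (\<psi> * c) * ((X + Y) powr (1 - c) * (X + Y) powr c)"
      using X Y by (simp add: powr_mult powr_powr)
    also have "\<dots> = e * (X + Y)"
      using X Y e \<psi>0 by (simp add: c_def flip: powr_add)
    finally show ?thesis using W by (smt (verit) mult_nonneg_nonneg powr_ge_zero)
  next
    case False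
    then have "X + Y \<le> e powr (- \<psi>) * W"
      using e by (simp add: powr_minus field_simps)
    then have "(X + Y) powr (1 - c) * W powr c \<le> (e powr (- \<psi>) * W) powr (1 - c) * W powr c"
      using X Y c by (intro mult_right_mono powr_mono2) auto
    also have "\<dots> = e powr (- \<psi> * (1 - c)) * (W powr (1 - c) * W powr c)"
      using W by (simp add: powr_mult powr_powr)
    also have "- \<psi> * (1 - c) = 1 - \<psi>"
      using \<psi>0 by (simp add: c_def algebra_simps)
    also have "W powr (1 - c) * W powr c = W"
      using W by (simp flip: powr_add)
    finally show ?thesis using X Y e by (smt (verit) mult_nonneg_nonneg)
  qed
  finally show ?thesis by (simp add: X_def Y_def W_def)
qed

locale weighted_embedding =
  fixes K V :: "real^'n \<Rightarrow> real" and p :: ennreal and s q r V\<^sub>0 q' \<tau> :: real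
  assumes p: "1 \<le> p" and s: "0 < s" "s < 1" and sp: "of_nat CARD('n) \<le> ennreal s * p"
    and r: "1 \<le> r" "r < q"
    and K_meas [measurable]: "K \<in> borel_measurable lebesgue" and K: "\<And>x. 0 < K x"
    and V_meas [measurable]: "V \<in> borel_measurable lebesgue" and V: "\<And>x. V\<^sub>0 \<le> V x" and V\<^sub>0: "0 < V\<^sub>0"
    and q': "q < q'" and \<tau>: "0 < \<tau>" "\<tau> \<le> r / (q - r)"
    and integrable_weight: "integrable lebesgue (\<lambda>x. K x powr psi q r q' \<tau> * V x powr (-\<tau>))"
begin

section \<open>Norm rules for \<open>N\<close> on Borel functions\<close>

abbreviation N :: "(real^'n \<Rightarrow> real) \<Rightarrow> ennreal" where "N \<equiv> M_norm s q p V"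

lemma V_pos: "0 < V x"
  using V[of x] V\<^sub>0 by simp

lemma N_add:
  assumes "u \<in> borel_measurable borel" "v \<in> borel_measurable borel"
  shows "N (\<lambda>x. u x + v x) \<le> N u + N v"
proof -
  have "lpn lebesgue q V (\<lambda>x. u x + v x) \<le> lpn lebesgue q V u + lpn lebesgue q V v"
    using r V_pos
    by (intro lpn_triangle V_meas assms[THEN borel_measurable_lebesgueI]) (auto intro: less_imp_le)
  from add_mono[OF this gagliardo_seminorm_triangle[OF assms p, of s]] show ?thesis
    by (simp add: M_norm_def weighted_norm_eq_lpn add_ac)
qed

lemma N_cmult:
  assumes "u \<in> borel_measurable borel"
  shows "N (\<lambda>x. c * u x) \<le> ennreal \<bar>c\<bar> * N u"
proof -
  have "lpn lebesgue q V (\<lambda>x. c * u x) \<le> ennreal \<bar>c\<bar> * lpn lebesgue q V u"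
    using r by (intro lpn_cmult_le V_meas assms[THEN borel_measurable_lebesgueI]) auto
  from add_mono[OF this gagliardo_seminorm_cmult_le[OF assms p, of s c]] show ?thesis
    by (simp add: M_norm_def weighted_norm_eq_lpn distrib_left)
qed

lemma N_lincomb:
  assumes "u \<in> borel_measurable borel" "v \<in> borel_measurable borel"
  shows "N (\<lambda>x. a * u x + b * v x) \<le> ennreal \<bar>a\<bar> * N u + ennreal \<bar>b\<bar> * N v"
proof -
  have "N (\<lambda>x. a * u x + b * v x) \<le> N (\<lambda>x. a * u x) + N (\<lambda>x. b * v x)"
    using assms by (intro N_add) auto
  also have "\<dots> \<le> ennreal \<bar>a\<bar> * N u + ennreal \<bar>b\<bar> * N v"
    by (intro add_mono N_cmult assms)
  finally show ?thesis .
qed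

lemma N_diff:
  assumes "u \<in> borel_measurable borel" "v \<in> borel_measurable borel"
  shows "N (\<lambda>x. u x - v x) \<le> N u + N v"
  using N_lincomb[OF assms, of 1 "-1"] by simp

lemma N_commute:
  assumes "u \<in> borel_measurable borel" "v \<in> borel_measurable borel"
  shows "N (\<lambda>x. u x - v x) = N (\<lambda>x. v x - u x)"
  using N_cmult[of "\<lambda>x. u x - v x" "-1"] N_cmult[of "\<lambda>x. v x - u x" "-1"] assms
  by (intro antisym) (simp_all add: borel_measurable_diff)

lemma N_diff_trans:
  assumes "u \<in> borel_measurable borel" "v \<in> borel_measurable borel" "w \<in> borel_measurable borel"
  shows "N (\<lambda>x. u x - w x) \<le> N (\<lambda>x. u x - v x) + N (\<lambda>x. v x - w x)"
  using N_add[of "\<lambda>x. u x - v x" "\<lambda>x. v x - w x"] assms by (simp add: borel_measurable_diff)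

lemma lpn_V_le_N: "lpn lebesgue q V u \<le> N u"
  by (simp add: M_norm_def weighted_norm_eq_lpn)

lemma gagliardo_le_N: "gagliardo_seminorm s p u \<le> N u"
  by (simp add: M_norm_def)

text \<open>Scaling to the unit ball of \<open>N\<close>. The constant is raised by 1 to make the
  factor positive, so that the right side is infinite whenever \<open>N u\<close> is.\<close>

lemma lpn_le_mult_N:
  assumes unit: "\<And>u. u \<in> borel_measurable borel \<Longrightarrow> N u \<le> 1 \<Longrightarrow> lpn lebesgue m k u \<le> ennreal C"
    and C: "0 \<le> C" and m: "0 < m" and k: "k \<in> borel_measurable lebesgue"
    and u: "u \<in> borel_measurable borel"
  shows "lpn lebesgue m k u \<le> ennreal (C + 1) * N u"
proof (cases "N u")
  case (real a)
  show ?thesis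
  proof (rule ennreal_le_epsilon)
    fix e :: real assume e: "0 < e"
    \<comment> \<open>\<open>N u\<close> may be 0, so it is enlarged before dividing by it; this
      amount makes \<open>d * (C + 1)\<close> equal to \<open>(C + 1) * a + e\<close>.\<close>
    define d where "d = a + e / (C + 1)"
    have d: "0 < d" "a \<le> d" using real e C by (auto simp: d_def add_nonneg_pos)
    have u': "(\<lambda>x. 1 / d * u x) \<in> borel_measurable borel" using u by simp
    have "N (\<lambda>x. 1 / d * u x) \<le> ennreal \<bar>1 / d\<bar> * N u"
      by (rule N_cmult[OF u])
    also have "\<dots> = ennreal (a / d)"
      using real d by (simp flip: ennreal_mult)
    also have "\<dots> \<le> ennreal 1"
      using d by (intro ennreal_leI) simp
    finally have "lpn lebesgue m k (\<lambda>x. 1 / d * u x) \<le> ennreal C"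
      by (intro unit u') simp
    then have "ennreal \<bar>d\<bar> * lpn lebesgue m k (\<lambda>x. 1 / d * u x) \<le> ennreal \<bar>d\<bar> * ennreal C"
      by (rule mult_left_mono) simp
    moreover have "lpn lebesgue m k (\<lambda>x. d * (1 / d * u x)) \<le> ennreal \<bar>d\<bar> * lpn lebesgue m k (\<lambda>x. 1 / d * u x)"
      by (intro lpn_cmult_le borel_measurable_lebesgueI u' k m)
    ultimately have "lpn lebesgue m k u \<le> ennreal \<bar>d\<bar> * ennreal C"
      using d by (simp add: order_trans)
    also have "\<dots> = ennreal (d * C)"
      using d C by (simp add: ennreal_mult)
    also have "\<dots> \<le> ennreal ((C + 1) * a + e)"
    proof (rule ennreal_leI)
      have "d * C \<le> d * (C + 1)" using d by simp
      also have "\<dots> = (C + 1) * a + e" using C by (simp add: d_def field_simps)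
      finally show "d * C \<le> (C + 1) * a + e" .
    qed
    also have "\<dots> = ennreal (C + 1) * N u + ennreal e"
      using real C e by (simp add: ennreal_mult)
    finally show "lpn lebesgue m k u \<le> ennreal (C + 1) * N u + ennreal e" .
  qed
qed (use C in \<open>simp add: ennreal_mult_top\<close>)

text \<open>For infinite p, n / s is the least exponent that satisfies \<open>n \<le> s * P\<close>,
  and \<open>s < 1\<close> makes it at least 1.\<close>

definition P :: real where "P = (if p = \<infinity> then real CARD('n) / s else enn2real p)"

definition C\<^sub>P :: real where "C\<^sub>P = unit_ball_vol (real CARD('n)) + 1"

lemma C\<^sub>P: "0 \<le> C\<^sub>P"
  by (simp add: C\<^sub>P_def unit_ball_vol_nonneg)

lemma P_ge_1: "1 \<le> P"
proof (cases "p = \<infinity>")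
  case True
  have "1 \<le> real CARD('n)" by (simp add: Suc_leI)
  then have "s \<le> real CARD('n)" using s by linarith
  then show ?thesis using s True unfolding P_def by (simp add: pos_le_divide_eq)
qed (simp add: P_def enn2real_ge_1 p)

lemma sP: "real CARD('n) \<le> s * P"
proof (cases p)
  case (real a)
  then have "ennreal (real CARD('n)) \<le> ennreal (s * a)"
    using sp s by (simp add: ennreal_mult ennreal_of_nat_eq_real_of_nat)
  then show ?thesis
    using real s unfolding P_def by (subst (asm) ennreal_le_iff) auto
qed (use s P_def in simp)

lemma hajlasz_of_gagliardo:
  fixes u :: "real^'n \<Rightarrow> real"
  assumes "u \<in> borel_measurable borel" "gagliardo_seminorm s p u \<le> 1"
  shows "\<exists>g. hajlasz s P C\<^sub>P u g"
proof (cases "p = \<infinity>")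
  case True
  have "hajlasz s P (unit_ball_vol (real DIM(real^'n)) + 1) u (\<lambda>_. 1)"
    using assms s gagliardo_seminorm_infinity_le_iff[of 1 s u]
    by (intro hajlasz_Hoelder) (auto simp: True)
  then show ?thesis by (auto simp: C\<^sub>P_def)
next
  case False
  have "(\<integral>\<^sup>+x. \<integral>\<^sup>+y. ennreal (\<bar>u x - u y\<bar> powr P / norm (x - y) powr (real DIM(real^'n) + s * P))
      \<partial>lborel \<partial>lborel) \<le> 1"
    using assms(2) False enn_powr_le_iff[of P 1] P_ge_1
    by (simp add: gagliardo_seminorm_def P_def nn_integral_completion)
  from hajlasz_finite_exponent[OF assms(1) P_ge_1 s(1) this] show ?thesis
    by (simp add: C\<^sub>P_def)
qed

text \<open>Here the lower bound \<open>V\<^sub>0\<close> removes the weight, so that the unweighted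
  estimates derived from \<open>hajlasz\<close> become applicable.\<close>

lemma nn_integral_powr_q_le:
  assumes [measurable]: "u \<in> borel_measurable borel" and "N u \<le> 1"
  shows "(\<integral>\<^sup>+x. ennreal (\<bar>u x\<bar> powr q) \<partial>lborel) \<le> ennreal (1 / V\<^sub>0)"
proof -
  note [measurable] = borel_measurable_lebesgueI[OF assms(1)]
  have "(\<integral>\<^sup>+x. ennreal (\<bar>u x\<bar> powr q) \<partial>lborel) = (\<integral>\<^sup>+x. ennreal (\<bar>u x\<bar> powr q) \<partial>lebesgue)"
    by (simp add: nn_integral_completion)
  also have "\<dots> \<le> (\<integral>\<^sup>+x. ennreal (1 / V\<^sub>0) * ennreal (\<bar>u x\<bar> powr q * V x) \<partial>lebesgue)"
  proof (intro nn_integral_mono)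
    fix x
    have "\<bar>u x\<bar> powr q * 1 \<le> \<bar>u x\<bar> powr q * (V x / V\<^sub>0)"
      using V[of x] V\<^sub>0 by (intro mult_left_mono) auto
    then show "ennreal (\<bar>u x\<bar> powr q) \<le> ennreal (1 / V\<^sub>0) * ennreal (\<bar>u x\<bar> powr q * V x)"
      using V\<^sub>0 V_pos[of x] by (simp add: ennreal_leI flip: ennreal_mult)
  qed
  also have "\<dots> = ennreal (1 / V\<^sub>0) * (\<integral>\<^sup>+x. ennreal (\<bar>u x\<bar> powr q * V x) \<partial>lebesgue)"
    by (rule nn_integral_cmult) measurable
  also have "\<dots> \<le> ennreal (1 / V\<^sub>0) * ennreal (1 powr q)"
    using order_trans[OF lpn_V_le_N assms(2)] r
    by (intro mult_left_mono) (simp_all add: lpn_le_1_iff)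
  finally show ?thesis by simp
qed

lemma lpn_q'_le_N: "\<exists>C\<ge>0. \<forall>u\<in>borel_measurable borel. lpn lebesgue q' (\<lambda>_. 1) u \<le> ennreal C * N u"
proof -
  have "\<exists>Q'\<ge>0. \<forall>(u :: real^'n \<Rightarrow> real) g. u \<in> borel_measurable borel \<longrightarrow> hajlasz s P C\<^sub>P u g \<longrightarrow>
    (\<integral>\<^sup>+x. ennreal (\<bar>u x\<bar> powr q) \<partial>lborel) \<le> ennreal (1 / V\<^sub>0) \<longrightarrow>
    (\<integral>\<^sup>+x. ennreal (\<bar>u x\<bar> powr q') \<partial>lborel) \<le> ennreal Q'"
    using s P_ge_1 sP C\<^sub>P V\<^sub>0 r q' by (intro hajlasz_higher_power) auto
  then obtain Q' where Q': "0 \<le> Q'" and *: "\<And>(u :: real^'n \<Rightarrow> real) g. u \<in> borel_measurable borel \<Longrightarrow>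
    hajlasz s P C\<^sub>P u g \<Longrightarrow> (\<integral>\<^sup>+x. ennreal (\<bar>u x\<bar> powr q) \<partial>lborel) \<le> ennreal (1 / V\<^sub>0) \<Longrightarrow>
    (\<integral>\<^sup>+x. ennreal (\<bar>u x\<bar> powr q') \<partial>lborel) \<le> ennreal Q'" by blast
  have unit: "lpn lebesgue q' (\<lambda>_. 1) u \<le> ennreal (Q' powr (1 / q'))"
    if u: "u \<in> borel_measurable borel" "N u \<le> 1" for u
  proof -
    obtain g where "hajlasz s P C\<^sub>P u g"
      using hajlasz_of_gagliardo[OF u(1)] gagliardo_le_N[of u] u(2) by (auto intro: order_trans)
    then have "(\<integral>\<^sup>+x. ennreal (\<bar>u x\<bar> powr q') \<partial>lborel) \<le> ennreal Q'"
      using * nn_integral_powr_q_le[OF u] u by blast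
    then show ?thesis
      using r q' Q' by (subst lpn_le_iff) (auto simp: nn_integral_completion powr_powr)
  qed
  have "lpn lebesgue q' (\<lambda>_. 1) u \<le> ennreal (Q' powr (1 / q') + 1) * N u"
    if "u \<in> borel_measurable borel" for u
    using r q' that by (intro lpn_le_mult_N unit) auto
  then show ?thesis
    by (intro exI[of _ "Q' powr (1 / q') + 1"]) auto
qed

definition W :: "real^'n \<Rightarrow> real" where "W x = K x powr psi q r q' \<tau> * V x powr (-\<tau>)"

lemma W_meas [measurable]: "W \<in> borel_measurable lebesgue"
  unfolding W_def by measurable

lemma W_nonneg: "0 \<le> W x"
  by (simp add: W_def)

lemma W_finite: "\<exists>I\<ge>0. (\<integral>\<^sup>+x. ennreal (W x) \<partial>lebesgue) = ennreal I"
proof -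
  have "integrable lebesgue W"
    using integrable_weight by (simp add: W_def[abs_def])
  then show ?thesis
    using W_nonneg by (intro exI[of _ "integral\<^sup>L lebesgue W"])
      (auto simp: nn_integral_eq_integral intro: integral_nonneg)
qed

lemma pointwise_le:
  assumes "0 < e"
  shows "\<bar>z\<bar> powr r * K x \<le> e * (\<bar>z\<bar> powr q * V x + \<bar>z\<bar> powr q') + e powr (1 - psi q r q' \<tau>) * W x"
  unfolding W_def using assms K[of x] V_pos[of x] r q' \<tau>
  by (intro weighted_power_le) auto

lemma lpn_K_le_N: "\<exists>C\<ge>0. \<forall>u\<in>borel_measurable borel. lpn lebesgue r K u \<le> ennreal C * N u"
proof -
  obtain C where C: "0 \<le> C" and Cq': "\<And>u. u \<in> borel_measurable borel \<Longrightarrow> lpn lebesgue q' (\<lambda>_. 1) u \<le> ennreal C * N u"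
    using lpn_q'_le_N by blast
  obtain I where I: "0 \<le> I" "(\<integral>\<^sup>+x. ennreal (W x) \<partial>lebesgue) = ennreal I"
    using W_finite by blast
  \<comment> \<open>The summands bound the integrals of \<open>\<bar>u\<bar> powr q * V\<close>,
    \<open>\<bar>u\<bar> powr q'\<close> and \<open>W\<close>; for mere boundedness,
    \<open>pointwise_le\<close> is used with e = 1.\<close>
  define D where "D = 1 + C powr q' + I"
  have D: "0 \<le> D" using I by (simp add: D_def)
  have unit: "lpn lebesgue r K u \<le> ennreal (D powr (1 / r))"
    if u: "u \<in> borel_measurable borel" "N u \<le> 1" for u
  proof -
    note [measurable] = borel_measurable_lebesgueI[OF u(1)]
    have 1: "(\<integral>\<^sup>+x. ennreal (\<bar>u x\<bar> powr q * V x) \<partial>lebesgue) \<le> ennreal 1"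
      using order_trans[OF lpn_V_le_N u(2)] r by (simp add: lpn_le_1_iff)
    have "lpn lebesgue q' (\<lambda>_. 1) u \<le> ennreal C * 1"
      using Cq'[OF u(1)] mult_left_mono[OF u(2), of "ennreal C"] by (auto intro: order_trans)
    then have 2: "(\<integral>\<^sup>+x. ennreal (\<bar>u x\<bar> powr q') \<partial>lebesgue) \<le> ennreal (C powr q')"
      using r q' C lpn_le_iff[of q' C lebesgue "\<lambda>_. 1" u] by simp
    have "(\<integral>\<^sup>+x. ennreal (\<bar>u x\<bar> powr r * K x) \<partial>lebesgue) \<le>
        (\<integral>\<^sup>+x. (ennreal (\<bar>u x\<bar> powr q * V x) + ennreal (\<bar>u x\<bar> powr q')) + ennreal (W x) \<partial>lebesgue)"
    proof (intro nn_integral_mono)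
      fix x
      have "ennreal (\<bar>u x\<bar> powr r * K x) \<le> ennreal ((\<bar>u x\<bar> powr q * V x + \<bar>u x\<bar> powr q') + W x)"
        using pointwise_le[of 1 "u x" x] by (intro ennreal_leI) simp
      then show "ennreal (\<bar>u x\<bar> powr r * K x) \<le>
          (ennreal (\<bar>u x\<bar> powr q * V x) + ennreal (\<bar>u x\<bar> powr q')) + ennreal (W x)"
        using V_pos[of x] W_nonneg[of x] by simp
    qed
    also have "\<dots> = ((\<integral>\<^sup>+x. ennreal (\<bar>u x\<bar> powr q * V x) \<partial>lebesgue) +
        (\<integral>\<^sup>+x. ennreal (\<bar>u x\<bar> powr q') \<partial>lebesgue)) + (\<integral>\<^sup>+x. ennreal (W x) \<partial>lebesgue)"
      by (simp add: nn_integral_add)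
    also have "\<dots> \<le> (ennreal 1 + ennreal (C powr q')) + ennreal I"
      using 1 2 I by (intro add_mono) auto
    also have "\<dots> = ennreal D"
      using I by (simp add: D_def)
    finally show ?thesis
      using r D by (subst lpn_le_iff) (auto simp: powr_powr)
  qed
  have "lpn lebesgue r K u \<le> ennreal (D powr (1 / r) + 1) * N u"
    if "u \<in> borel_measurable borel" for u
    using r that by (intro lpn_le_mult_N unit) auto
  then show ?thesis
    by (intro exI[of _ "D powr (1 / r) + 1"]) auto
qed

lemma bounded_AE_convergent_subseq:
  fixes u :: "nat \<Rightarrow> real^'n \<Rightarrow> real"
  assumes u: "\<And>k. u k \<in> borel_measurable borel" and B: "\<And>k. N (u k) \<le> ennreal B"
  shows "\<exists>\<rho> f. strict_mono \<rho> \<and> f \<in> borel_measurable borel \<and> (AE x in lebesgue. (\<lambda>k. u (\<rho> k) x) \<longlonglongrightarrow> f x)"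
proof -
  \<comment> \<open>A positive bound is needed to scale the sequence into the unit ball of
    \<open>N\<close>, but \<open>B\<close> may be 0 or negative.\<close>
  define D where "D = \<bar>B\<bar> + 1"
  have D: "0 < D" by (simp add: D_def)
  define v where "v k x = 1 / D * u k x" for k x
  have v [measurable]: "v k \<in> borel_measurable borel" for k
    unfolding v_def using u by simp
  have Nv: "N (v k) \<le> 1" for k
  proof -
    have "N (v k) \<le> ennreal \<bar>1 / D\<bar> * N (u k)"
      unfolding v_def by (rule N_cmult[OF u])
    also have "\<dots> \<le> ennreal (1 / D) * ennreal D"
      by (intro mult_mono order_trans[OF B ennreal_leI]) (auto simp: D_def)
    also have "\<dots> = 1"
      using D by (simp flip: ennreal_mult)
    finally show ?thesis .
  qed
  have "\<exists>g. hajlasz s P C\<^sub>P (v k) g" for k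
    using v order_trans[OF gagliardo_le_N Nv] by (rule hajlasz_of_gagliardo)
  then obtain g where g: "\<And>k. hajlasz s P C\<^sub>P (v k) (g k)" by metis
  have "\<exists>\<rho>. strict_mono \<rho> \<and> (AE x in lborel. convergent (\<lambda>k. v (\<rho> k) x))"
    using s P_ge_1 C\<^sub>P V\<^sub>0 r
    by (intro hajlasz_AE_convergent_subseq[where u = v, OF v g nn_integral_powr_q_le[OF v Nv]]) auto
  then obtain \<rho> where \<rho>: "strict_mono \<rho>" "AE x in lborel. convergent (\<lambda>k. v (\<rho> k) x)" by blast
  \<comment> \<open>Where the sequence diverges, \<open>lim\<close> has no meaningful value; this
    concerns a null set, and \<open>f\<close> is Borel all the same.\<close>
  define f where "f x = D * lim (\<lambda>k. v (\<rho> k) x)" for x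
  have "f \<in> borel_measurable borel"
    unfolding f_def by (intro borel_measurable_times borel_measurable_lim_metric v) auto
  moreover have "AE x in lborel. (\<lambda>k. u (\<rho> k) x) \<longlonglongrightarrow> f x"
    using \<rho>(2)
  proof eventually_elim
    case (elim x)
    then have "(\<lambda>k. D * v (\<rho> k) x) \<longlonglongrightarrow> f x"
      unfolding f_def by (intro tendsto_mult_left) (simp add: convergent_LIMSEQ_iff)
    then show ?case using D by (simp add: v_def)
  qed
  then have "AE x in lebesgue. (\<lambda>k. u (\<rho> k) x) \<longlonglongrightarrow> f x"
    by (rule AE_completion)
  ultimately show ?thesis
    using \<rho>(1) by blast
qed

text \<open>\<open>N\<close> of \<open>f\<close> is not estimated; the bounds on
  \<open>u k - f\<close> are those on \<open>u k - u j\<close>, passed to the limit in j by Fatou's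
  lemma. They do not tend to 0, so convergence has to come from a majorant built from
  \<open>W\<close>.\<close>

lemma AE_convergent_bounded_imp_lpn_K_tendsto:
  assumes u: "\<And>k. u k \<in> borel_measurable borel" and f: "f \<in> borel_measurable borel"
    and B: "\<And>k. N (u k) \<le> ennreal B"
    and lim: "AE x in lebesgue. (\<lambda>k. u k x) \<longlonglongrightarrow> f x"
  shows "(\<lambda>k. lpn lebesgue r K (\<lambda>x. u k x - f x)) \<longlonglongrightarrow> 0"
proof -
  define D where "D = 2 * \<bar>B\<bar>"
  have D: "0 \<le> D" by (simp add: D_def)
  have ND: "N (\<lambda>x. u i x - u j x) \<le> ennreal D" for i j
  proof -
    have "N (\<lambda>x. u i x - u j x) \<le> N (u i) + N (u j)"
      by (rule N_diff[OF u u])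
    also have "\<dots> \<le> ennreal \<bar>B\<bar> + ennreal \<bar>B\<bar>"
      using B by (intro add_mono) (meson abs_ge_self ennreal_leI order_trans)+
    finally show ?thesis by (simp add: D_def flip: ennreal_plus)
  qed
  note [measurable] = borel_measurable_lebesgueI[OF u] borel_measurable_lebesgueI[OF f]
  have limk: "AE x in lebesgue. (\<lambda>j. u k x - u j x) \<longlonglongrightarrow> u k x - f x" for k
    using lim by eventually_elim (intro tendsto_intros)
  obtain C where C: "0 \<le> C" and Cq': "\<And>u. u \<in> borel_measurable borel \<Longrightarrow> lpn lebesgue q' (\<lambda>_. 1) u \<le> ennreal C * N u"
    using lpn_q'_le_N by blast
  have 1: "(\<integral>\<^sup>+x. ennreal (\<bar>u k x - f x\<bar> powr q * V x) \<partial>lebesgue) \<le> ennreal (D powr q)" for k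
  proof -
    have "lpn lebesgue q V (\<lambda>x. u k x - f x) \<le> ennreal D"
      using r order_trans[OF lpn_V_le_N ND] limk
      by (intro lpn_Fatou[where f = "\<lambda>j x. u k x - u j x"]) auto
    then show ?thesis using r D by (simp add: lpn_le_iff)
  qed
  have 2: "(\<integral>\<^sup>+x. ennreal (\<bar>u k x - f x\<bar> powr q') \<partial>lebesgue) \<le> ennreal ((C * D) powr q')" for k
  proof -
    have "lpn lebesgue q' (\<lambda>_. 1) (\<lambda>x. u k x - u j x) \<le> ennreal (C * D)" for j
    proof -
      have "lpn lebesgue q' (\<lambda>_. 1) (\<lambda>x. u k x - u j x) \<le> ennreal C * N (\<lambda>x. u k x - u j x)"
        using u by (intro Cq') auto
      also have "\<dots> \<le> ennreal C * ennreal D"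
        by (intro mult_left_mono ND) auto
      finally show ?thesis using C D by (simp add: ennreal_mult)
    qed
    then have "lpn lebesgue q' (\<lambda>_. 1) (\<lambda>x. u k x - f x) \<le> ennreal (C * D)"
      using r q' limk by (intro lpn_Fatou[where f = "\<lambda>j x. u k x - u j x"]) auto
    then show ?thesis using r q' C D by (simp add: lpn_le_iff)
  qed
  obtain I where I: "0 \<le> I" "(\<integral>\<^sup>+x. ennreal (W x) \<partial>lebesgue) = ennreal I"
    using W_finite by blast
  define E where "E = D powr q + (C * D) powr q'"
  have E: "0 \<le> E" by (simp add: E_def)
  define J where "J k = (\<integral>\<^sup>+x. ennreal (\<bar>u k x - f x\<bar> powr r * K x) \<partial>lebesgue)" for k
  have J: "\<forall>\<^sub>F k in sequentially. J k \<le> ennreal e" if e: "0 < e" for e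
  proof -
    \<comment> \<open>Makes \<open>\<epsilon> * E\<close> at most e / 2; the added 1 covers E =
      0.\<close>
    define \<epsilon> where "\<epsilon> = e / (2 * (E + 1))"
    have \<epsilon>: "0 < \<epsilon>" using e E by (simp add: \<epsilon>_def)
    define c where "c = \<epsilon> powr (1 - psi q r q' \<tau>)"
    \<comment> \<open>Truncation at \<open>c * W\<close> provides the integrable majorant. By
      \<open>pointwise_le\<close> the part cut off is at most \<open>\<epsilon>\<close> times the q
      and q' terms, whose integrals are bounded uniformly in k.\<close>
    define m where "m k x = min (\<bar>u k x - f x\<bar> powr r * K x) (c * W x)" for k x
    have [measurable]: "m k \<in> borel_measurable lebesgue" for k
      unfolding m_def by measurable
    have m0: "0 \<le> m k x" for k x
      using K[of x] W_nonneg[of x] by (simp add: m_def c_def)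
    have "(\<lambda>k. \<integral>\<^sup>+x. ennreal (m k x) \<partial>lebesgue) \<longlonglongrightarrow> (\<integral>\<^sup>+x. 0 \<partial>(lebesgue :: (real^'n) measure))"
    proof (rule nn_integral_dominated_convergence[where w = "\<lambda>x. ennreal (c * W x)"])
      have "(\<integral>\<^sup>+x. ennreal (c * W x) \<partial>lebesgue) = ennreal c * (\<integral>\<^sup>+x. ennreal (W x) \<partial>lebesgue)"
        using W_nonneg by (subst nn_integral_cmult[symmetric]) (auto simp: c_def ennreal_mult)
      then show "(\<integral>\<^sup>+x. ennreal (c * W x) \<partial>lebesgue) < \<infinity>"
        by (simp add: I ennreal_mult_less_top)
      show "AE x in lebesgue. (\<lambda>k. ennreal (m k x)) \<longlonglongrightarrow> 0"
        using lim
      proof eventually_elim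
        case (elim x)
        have "(\<lambda>k. \<bar>u k x - f x\<bar>) \<longlonglongrightarrow> 0"
          using elim by (simp add: LIM_zero tendsto_rabs_zero)
        then have "(\<lambda>k. \<bar>u k x - f x\<bar> powr r * K x) \<longlonglongrightarrow> 0 powr r * K x"
          using r by (intro tendsto_mult_right tendsto_powr') auto
        then have "(\<lambda>k. \<bar>u k x - f x\<bar> powr r * K x) \<longlonglongrightarrow> 0"
          by simp
        then have "(\<lambda>k. m k x) \<longlonglongrightarrow> 0"
          by (rule_tac tendsto_sandwich[where f = "\<lambda>_. 0" and h = "\<lambda>k. \<bar>u k x - f x\<bar> powr r * K x"])
            (auto simp: m0, auto simp: m_def)
        then show ?case
          using tendsto_ennrealI by fastforce
      qed
    qed (auto simp: m_def intro!: ennreal_leI)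
    then have "(\<lambda>k. \<integral>\<^sup>+x. ennreal (m k x) \<partial>lebesgue) \<longlonglongrightarrow> 0"
      by simp
    then have "\<forall>\<^sub>F k in sequentially. (\<integral>\<^sup>+x. ennreal (m k x) \<partial>lebesgue) < ennreal (e / 2)"
      using e by (intro order_tendstoD(2)) auto
    then show ?thesis
    proof eventually_elim
      case (elim k)
      have "J k \<le> (\<integral>\<^sup>+x. ennreal \<epsilon> * (ennreal (\<bar>u k x - f x\<bar> powr q * V x) +
          ennreal (\<bar>u k x - f x\<bar> powr q')) + ennreal (m k x) \<partial>lebesgue)"
        unfolding J_def
      proof (intro nn_integral_mono)
        fix x
        have "\<bar>u k x - f x\<bar> powr r * K x \<le>
            \<epsilon> * (\<bar>u k x - f x\<bar> powr q * V x + \<bar>u k x - f x\<bar> powr q') + m k x"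
          using pointwise_le[OF \<epsilon>, of "u k x - f x" x] V_pos[of x] \<epsilon>
          by (auto simp: m_def c_def min_def)
        then have "ennreal (\<bar>u k x - f x\<bar> powr r * K x) \<le>
            ennreal (\<epsilon> * (\<bar>u k x - f x\<bar> powr q * V x + \<bar>u k x - f x\<bar> powr q') + m k x)"
          by (rule ennreal_leI)
        then show "ennreal (\<bar>u k x - f x\<bar> powr r * K x) \<le> ennreal \<epsilon> * (ennreal (\<bar>u k x - f x\<bar> powr q * V x) +
          ennreal (\<bar>u k x - f x\<bar> powr q')) + ennreal (m k x)"
          using V_pos[of x] \<epsilon> m0 by (simp add: ennreal_mult)
      qed
      also have "\<dots> = ennreal \<epsilon> * ((\<integral>\<^sup>+x. ennreal (\<bar>u k x - f x\<bar> powr q * V x) \<partial>lebesgue) +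
          (\<integral>\<^sup>+x. ennreal (\<bar>u k x - f x\<bar> powr q') \<partial>lebesgue)) + (\<integral>\<^sup>+x. ennreal (m k x) \<partial>lebesgue)"
        by (simp add: nn_integral_add nn_integral_cmult)
      also have "\<dots> \<le> ennreal \<epsilon> * (ennreal (D powr q) + ennreal ((C * D) powr q')) + ennreal (e / 2)"
        using elim by (intro add_mono mult_left_mono 1 2) auto
      also have "\<dots> = ennreal (\<epsilon> * E + e / 2)"
        using \<epsilon> e by (simp add: E_def ennreal_mult)
      also have "\<dots> \<le> ennreal e"
        using e E by (intro ennreal_leI) (simp add: \<epsilon>_def field_simps)
      finally show ?case .
    qed
  qed
  show ?thesis
  proof (rule tendsto_zero_ennreal)
    fix e :: real assume e: "0 < e"
    have "\<forall>\<^sub>F k in sequentially. J k \<le> ennreal ((e / 2) powr r)"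
      using e by (intro J) simp
    then show "\<forall>\<^sub>F k in sequentially. lpn lebesgue r K (\<lambda>x. u k x - f x) < ennreal e"
    proof eventually_elim
      case (elim k)
      then have "lpn lebesgue r K (\<lambda>x. u k x - f x) \<le> ennreal (e / 2)"
        using r e by (simp add: lpn_le_iff J_def)
      also have "\<dots> < ennreal e"
        using e by (intro ennreal_lessI) auto
      finally show ?case .
    qed
  qed
qed

end

subsection \<open>The completion\<close>

lemma tendsto_0_le_ennreal:
  fixes f g :: "nat \<Rightarrow> ennreal"
  assumes "\<And>k. f k \<le> g k" "g \<longlonglongrightarrow> 0"
  shows "f \<longlonglongrightarrow> 0"
  by (rule tendsto_sandwich[OF _ _ tendsto_const assms(2)]) (auto simp: assms(1))

lemma tendsto_0_ennreal_leI:
  fixes f :: "nat \<Rightarrow> ennreal"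
  assumes "\<And>e. 0 < e \<Longrightarrow> \<exists>n. \<forall>k\<ge>n. f k \<le> ennreal e"
  shows "f \<longlonglongrightarrow> 0"
proof (rule tendsto_zero_ennreal)
  fix e :: real assume e: "0 < e"
  then obtain n where "\<forall>k\<ge>n. f k \<le> ennreal (e / 2)"
    using assms[of "e / 2"] by auto
  moreover have "ennreal (e / 2) < ennreal e"
    using e by (intro ennreal_lessI) auto
  ultimately show "\<forall>\<^sub>F k in sequentially. f k < ennreal e"
    unfolding eventually_sequentially by (meson le_less_trans)
qed

lemma tendsto_0_ennreal_leD:
  fixes f :: "nat \<Rightarrow> ennreal"
  assumes "f \<longlonglongrightarrow> 0" "0 < e"
  shows "\<forall>\<^sub>F k in sequentially. f k \<le> ennreal e"
proof -
  have "\<forall>\<^sub>F k in sequentially. f k < ennreal e"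
    using assms by (intro order_tendstoD(2)) auto
  then show ?thesis by (rule eventually_mono) simp
qed

lemma tendsto_0_ennreal_lincomb:
  fixes f g :: "nat \<Rightarrow> ennreal"
  assumes "f \<longlonglongrightarrow> 0" "g \<longlonglongrightarrow> 0"
  shows "(\<lambda>k. ennreal a * f k + ennreal b * g k) \<longlonglongrightarrow> 0"
proof -
  have "(\<lambda>k. ennreal a * f k + ennreal b * g k) \<longlonglongrightarrow> ennreal a * 0 + ennreal b * 0"
    using assms by (intro tendsto_add ennreal_tendsto_cmult) auto
  then show ?thesis by simp
qed

text \<open>The Cauchy condition avoids the truncated subtraction of \<open>ennreal\<close>. One
  inequality is enough, since i and j may be exchanged.\<close>

lemma ennreal_Cauchy_imp_convergent:
  fixes f :: "nat \<Rightarrow> ennreal"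
  assumes fin: "\<And>k. f k < \<infinity>"
    and Cauchy: "\<And>e. 0 < e \<Longrightarrow> \<exists>n. \<forall>i\<ge>n. \<forall>j\<ge>n. f i \<le> f j + ennreal e"
  shows "convergent f"
proof -
  define g where "g k = enn2real (f k)" for k
  have g: "0 \<le> g k" "f k = ennreal (g k)" for k
    using fin[of k] by (auto simp: g_def)
  have "Cauchy g"
  proof (rule metric_CauchyI)
    fix e :: real assume e: "0 < e"
    then obtain n where n: "\<And>i j. n \<le> i \<Longrightarrow> n \<le> j \<Longrightarrow> f i \<le> f j + ennreal (e / 2)"
      using Cauchy[of "e / 2"] by auto
    have "g i \<le> g j + e / 2" if "n \<le> i" "n \<le> j" for i j
    proof -
      have "ennreal (g i) \<le> ennreal (g j + e / 2)"
        using n[OF that] e g by simp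
      then show ?thesis using g(1)[of j] e by (subst (asm) ennreal_le_iff) auto
    qed
    then have "dist (g i) (g j) < e" if "n \<le> i" "n \<le> j" for i j
      using that e by (force simp: dist_real_def abs_if)
    then show "\<exists>n. \<forall>i\<ge>n. \<forall>j\<ge>n. dist (g i) (g j) < e" by blast
  qed
  then obtain l where "g \<longlonglongrightarrow> l"
    using Cauchy_convergent convergent_def by blast
  then have "(\<lambda>k. ennreal (g k)) \<longlonglongrightarrow> ennreal l"
    by (rule tendsto_ennrealI)
  then show ?thesis
    unfolding convergent_def g(2)[symmetric] by blast
qed

lemma lpn_commute: "lpn M p k (\<lambda>x. f x - g x) = lpn M p k (\<lambda>x. g x - f x)"
  by (simp add: lpn_def abs_minus_commute)

lemma lpn_diff_trans:
  assumes "f \<in> borel_measurable M" "g \<in> borel_measurable M" "h \<in> borel_measurable M"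
    "k \<in> borel_measurable M" "\<And>x. 0 \<le> k x" "1 \<le> p"
  shows "lpn M p k (\<lambda>x. f x - h x) \<le> lpn M p k (\<lambda>x. f x - g x) + lpn M p k (\<lambda>x. g x - h x)"
  using lpn_triangle[of "\<lambda>x. f x - g x" M "\<lambda>x. g x - h x" k p] assms
  by (simp add: borel_measurable_diff)

section \<open>Linear combinations of test functions\<close>

lemma C1c_continuous:
  assumes "u \<in> C1c"
  shows "continuous_on UNIV u"
proof -
  from assms obtain u' where "(u has_derivative blinfun_apply (u' x)) (at x)" for x
    unfolding C1c_def by auto
  from has_derivative_continuous[OF this] show ?thesis
    by (intro continuous_at_imp_continuous_on) auto
qed

lemma C1c_lincomb:
  assumes "u \<in> C1c" "v \<in> C1c"
  shows "(\<lambda>x. a * u x + b * v x) \<in> C1c"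
proof -
  obtain u' v' where u': "\<And>x. (u has_derivative blinfun_apply (u' x)) (at x)" "continuous_on UNIV u'"
      and v': "\<And>x. (v has_derivative blinfun_apply (v' x)) (at x)" "continuous_on UNIV v'"
      and supp: "compact (closure {x. u x \<noteq> 0})" "compact (closure {x. v x \<noteq> 0})"
    using assms by (auto simp: C1c_def)
  have "((\<lambda>x. a * u x + b * v x) has_derivative blinfun_apply (a *\<^sub>R u' x + b *\<^sub>R v' x)) (at x)" for x
  proof -
    have "((\<lambda>x. a * u x + b * v x) has_derivative (\<lambda>h. a * u' x h + b * v' x h)) (at x)"
      by (intro has_derivative_add has_derivative_mult_right u' v')
    then show ?thesis
      by (rule has_derivative_eq_rhs) (simp add: fun_eq_iff blinfun.add_left blinfun.scaleR_left)
  qed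
  moreover have "continuous_on UNIV (\<lambda>x. a *\<^sub>R u' x + b *\<^sub>R v' x)"
    by (intro continuous_intros u' v')
  moreover have "compact (closure {x. a * u x + b * v x \<noteq> 0})"
  proof -
    have "closure {x. a * u x + b * v x \<noteq> 0} \<subseteq> closure ({x. u x \<noteq> 0} \<union> {x. v x \<noteq> 0})"
      by (intro closure_mono) auto
    then have "closure {x. a * u x + b * v x \<noteq> 0} =
        (closure {x. u x \<noteq> 0} \<union> closure {x. v x \<noteq> 0}) \<inter> closure {x. a * u x + b * v x \<noteq> 0}"
      by (auto simp: closure_Un)
    moreover have "compact \<dots>"
      using supp by (intro compact_Int_closed compact_Un) auto
    ultimately show ?thesis by simp
  qed
  ultimately show ?thesis
    unfolding C1c_def mem_Collect_eq
    by (intro conjI exI[of _ "\<lambda>x. a *\<^sub>R u' x + b *\<^sub>R v' x"] allI)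
qed

section \<open>Classes of functions modulo equality almost everywhere\<close>

lemma mem_ae_class: "u \<in> borel_measurable lebesgue \<Longrightarrow> u \<in> ae_class u"
  by (simp add: ae_class_def)

lemma ae_class_eq_iff:
  assumes "u \<in> borel_measurable lebesgue" "v \<in> borel_measurable lebesgue"
  shows "ae_class u = ae_class v \<longleftrightarrow> (AE x in lebesgue. u x = v x)"
proof
  assume "ae_class u = ae_class v"
  then have "u \<in> ae_class v"
    using mem_ae_class[OF assms(1)] by simp
  then show "AE x in lebesgue. u x = v x"
    by (simp add: ae_class_def)
next
  assume uv: "AE x in lebesgue. u x = v x"
  have "(AE x in lebesgue. w x = u x) \<longleftrightarrow> (AE x in lebesgue. w x = v x)" for w
  proof
    assume "AE x in lebesgue. w x = u x"
    with uv show "AE x in lebesgue. w x = v x" by eventually_elim simp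
  next
    assume "AE x in lebesgue. w x = v x"
    with uv show "AE x in lebesgue. w x = u x" by eventually_elim simp
  qed
  then show "ae_class u = ae_class v"
    unfolding ae_class_def by simp
qed

lemma L_space_norm_ae_class:
  assumes "u \<in> borel_measurable lebesgue"
  shows "L_space_norm r K (ae_class u) = lpn lebesgue r K u"
proof -
  have "(SOME v. v \<in> ae_class u) \<in> ae_class u"
    using mem_ae_class[OF assms] by (rule someI[where P = "\<lambda>v. v \<in> ae_class u"])
  moreover have "AE x in lebesgue. v x = u x" if "v \<in> ae_class u" for v
    using that by (simp add: ae_class_def)
  ultimately have "AE x in lebesgue. (SOME v. v \<in> ae_class u) x = u x"
    by blast
  then show ?thesis
    unfolding L_space_norm_def weighted_norm_eq_lpn by (rule lpn_cong_AE)
qed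

text \<open>All representatives yield the same class, so the union defining the combination
  collapses to a single set.\<close>

lemma L_space_lincomb_ae_class:
  assumes [measurable]: "u \<in> borel_measurable lebesgue" "v \<in> borel_measurable lebesgue"
  shows "L_space_lincomb a (ae_class u) b (ae_class v) = ae_class (\<lambda>x. a * u x + b * v x)"
proof -
  have *: "ae_class (\<lambda>x. a * u' x + b * v' x) = ae_class (\<lambda>x. a * u x + b * v x)"
    if "u' \<in> ae_class u" "v' \<in> ae_class v" for u' v'
  proof -
    have [measurable]: "u' \<in> borel_measurable lebesgue" "v' \<in> borel_measurable lebesgue"
      and u': "AE x in lebesgue. u' x = u x" and v': "AE x in lebesgue. v' x = v x"
      using that by (auto simp: ae_class_def)
    have "AE x in lebesgue. a * u' x + b * v' x = a * u x + b * v x"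
      using u' v' by eventually_elim simp
    then show ?thesis
      by (subst ae_class_eq_iff) measurable
  qed
  have "L_space_lincomb a (ae_class u) b (ae_class v) =
      (\<Union>u'\<in>ae_class u. \<Union>v'\<in>ae_class v. ae_class (\<lambda>x. a * u x + b * v x))"
    unfolding L_space_lincomb_def by (intro SUP_cong refl *)
  also have "\<dots> = ae_class (\<lambda>x. a * u x + b * v x)"
    using mem_ae_class[OF assms(1)] mem_ae_class[OF assms(2)] by blast
  finally show ?thesis .
qed

context weighted_embedding
begin

section \<open>Classes of Cauchy sequences\<close>

abbreviation MC :: "(nat \<Rightarrow> real^'n \<Rightarrow> real) set" where "MC \<equiv> M_cauchy s q p V"

abbreviation R :: "(nat \<Rightarrow> real^'n \<Rightarrow> real) rel" where "R \<equiv> M_rel s q p V"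

abbreviation Lq :: "(real^'n \<Rightarrow> real) \<Rightarrow> ennreal" where "Lq \<equiv> lpn lebesgue q V"

abbreviation Lr :: "(real^'n \<Rightarrow> real) \<Rightarrow> ennreal" where "Lr \<equiv> lpn lebesgue r K"

lemma Lq_diff_trans:
  assumes "f \<in> borel_measurable lebesgue" "g \<in> borel_measurable lebesgue" "h \<in> borel_measurable lebesgue"
  shows "Lq (\<lambda>x. f x - h x) \<le> Lq (\<lambda>x. f x - g x) + Lq (\<lambda>x. g x - h x)"
  using assms r V_pos by (intro lpn_diff_trans) (auto intro: less_imp_le)

lemma Lr_diff_trans:
  assumes "f \<in> borel_measurable lebesgue" "g \<in> borel_measurable lebesgue" "h \<in> borel_measurable lebesgue"
  shows "Lr (\<lambda>x. f x - h x) \<le> Lr (\<lambda>x. f x - g x) + Lr (\<lambda>x. g x - h x)"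
  using assms r K by (intro lpn_diff_trans) (auto intro: less_imp_le)

lemma M_test_lincomb:
  assumes "u \<in> M_test s q p V" "v \<in> M_test s q p V"
  shows "(\<lambda>x. a * u x + b * v x) \<in> M_test s q p V"
proof -
  have uv: "u \<in> C1c" "v \<in> C1c" "N u < \<infinity>" "N v < \<infinity>"
    using assms by (auto simp: M_test_def)
  have "N (\<lambda>x. a * u x + b * v x) \<le> ennreal \<bar>a\<bar> * N u + ennreal \<bar>b\<bar> * N v"
    by (intro N_lincomb borel_measurable_continuous_onI C1c_continuous uv)
  also have "\<dots> < \<infinity>"
    using uv by (simp add: ennreal_mult_less_top)
  finally show ?thesis
    by (simp add: M_test_def C1c_lincomb uv)
qed

text \<open>The definition uses tolerances in \<open>ennreal\<close> and strict inequality; the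
  estimates produce real tolerances and \<open>\<le>\<close>.\<close>

lemma M_cauchy_iff:
  "\<phi> \<in> MC \<longleftrightarrow> (\<forall>k. \<phi> k \<in> M_test s q p V) \<and>
    (\<forall>e>0. \<exists>n. \<forall>i\<ge>n. \<forall>j\<ge>n. N (\<lambda>x. \<phi> i x - \<phi> j x) \<le> ennreal e)"
proof -
  have "(\<forall>e>0. \<exists>n. \<forall>i\<ge>n. \<forall>j\<ge>n. N (\<lambda>x. \<phi> i x - \<phi> j x) < e) \<longleftrightarrow>
      (\<forall>e>0. \<exists>n. \<forall>i\<ge>n. \<forall>j\<ge>n. N (\<lambda>x. \<phi> i x - \<phi> j x) \<le> ennreal e)" (is "?A \<longleftrightarrow> ?B")
  proof
    assume A: ?A
    show ?B
    proof (intro allI impI)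
      fix e :: real assume "0 < e"
      then have "0 < ennreal e" by simp
      with A obtain n where "\<forall>i\<ge>n. \<forall>j\<ge>n. N (\<lambda>x. \<phi> i x - \<phi> j x) < ennreal e" by blast
      then show "\<exists>n. \<forall>i\<ge>n. \<forall>j\<ge>n. N (\<lambda>x. \<phi> i x - \<phi> j x) \<le> ennreal e"
        by (meson less_imp_le)
    qed
  next
    assume B: ?B
    show ?A
    proof (intro allI impI)
      fix e :: ennreal assume "0 < e"
      then obtain y where "0 < y" "y < e"
        using dense by blast
      then obtain d :: real where d: "0 < d" "ennreal d < e"
        by (cases y) (auto simp: top_unique)
      with B obtain n where "\<forall>i\<ge>n. \<forall>j\<ge>n. N (\<lambda>x. \<phi> i x - \<phi> j x) \<le> ennreal d" by blast
      then show "\<exists>n. \<forall>i\<ge>n. \<forall>j\<ge>n. N (\<lambda>x. \<phi> i x - \<phi> j x) < e"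
        using d by (meson le_less_trans)
    qed
  qed
  then show ?thesis
    by (simp add: M_cauchy_def)
qed

lemma M_cauchyD:
  assumes "\<phi> \<in> MC"
  shows "\<phi> k \<in> M_test s q p V" "continuous_on UNIV (\<phi> k)" "\<phi> k \<in> borel_measurable borel"
    "\<phi> k \<in> borel_measurable lebesgue" "N (\<phi> k) < \<infinity>"
proof -
  show test: "\<phi> k \<in> M_test s q p V" and "N (\<phi> k) < \<infinity>"
    using assms by (auto simp: M_cauchy_def M_test_def)
  then show c: "continuous_on UNIV (\<phi> k)"
    by (intro C1c_continuous) (simp add: M_test_def)
  from c show "\<phi> k \<in> borel_measurable borel"
    by (rule borel_measurable_continuous_onI)
  then show "\<phi> k \<in> borel_measurable lebesgue"
    by (rule borel_measurable_lebesgueI)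
qed

lemma M_cauchy_bounded:
  assumes "\<phi> \<in> MC"
  shows "\<exists>B. \<forall>k. N (\<phi> k) \<le> ennreal B"
proof -
  note \<phi> = M_cauchyD[OF assms]
  obtain n where n: "\<And>i j. n \<le> i \<Longrightarrow> n \<le> j \<Longrightarrow> N (\<lambda>x. \<phi> i x - \<phi> j x) \<le> ennreal 1"
    using assms unfolding M_cauchy_iff by (metis zero_less_one)
  define S where "S = (\<Sum>k\<le>n. N (\<phi> k)) + 1"
  have S: "S < \<infinity>"
    using \<phi> by (simp add: S_def)
  have le: "N (\<phi> k) \<le> (\<Sum>k\<le>n. N (\<phi> k))" if "k \<le> n" for k
    using that by (intro member_le_sum) auto
  have "N (\<phi> k) \<le> S" for k
  proof (cases "k \<le> n")
    case True
    then show ?thesis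
      using le[OF True] by (simp add: S_def add_increasing2)
  next
    case False
    have "N (\<phi> k) \<le> N (\<phi> n) + N (\<lambda>x. \<phi> k x - \<phi> n x)"
      using N_add[of "\<phi> n" "\<lambda>x. \<phi> k x - \<phi> n x"] \<phi> by (simp add: borel_measurable_diff)
    also have "\<dots> \<le> (\<Sum>k\<le>n. N (\<phi> k)) + ennreal 1"
      using False by (intro add_mono le n) auto
    finally show ?thesis by (simp add: S_def)
  qed
  then show ?thesis
    using S by (intro exI[of _ "enn2real S"]) simp
qed

lemma N_diff_lincomb:
  assumes "u \<in> borel_measurable borel" "v \<in> borel_measurable borel"
    "u' \<in> borel_measurable borel" "v' \<in> borel_measurable borel"
  shows "N (\<lambda>x. (a * u x + b * v x) - (a * u' x + b * v' x)) \<le>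
    ennreal \<bar>a\<bar> * N (\<lambda>x. u x - u' x) + ennreal \<bar>b\<bar> * N (\<lambda>x. v x - v' x)"
  using N_lincomb[of "\<lambda>x. u x - u' x" "\<lambda>x. v x - v' x" a b] assms
  by (simp add: borel_measurable_diff algebra_simps)

lemma M_cauchy_lincomb:
  assumes "\<phi> \<in> MC" "\<eta> \<in> MC"
  shows "(\<lambda>k x. a * \<phi> k x + b * \<eta> k x) \<in> MC"
  unfolding M_cauchy_iff
proof (intro conjI allI impI)
  note \<phi> = M_cauchyD[OF assms(1)] and \<eta> = M_cauchyD[OF assms(2)]
  show "(\<lambda>x. a * \<phi> k x + b * \<eta> k x) \<in> M_test s q p V" for k
    by (intro M_test_lincomb \<phi> \<eta>)
  fix e :: real assume e: "0 < e"
  \<comment> \<open>The added 1 covers a = b = 0.\<close>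
  define d where "d = e / (\<bar>a\<bar> + \<bar>b\<bar> + 1)"
  have d: "0 < d" "(\<bar>a\<bar> + \<bar>b\<bar>) * d \<le> e"
    using e by (auto simp: d_def field_simps)
  obtain m where m: "\<And>i j. m \<le> i \<Longrightarrow> m \<le> j \<Longrightarrow> N (\<lambda>x. \<phi> i x - \<phi> j x) \<le> ennreal d"
    using assms(1) d unfolding M_cauchy_iff by blast
  obtain n where n: "\<And>i j. n \<le> i \<Longrightarrow> n \<le> j \<Longrightarrow> N (\<lambda>x. \<eta> i x - \<eta> j x) \<le> ennreal d"
    using assms(2) d unfolding M_cauchy_iff by blast
  show "\<exists>n. \<forall>i\<ge>n. \<forall>j\<ge>n. N (\<lambda>x. (a * \<phi> i x + b * \<eta> i x) - (a * \<phi> j x + b * \<eta> j x)) \<le> ennreal e"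
  proof (intro exI[of _ "max m n"] allI impI)
    fix i j assume ij: "max m n \<le> i" "max m n \<le> j"
    have "N (\<lambda>x. (a * \<phi> i x + b * \<eta> i x) - (a * \<phi> j x + b * \<eta> j x)) \<le>
        ennreal \<bar>a\<bar> * N (\<lambda>x. \<phi> i x - \<phi> j x) + ennreal \<bar>b\<bar> * N (\<lambda>x. \<eta> i x - \<eta> j x)"
      by (intro N_diff_lincomb \<phi> \<eta>)
    also have "\<dots> \<le> ennreal \<bar>a\<bar> * ennreal d + ennreal \<bar>b\<bar> * ennreal d"
      using ij by (intro add_mono mult_left_mono m n) auto
    also have "\<dots> = ennreal ((\<bar>a\<bar> + \<bar>b\<bar>) * d)"
      using d by (simp add: ennreal_mult distrib_right)
    also have "\<dots> \<le> ennreal e"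
      by (intro ennreal_leI d)
    finally show "N (\<lambda>x. (a * \<phi> i x + b * \<eta> i x) - (a * \<phi> j x + b * \<eta> j x)) \<le> ennreal e" .
  qed
qed

lemma N_zero: "N (\<lambda>x. 0) = 0"
  using N_cmult[of "\<lambda>_. 0" 0] by simp

lemma equiv_M_rel: "equiv MC R"
proof (rule equivI)
  show "R \<subseteq> MC \<times> MC" by (auto simp: M_rel_def)
  show "refl_on MC R"
    by (auto simp: refl_on_def M_rel_def N_zero)
  show "sym R"
    by (auto simp: sym_def M_rel_def N_commute[OF M_cauchyD(3) M_cauchyD(3)])
  show "trans R"
  proof (rule transI)
    fix \<phi> \<eta> \<theta> assume 1: "(\<phi>, \<eta>) \<in> R" "(\<eta>, \<theta>) \<in> R"
    then have mc: "\<phi> \<in> MC" "\<eta> \<in> MC" "\<theta> \<in> MC" by (auto simp: M_rel_def)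
    have "(\<lambda>k. N (\<lambda>x. \<phi> k x - \<eta> k x) + N (\<lambda>x. \<eta> k x - \<theta> k x)) \<longlonglongrightarrow> 0 + 0"
      using 1 by (intro tendsto_add) (auto simp: M_rel_def)
    then have "(\<lambda>k. N (\<lambda>x. \<phi> k x - \<theta> k x)) \<longlonglongrightarrow> 0"
      using mc by (intro tendsto_0_le_ennreal[OF N_diff_trans]) (auto intro: M_cauchyD)
    with mc show "(\<phi>, \<theta>) \<in> R" by (simp add: M_rel_def)
  qed
qed

text \<open>\<open>M_space_norm\<close> chooses a representative by \<open>SOME\<close>. The choice
  is a Cauchy sequence generating the class, so estimates can be made for it.\<close>

lemma M_space_rep:
  assumes "U \<in> M_space s q p V"
  shows "(SOME \<phi>. \<phi> \<in> U) \<in> MC" "U = R `` {SOME \<phi>. \<phi> \<in> U}"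
proof -
  obtain \<phi> where \<phi>: "\<phi> \<in> MC" "U = R `` {\<phi>}"
    using assms by (auto simp: M_space_def elim: quotientE)
  have "\<phi> \<in> U"
    using \<phi> equiv_class_self[OF equiv_M_rel] by auto
  then have "(SOME \<phi>. \<phi> \<in> U) \<in> U"
    by (rule someI[where P = "\<lambda>\<phi>. \<phi> \<in> U"])
  then have *: "(\<phi>, SOME \<phi>. \<phi> \<in> U) \<in> R"
    using \<phi> by auto
  then show "(SOME \<phi>. \<phi> \<in> U) \<in> MC"
    by (simp add: M_rel_def)
  show "U = R `` {SOME \<phi>. \<phi> \<in> U}"
    using equiv_class_eq[OF equiv_M_rel *] \<phi>(2) by metis
qed

lemma M_space_cases:
  assumes "U \<in> M_space s q p V"
  obtains \<phi> where "\<phi> \<in> MC" "U = R `` {\<phi>}"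
  using M_space_rep[OF assms] by metis

text \<open>\<open>M_space_norm\<close> is a \<open>lim\<close>, which carries information only once
  convergence is known; the triangle inequality makes the norms along a Cauchy sequence a Cauchy
  sequence themselves.\<close>

lemma M_space_norm_tendsto:
  assumes "U \<in> M_space s q p V"
  shows "(\<lambda>k. N ((SOME \<phi>. \<phi> \<in> U) k)) \<longlonglongrightarrow> M_space_norm s q p V U"
proof -
  define \<phi> where "\<phi> = (SOME \<phi>. \<phi> \<in> U)"
  have mc: "\<phi> \<in> MC"
    using M_space_rep[OF assms] by (simp add: \<phi>_def)
  note \<phi> = M_cauchyD[OF mc]
  have "convergent (\<lambda>k. N (\<phi> k))"
  proof (rule ennreal_Cauchy_imp_convergent)
    fix e :: real assume "0 < e"
    then obtain n where n: "\<And>i j. n \<le> i \<Longrightarrow> n \<le> j \<Longrightarrow> N (\<lambda>x. \<phi> i x - \<phi> j x) \<le> ennreal e"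
      using mc unfolding M_cauchy_iff by blast
    have "N (\<phi> i) \<le> N (\<phi> j) + ennreal e" if "n \<le> i" "n \<le> j" for i j
    proof -
      have "N (\<phi> i) \<le> N (\<phi> j) + N (\<lambda>x. \<phi> i x - \<phi> j x)"
        using N_add[of "\<phi> j" "\<lambda>x. \<phi> i x - \<phi> j x"] \<phi> by (simp add: borel_measurable_diff)
      also have "\<dots> \<le> N (\<phi> j) + ennreal e"
        by (intro add_left_mono n that)
      finally show ?thesis .
    qed
    then show "\<exists>n. \<forall>i\<ge>n. \<forall>j\<ge>n. N (\<phi> i) \<le> N (\<phi> j) + ennreal e" by blast
  qed (rule \<phi>)
  then show ?thesis
    unfolding M_space_norm_def \<phi>_def[symmetric] by (simp add: convergent_LIMSEQ_iff)
qed

text \<open>Other representatives change the combination by a sequence tending to 0 in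
  \<open>N\<close>, so all sets in the defining union coincide.\<close>

lemma M_space_lincomb_eq:
  assumes "\<phi> \<in> MC" "\<eta> \<in> MC"
  shows "M_space_lincomb s q p V a (R `` {\<phi>}) b (R `` {\<eta>}) = R `` {\<lambda>k x. a * \<phi> k x + b * \<eta> k x}"
proof -
  have *: "R `` {\<lambda>k x. a * \<phi>' k x + b * \<eta>' k x} = R `` {\<lambda>k x. a * \<phi> k x + b * \<eta> k x}"
    if 0: "\<phi>' \<in> R `` {\<phi>}" "\<eta>' \<in> R `` {\<eta>}" for \<phi>' \<eta>'
  proof -
    have 1: "(\<phi>, \<phi>') \<in> R" "(\<eta>, \<eta>') \<in> R" using 0 by auto
    have mc: "\<phi>' \<in> MC" "\<eta>' \<in> MC" using 1 by (auto simp: M_rel_def)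
    have "(\<lambda>k. ennreal \<bar>a\<bar> * N (\<lambda>x. \<phi> k x - \<phi>' k x) + ennreal \<bar>b\<bar> * N (\<lambda>x. \<eta> k x - \<eta>' k x)) \<longlonglongrightarrow> 0"
      using 1 by (intro tendsto_0_ennreal_lincomb) (auto simp: M_rel_def)
    then have "(\<lambda>k. N (\<lambda>x. (a * \<phi> k x + b * \<eta> k x) - (a * \<phi>' k x + b * \<eta>' k x))) \<longlonglongrightarrow> 0"
      using mc assms by (intro tendsto_0_le_ennreal[OF N_diff_lincomb]) (auto intro: M_cauchyD)
    then have "(\<lambda>k x. a * \<phi> k x + b * \<eta> k x, \<lambda>k x. a * \<phi>' k x + b * \<eta>' k x) \<in> R"
      using mc assms by (simp add: M_rel_def M_cauchy_lincomb)
    from equiv_class_eq[OF equiv_M_rel this] show ?thesis ..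
  qed
  have "M_space_lincomb s q p V a (R `` {\<phi>}) b (R `` {\<eta>}) =
      (\<Union>\<phi>'\<in>R `` {\<phi>}. \<Union>\<eta>'\<in>R `` {\<eta>}. R `` {\<lambda>k x. a * \<phi> k x + b * \<eta> k x})"
    unfolding M_space_lincomb_def by (intro SUP_cong refl *)
  also have "\<dots> = R `` {\<lambda>k x. a * \<phi> k x + b * \<eta> k x}"
    using equiv_class_self[OF equiv_M_rel assms(1)] equiv_class_self[OF equiv_M_rel assms(2)] by blast
  finally show ?thesis .
qed

text \<open>One almost everywhere limit, along a subsequence, serves both norms. With k fixed and j
  running along the subsequence, Fatou's lemma turns the Cauchy condition into convergence of the
  whole sequence.\<close>

lemma M_cauchy_limit:
  assumes "\<phi> \<in> MC"
  shows "\<exists>f. f \<in> borel_measurable lebesgue \<and> (\<lambda>k. Lq (\<lambda>x. \<phi> k x - f x)) \<longlonglongrightarrow> 0 \<and>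
    (\<lambda>k. Lr (\<lambda>x. \<phi> k x - f x)) \<longlonglongrightarrow> 0"
proof -
  note \<phi> = M_cauchyD[OF assms]
  obtain B where "\<And>k. N (\<phi> k) \<le> ennreal B"
    using M_cauchy_bounded[OF assms] by blast
  then obtain \<rho> f where \<rho>: "strict_mono \<rho>" and f: "f \<in> borel_measurable borel"
    and lim: "AE x in lebesgue. (\<lambda>k. \<phi> (\<rho> k) x) \<longlonglongrightarrow> f x"
    using bounded_AE_convergent_subseq[of \<phi> B] \<phi> by blast
  obtain C where C: "0 \<le> C" and Lr_le: "\<And>u. u \<in> borel_measurable borel \<Longrightarrow> Lr u \<le> ennreal C * N u"
    using lpn_K_le_N by blast
  have limk: "AE x in lebesgue. (\<lambda>j. \<phi> k x - \<phi> (\<rho> j) x) \<longlonglongrightarrow> \<phi> k x - f x" for k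
    using lim by eventually_elim (intro tendsto_intros)
  have meas: "(\<lambda>x. \<phi> i x - \<phi> j x) \<in> borel_measurable lebesgue" for i j
    using \<phi> by (intro borel_measurable_diff)
  have ev: "\<exists>n. \<forall>k\<ge>n. \<forall>\<^sub>F j in sequentially. N (\<lambda>x. \<phi> k x - \<phi> (\<rho> j) x) \<le> ennreal e" if "0 < e" for e
  proof -
    obtain n where n: "\<And>i j. n \<le> i \<Longrightarrow> n \<le> j \<Longrightarrow> N (\<lambda>x. \<phi> i x - \<phi> j x) \<le> ennreal e"
      using assms \<open>0 < e\<close> unfolding M_cauchy_iff by blast
    show ?thesis
    proof (intro exI allI impI)
      fix k assume k: "n \<le> k"
      show "\<forall>\<^sub>F j in sequentially. N (\<lambda>x. \<phi> k x - \<phi> (\<rho> j) x) \<le> ennreal e"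
        using eventually_ge_at_top[of n]
        by eventually_elim (intro n k order_trans[OF _ strict_mono_imp_increasing[OF \<rho>]])
    qed
  qed
  have "(\<lambda>k. Lq (\<lambda>x. \<phi> k x - f x)) \<longlonglongrightarrow> 0"
  proof (rule tendsto_0_ennreal_leI)
    fix e :: real assume "0 < e"
    then obtain n where n: "\<And>k. n \<le> k \<Longrightarrow> \<forall>\<^sub>F j in sequentially. N (\<lambda>x. \<phi> k x - \<phi> (\<rho> j) x) \<le> ennreal e"
      using ev by blast
    have "Lq (\<lambda>x. \<phi> k x - f x) \<le> ennreal e" if "n \<le> k" for k
      using r n[OF that]
      by (intro lpn_Fatou[OF meas V_meas _ limk]) (auto elim!: eventually_mono intro: order_trans[OF lpn_V_le_N])
    then show "\<exists>n. \<forall>k\<ge>n. Lq (\<lambda>x. \<phi> k x - f x) \<le> ennreal e" by blast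
  qed
  moreover have "(\<lambda>k. Lr (\<lambda>x. \<phi> k x - f x)) \<longlonglongrightarrow> 0"
  proof (rule tendsto_0_ennreal_leI)
    fix e :: real assume e: "0 < e"
    define d where "d = e / (C + 1)"
    have d: "0 < d" "C * d \<le> e"
      using e C by (auto simp: d_def field_simps)
    obtain n where n: "\<And>k. n \<le> k \<Longrightarrow> \<forall>\<^sub>F j in sequentially. N (\<lambda>x. \<phi> k x - \<phi> (\<rho> j) x) \<le> ennreal d"
      using ev[OF d(1)] by blast
    have "Lr (\<lambda>x. \<phi> k x - f x) \<le> ennreal e" if "n \<le> k" for k
    proof (rule lpn_Fatou[OF meas K_meas _ limk])
      show "\<forall>\<^sub>F j in sequentially. Lr (\<lambda>x. \<phi> k x - \<phi> (\<rho> j) x) \<le> ennreal e"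
        using n[OF that]
      proof eventually_elim
        case (elim j)
        have "Lr (\<lambda>x. \<phi> k x - \<phi> (\<rho> j) x) \<le> ennreal C * N (\<lambda>x. \<phi> k x - \<phi> (\<rho> j) x)"
          using \<phi> by (intro Lr_le borel_measurable_diff)
        also have "\<dots> \<le> ennreal C * ennreal d"
          by (intro mult_left_mono elim) auto
        also have "\<dots> = ennreal (C * d)" using C d by (simp add: ennreal_mult)
        also have "\<dots> \<le> ennreal e" by (intro ennreal_leI d)
        finally show ?case .
      qed
    qed (use r in auto)
    then show "\<exists>n. \<forall>k\<ge>n. Lr (\<lambda>x. \<phi> k x - f x) \<le> ennreal e" by blast
  qed
  ultimately show ?thesis
    using f by (blast intro: borel_measurable_lebesgueI)
qed

text \<open>Members of \<open>M_function\<close> must be limits of every representative. One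
  inclusion is uniqueness of limits in \<open>Lq\<close>; for the other, equivalent sequences differ
  by a sequence tending to 0 in \<open>N\<close> and hence in \<open>Lq\<close>.\<close>

lemma M_function_eq_ae_class:
  assumes mc: "\<phi> \<in> MC" and f: "f \<in> borel_measurable lebesgue"
    and lim: "(\<lambda>k. Lq (\<lambda>x. \<phi> k x - f x)) \<longlonglongrightarrow> 0"
  shows "M_function q V (R `` {\<phi>}) = ae_class f"
proof (intro set_eqI iffI)
  fix v assume v: "v \<in> M_function q V (R `` {\<phi>})"
  have "\<phi> \<in> R `` {\<phi>}"
    using mc equiv_class_self[OF equiv_M_rel] by auto
  with v have vm: "v \<in> borel_measurable lebesgue" and vl: "(\<lambda>k. Lq (\<lambda>x. \<phi> k x - v x)) \<longlonglongrightarrow> 0"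
    by (auto simp: M_function_def weighted_norm_eq_lpn)
  have "Lq (\<lambda>x. v x - f x) \<le> Lq (\<lambda>x. \<phi> k x - v x) + Lq (\<lambda>x. \<phi> k x - f x)" for k
    using Lq_diff_trans[OF vm M_cauchyD(4)[OF mc, of k] f] by (simp add: lpn_commute[of _ _ _ v])
  moreover have "(\<lambda>k. Lq (\<lambda>x. \<phi> k x - v x) + Lq (\<lambda>x. \<phi> k x - f x)) \<longlonglongrightarrow> 0"
    using tendsto_add[OF vl lim] by simp
  ultimately have "(\<lambda>k :: nat. Lq (\<lambda>x. v x - f x)) \<longlonglongrightarrow> 0"
    by (rule tendsto_0_le_ennreal)
  then have "Lq (\<lambda>x. v x - f x) = 0"
    by (simp add: LIMSEQ_const_iff)
  then have "AE x in lebesgue. v x - f x = 0"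
    using vm f r V_pos by (subst (asm) lpn_eq_0_iff) auto
  then show "v \<in> ae_class f"
    using vm by (simp add: ae_class_def)
next
  fix v assume "v \<in> ae_class f"
  then have vm: "v \<in> borel_measurable lebesgue" and vf: "AE x in lebesgue. v x = f x"
    by (auto simp: ae_class_def)
  have "(\<lambda>k. Lq (\<lambda>x. \<eta> k x - v x)) \<longlonglongrightarrow> 0" if \<eta>: "(\<phi>, \<eta>) \<in> R" for \<eta>
  proof -
    have mc': "\<eta> \<in> MC" using \<eta> by (simp add: M_rel_def)
    have "Lq (\<lambda>x. \<eta> k x - v x) \<le> N (\<lambda>x. \<phi> k x - \<eta> k x) + Lq (\<lambda>x. \<phi> k x - f x)" for k
    proof -
      have "Lq (\<lambda>x. \<eta> k x - v x) = Lq (\<lambda>x. \<eta> k x - f x)"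
        using vf by (intro lpn_cong_AE) auto
      also have "\<dots> \<le> Lq (\<lambda>x. \<phi> k x - \<eta> k x) + Lq (\<lambda>x. \<phi> k x - f x)"
        using Lq_diff_trans[OF M_cauchyD(4)[OF mc', of k] M_cauchyD(4)[OF mc, of k] f]
        by (simp add: lpn_commute[of _ _ _ "\<eta> k"])
      also have "\<dots> \<le> N (\<lambda>x. \<phi> k x - \<eta> k x) + Lq (\<lambda>x. \<phi> k x - f x)"
        by (intro add_right_mono lpn_V_le_N)
      finally show ?thesis .
    qed
    moreover have "(\<lambda>k. N (\<lambda>x. \<phi> k x - \<eta> k x) + Lq (\<lambda>x. \<phi> k x - f x)) \<longlonglongrightarrow> 0 + 0"
      using \<eta> by (intro tendsto_add lim) (simp add: M_rel_def)
    ultimately show ?thesis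
      unfolding add_0_left by (rule tendsto_0_le_ennreal)
  qed
  then show "v \<in> M_function q V (R `` {\<phi>})"
    using vm by (auto simp: M_function_def weighted_norm_eq_lpn)
qed

lemma Lr_finite_of_limit:
  assumes "u \<in> borel_measurable borel" "N u < \<infinity>" "f \<in> borel_measurable lebesgue" "Lr (\<lambda>x. u x - f x) < \<infinity>"
  shows "Lr f < \<infinity>"
proof -
  obtain C where "\<And>u. u \<in> borel_measurable borel \<Longrightarrow> Lr u \<le> ennreal C * N u"
    using lpn_K_le_N by blast
  then have "Lr u \<le> ennreal C * N u" using assms by blast
  also have "\<dots> < \<infinity>" using assms by (simp add: ennreal_mult_less_top)
  finally have "Lr u < \<infinity>" .
  moreover have "Lr f \<le> Lr (\<lambda>x. u x - f x) + Lr u"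
    using Lr_diff_trans[of f u "\<lambda>_. 0"] assms borel_measurable_lebesgueI[OF assms(1)]
    by (simp add: lpn_commute[of _ _ _ f])
  moreover have "Lr (\<lambda>x. u x - f x) + Lr u < \<infinity>"
    using assms(4) \<open>Lr u < \<infinity>\<close> by simp
  ultimately show ?thesis
    by (rule_tac le_less_trans)
qed

lemma M_space_function:
  assumes "U \<in> M_space s q p V"
  shows "\<exists>f. f \<in> borel_measurable lebesgue \<and> M_function q V U = ae_class f \<and> Lr f < \<infinity> \<and>
    (\<lambda>k. Lr (\<lambda>x. (SOME \<phi>. \<phi> \<in> U) k x - f x)) \<longlonglongrightarrow> 0"
proof -
  define \<phi> where "\<phi> = (SOME \<phi>. \<phi> \<in> U)"
  have mc: "\<phi> \<in> MC" and U: "U = R `` {\<phi>}"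
    using M_space_rep[OF assms] by (simp_all add: \<phi>_def)
  obtain f where f: "f \<in> borel_measurable lebesgue" and lq: "(\<lambda>k. Lq (\<lambda>x. \<phi> k x - f x)) \<longlonglongrightarrow> 0"
    and lr: "(\<lambda>k. Lr (\<lambda>x. \<phi> k x - f x)) \<longlonglongrightarrow> 0"
    using M_cauchy_limit[OF mc] by blast
  have "\<forall>\<^sub>F k in sequentially. Lr (\<lambda>x. \<phi> k x - f x) \<le> ennreal 1"
    by (intro tendsto_0_ennreal_leD[OF lr]) simp
  then obtain k where "Lr (\<lambda>x. \<phi> k x - f x) \<le> ennreal 1"
    using eventually_happens'[OF sequentially_bot] by blast
  then have "Lr (\<lambda>x. \<phi> k x - f x) < \<infinity>"
    by (rule le_less_trans) simp
  then have "Lr f < \<infinity>"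
    by (rule Lr_finite_of_limit[OF M_cauchyD(3)[OF mc] M_cauchyD(5)[OF mc] f])
  moreover have "M_function q V U = ae_class f"
    unfolding U by (rule M_function_eq_ae_class[OF mc f lq])
  ultimately show ?thesis
    using f lr unfolding \<phi>_def[symmetric] by (intro exI[of _ f] conjI)
qed

text \<open>Equality of the functions says only that the difference \<open>w\<close> of two
  representatives tends to 0 in \<open>Lq\<close>. The seminorm of \<open>w k - w j\<close> is small
  by the Cauchy property, and Fatou's lemma in j, along a subsequence tending to 0 almost
  everywhere, passes this on to \<open>w k\<close>.\<close>

lemma inj_on_M_function: "inj_on (M_function q V) (M_space s q p V)"
proof (rule inj_onI)
  fix U U' assume U: "U \<in> M_space s q p V" and U': "U' \<in> M_space s q p V"
    and eq: "M_function q V U = M_function q V U'"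
  obtain \<phi> where \<phi>: "\<phi> \<in> MC" "U = R `` {\<phi>}" using M_space_cases[OF U] .
  obtain \<eta> where \<eta>: "\<eta> \<in> MC" "U' = R `` {\<eta>}" using M_space_cases[OF U'] .
  obtain f where f: "f \<in> borel_measurable lebesgue" and lf: "(\<lambda>k. Lq (\<lambda>x. \<phi> k x - f x)) \<longlonglongrightarrow> 0"
    using M_cauchy_limit[OF \<phi>(1)] by blast
  obtain g where g: "g \<in> borel_measurable lebesgue" and lg: "(\<lambda>k. Lq (\<lambda>x. \<eta> k x - g x)) \<longlonglongrightarrow> 0"
    using M_cauchy_limit[OF \<eta>(1)] by blast
  have "ae_class f = ae_class g"
    using eq unfolding \<phi>(2) \<eta>(2) M_function_eq_ae_class[OF \<phi>(1) f lf]
      M_function_eq_ae_class[OF \<eta>(1) g lg] .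
  then have fg: "AE x in lebesgue. f x = g x"
    using ae_class_eq_iff[OF f g] by blast
  define w where "w k x = \<phi> k x - \<eta> k x" for k x
  have w: "w \<in> MC"
    using M_cauchy_lincomb[OF \<phi>(1) \<eta>(1), of 1 "-1"] by (simp add: w_def[abs_def])
  note wD = M_cauchyD[OF w]
  have Lq_w: "(\<lambda>k. Lq (w k)) \<longlonglongrightarrow> 0"
  proof (rule tendsto_0_le_ennreal)
    fix k
    have "Lq (\<lambda>x. \<phi> k x - \<eta> k x) \<le> Lq (\<lambda>x. \<phi> k x - f x) + Lq (\<lambda>x. f x - \<eta> k x)"
      by (intro Lq_diff_trans M_cauchyD(4)[OF \<phi>(1)] M_cauchyD(4)[OF \<eta>(1)] f)
    also have "Lq (\<lambda>x. f x - \<eta> k x) = Lq (\<lambda>x. g x - \<eta> k x)"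
      using fg by (intro lpn_cong_AE) auto
    finally show "Lq (w k) \<le> Lq (\<lambda>x. \<phi> k x - f x) + Lq (\<lambda>x. \<eta> k x - g x)"
      by (simp add: w_def[abs_def] lpn_commute[of _ _ _ g])
  next
    have "(\<lambda>k. Lq (\<lambda>x. \<phi> k x - f x) + Lq (\<lambda>x. \<eta> k x - g x)) \<longlonglongrightarrow> 0 + 0"
      by (intro tendsto_add lf lg)
    then show "(\<lambda>k. Lq (\<lambda>x. \<phi> k x - f x) + Lq (\<lambda>x. \<eta> k x - g x)) \<longlonglongrightarrow> 0" by simp
  qed
  obtain B where "\<And>k. N (w k) \<le> ennreal B"
    using M_cauchy_bounded[OF w] by blast
  then obtain \<rho> h where \<rho>: "strict_mono \<rho>" and h: "h \<in> borel_measurable borel"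
    and lim: "AE x in lebesgue. (\<lambda>k. w (\<rho> k) x) \<longlonglongrightarrow> h x"
    using bounded_AE_convergent_subseq[of w B] wD(3) by blast
  \<comment> \<open>The almost everywhere limit is 0, since Fatou's lemma bounds its norm by every
    positive e.\<close>
  have "Lq h \<le> 0 + ennreal e" if e: "0 < e" for e
  proof -
    have "\<forall>\<^sub>F j in sequentially. Lq (w (\<rho> j)) \<le> ennreal e"
      by (rule tendsto_0_ennreal_leD[OF LIMSEQ_subseq_LIMSEQ[OF Lq_w \<rho>, unfolded o_def] e])
    then have "Lq h \<le> ennreal e"
      using r by (intro lpn_Fatou[OF wD(4) V_meas _ lim]) auto
    then show ?thesis by simp
  qed
  then have "Lq h \<le> 0"
    by (rule ennreal_le_epsilon)
  then have h0: "AE x in lebesgue. h x = 0"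
    using lpn_eq_0_iff[of h lebesgue V q] borel_measurable_lebesgueI[OF h] r V_pos by simp
  have gag: "(\<lambda>k. gagliardo_seminorm s p (w k)) \<longlonglongrightarrow> 0"
  proof (rule tendsto_0_ennreal_leI)
    fix e :: real assume "0 < e"
    then obtain n where n: "\<And>i j. n \<le> i \<Longrightarrow> n \<le> j \<Longrightarrow> N (\<lambda>x. w i x - w j x) \<le> ennreal e"
      using w unfolding M_cauchy_iff by blast
    have "gagliardo_seminorm s p (w k) \<le> ennreal e" if k: "n \<le> k" for k
    proof (rule gagliardo_seminorm_Fatou[where w = "\<lambda>j x. w k x - w (\<rho> j) x"])
      show "continuous_on UNIV (\<lambda>x. w k x - w (\<rho> j) x)" for j
        by (intro continuous_intros wD)
      have "AE x in lebesgue. (\<lambda>j. w k x - w (\<rho> j) x) \<longlonglongrightarrow> w k x"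
        using lim h0
      proof eventually_elim
        case (elim x)
        then have "(\<lambda>j. w k x - w (\<rho> j) x) \<longlonglongrightarrow> w k x - 0"
          by (intro tendsto_diff) auto
        then show ?case by simp
      qed
      then show "AE x in lborel. (\<lambda>j. w k x - w (\<rho> j) x) \<longlonglongrightarrow> w k x"
        by (simp add: AE_completion_iff)
      show "\<forall>\<^sub>F j in sequentially. gagliardo_seminorm s p (\<lambda>x. w k x - w (\<rho> j) x) \<le> ennreal e"
        using eventually_ge_at_top[of n]
      proof eventually_elim
        case (elim j)
        then have "n \<le> \<rho> j"
          using strict_mono_imp_increasing[OF \<rho>, of j] by simp
        then show ?case
          by (rule order_trans[OF gagliardo_le_N n[OF k]])
      qed
    qed (intro wD(2) p s)+
    then show "\<exists>n. \<forall>k\<ge>n. gagliardo_seminorm s p (w k) \<le> ennreal e" by blast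
  qed
  have "(\<lambda>k. Lq (w k) + gagliardo_seminorm s p (w k)) \<longlonglongrightarrow> 0 + 0"
    by (intro tendsto_add Lq_w gag)
  then have "(\<phi>, \<eta>) \<in> R"
    using \<phi>(1) \<eta>(1) unfolding M_rel_def M_norm_def weighted_norm_eq_lpn w_def[abs_def] by simp
  then show "U = U'"
    unfolding \<phi>(2) \<eta>(2) by (rule equiv_class_eq[OF equiv_M_rel])
qed

lemma M_function_lincomb:
  assumes "U \<in> M_space s q p V" "U' \<in> M_space s q p V"
  shows "M_function q V (M_space_lincomb s q p V a U b U') =
    L_space_lincomb a (M_function q V U) b (M_function q V U')"
proof -
  obtain \<phi> where \<phi>: "\<phi> \<in> MC" "U = R `` {\<phi>}" using M_space_cases[OF assms(1)] .
  obtain \<eta> where \<eta>: "\<eta> \<in> MC" "U' = R `` {\<eta>}" using M_space_cases[OF assms(2)] .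
  obtain f where f: "f \<in> borel_measurable lebesgue" and lf: "(\<lambda>k. Lq (\<lambda>x. \<phi> k x - f x)) \<longlonglongrightarrow> 0"
    using M_cauchy_limit[OF \<phi>(1)] by blast
  obtain g where g: "g \<in> borel_measurable lebesgue" and lg: "(\<lambda>k. Lq (\<lambda>x. \<eta> k x - g x)) \<longlonglongrightarrow> 0"
    using M_cauchy_limit[OF \<eta>(1)] by blast
  note [measurable] = f g M_cauchyD(4)[OF \<phi>(1)] M_cauchyD(4)[OF \<eta>(1)]
  have "(\<lambda>k. Lq (\<lambda>x. (a * \<phi> k x + b * \<eta> k x) - (a * f x + b * g x))) \<longlonglongrightarrow> 0"
  proof (rule tendsto_0_le_ennreal)
    fix k
    have "Lq (\<lambda>x. a * (\<phi> k x - f x) + b * (\<eta> k x - g x)) \<le>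
        Lq (\<lambda>x. a * (\<phi> k x - f x)) + Lq (\<lambda>x. b * (\<eta> k x - g x))"
      using r V_pos by (intro lpn_triangle) (auto intro: less_imp_le)
    also have "\<dots> \<le> ennreal \<bar>a\<bar> * Lq (\<lambda>x. \<phi> k x - f x) + ennreal \<bar>b\<bar> * Lq (\<lambda>x. \<eta> k x - g x)"
      using r by (intro add_mono lpn_cmult_le) auto
    finally show "Lq (\<lambda>x. (a * \<phi> k x + b * \<eta> k x) - (a * f x + b * g x)) \<le>
        ennreal \<bar>a\<bar> * Lq (\<lambda>x. \<phi> k x - f x) + ennreal \<bar>b\<bar> * Lq (\<lambda>x. \<eta> k x - g x)"
      by (simp add: algebra_simps)
  qed (rule tendsto_0_ennreal_lincomb[OF lf lg])
  then have "M_function q V (R `` {\<lambda>k x. a * \<phi> k x + b * \<eta> k x}) = ae_class (\<lambda>x. a * f x + b * g x)"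
    by (intro M_function_eq_ae_class M_cauchy_lincomb \<phi> \<eta>) auto
  then show ?thesis
    unfolding \<phi>(2) \<eta>(2) M_space_lincomb_eq[OF \<phi>(1) \<eta>(1)] M_function_eq_ae_class[OF \<phi>(1) f lf]
      M_function_eq_ae_class[OF \<eta>(1) g lg] L_space_lincomb_ae_class[OF f g] .
qed

section \<open>Boundedness and compactness of the embedding\<close>

lemma L_space_norm_M_function_le:
  "\<exists>C. \<forall>U\<in>M_space s q p V. L_space_norm r K (M_function q V U) \<le> ennreal C * M_space_norm s q p V U"
proof -
  obtain C where C: "0 \<le> C" and Lr_le: "\<And>u. u \<in> borel_measurable borel \<Longrightarrow> Lr u \<le> ennreal C * N u"
    using lpn_K_le_N by blast
  have "L_space_norm r K (M_function q V U) \<le> ennreal C * M_space_norm s q p V U"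
    if U: "U \<in> M_space s q p V" for U
  proof -
    define \<phi> where "\<phi> = (SOME \<phi>. \<phi> \<in> U)"
    have mc: "\<phi> \<in> MC"
      using M_space_rep[OF U] by (simp add: \<phi>_def)
    obtain f where f: "f \<in> borel_measurable lebesgue" and Uf: "M_function q V U = ae_class f"
      and lim: "(\<lambda>k. Lr (\<lambda>x. \<phi> k x - f x)) \<longlonglongrightarrow> 0"
      using M_space_function[OF U] unfolding \<phi>_def[symmetric] by blast
    have "Lr f \<le> Lr (\<lambda>x. \<phi> k x - f x) + ennreal C * N (\<phi> k)" for k
    proof -
      have "Lr f \<le> Lr (\<lambda>x. \<phi> k x - f x) + Lr (\<phi> k)"
        using Lr_diff_trans[of f "\<phi> k" "\<lambda>_. 0"] f M_cauchyD[OF mc]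
        by (simp add: lpn_commute[of _ _ _ f])
      also have "\<dots> \<le> Lr (\<lambda>x. \<phi> k x - f x) + ennreal C * N (\<phi> k)"
        using M_cauchyD[OF mc] by (intro add_left_mono Lr_le)
      finally show ?thesis .
    qed
    moreover have "(\<lambda>k. Lr (\<lambda>x. \<phi> k x - f x) + ennreal C * N (\<phi> k)) \<longlonglongrightarrow> 0 + ennreal C * M_space_norm s q p V U"
      using M_space_norm_tendsto[OF U] unfolding \<phi>_def[symmetric]
      by (intro tendsto_add lim ennreal_tendsto_cmult) auto
    ultimately have "Lr f \<le> 0 + ennreal C * M_space_norm s q p V U"
      by (intro tendsto_lowerbound[where f = "\<lambda>k. Lr (\<lambda>x. \<phi> k x - f x) + ennreal C * N (\<phi> k)"]) auto
    then show ?thesis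
      by (simp add: Uf L_space_norm_ae_class f)
  qed
  then show ?thesis by blast
qed

text \<open>Each class is replaced by one test function, taken so far out in its representative that
  \<open>N\<close> is at most \<open>\<bar>B\<bar> + 1\<close> and the distance in \<open>Lr\<close>
  to the function of the class is at most 1 / (k + 1). The results on bounded sequences of Borel
  functions then apply, and the replacement error tends to 0.\<close>

lemma M_function_compact:
  fixes U :: "nat \<Rightarrow> (nat \<Rightarrow> real^'n \<Rightarrow> real) set"
  assumes U: "\<And>k. U k \<in> M_space s q p V" and B: "\<And>k. M_space_norm s q p V (U k) \<le> ennreal B"
  shows "\<exists>\<rho>. \<exists>A\<in>L_space r K. strict_mono \<rho> \<and>
    (\<lambda>k. L_space_norm r K (L_space_lincomb 1 (M_function q V (U (\<rho> k))) (-1) A)) \<longlonglongrightarrow> 0"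
proof -
  define \<phi> where "\<phi> k = (SOME \<phi>. \<phi> \<in> U k)" for k
  have mc: "\<phi> k \<in> MC" for k
    using M_space_rep[OF U] by (simp add: \<phi>_def)
  have "\<exists>f. f \<in> borel_measurable lebesgue \<and> M_function q V (U k) = ae_class f \<and>
      (\<lambda>j. Lr (\<lambda>x. \<phi> k j x - f x)) \<longlonglongrightarrow> 0" for k
    using M_space_function[OF U[of k]] unfolding \<phi>_def[symmetric] by blast
  then have "\<exists>f. \<forall>k. f k \<in> borel_measurable lebesgue \<and> M_function q V (U k) = ae_class (f k) \<and>
      (\<lambda>j. Lr (\<lambda>x. \<phi> k j x - f k x)) \<longlonglongrightarrow> 0"
    by (intro choice allI)
  then obtain f where f [measurable]: "\<And>k. f k \<in> borel_measurable lebesgue"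
    and Uf: "\<And>k. M_function q V (U k) = ae_class (f k)"
    and lim: "\<And>k. (\<lambda>j. Lr (\<lambda>x. \<phi> k j x - f k x)) \<longlonglongrightarrow> 0"
    by blast
  have "\<exists>j. N (\<phi> k j) \<le> ennreal (\<bar>B\<bar> + 1) \<and> Lr (\<lambda>x. \<phi> k j x - f k x) \<le> ennreal (1 / real (Suc k))" for k
  proof -
    have "M_space_norm s q p V (U k) \<le> ennreal \<bar>B\<bar>"
      using B by (rule order_trans) (simp add: ennreal_leI)
    also have "\<dots> < ennreal (\<bar>B\<bar> + 1)"
      by (intro ennreal_lessI) auto
    finally have "\<forall>\<^sub>F j in sequentially. N (\<phi> k j) < ennreal (\<bar>B\<bar> + 1)"
      using M_space_norm_tendsto[OF U] unfolding \<phi>_def by (intro order_tendstoD(2))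
    moreover have "\<forall>\<^sub>F j in sequentially. Lr (\<lambda>x. \<phi> k j x - f k x) \<le> ennreal (1 / real (Suc k))"
      by (intro tendsto_0_ennreal_leD lim) simp
    ultimately have "\<forall>\<^sub>F j in sequentially. N (\<phi> k j) \<le> ennreal (\<bar>B\<bar> + 1) \<and>
        Lr (\<lambda>x. \<phi> k j x - f k x) \<le> ennreal (1 / real (Suc k))"
      by eventually_elim (auto intro: less_imp_le)
    then show ?thesis
      by (rule eventually_happens'[OF sequentially_bot])
  qed
  then have "\<exists>j. \<forall>k. N (\<phi> k (j k)) \<le> ennreal (\<bar>B\<bar> + 1) \<and>
      Lr (\<lambda>x. \<phi> k (j k) x - f k x) \<le> ennreal (1 / real (Suc k))"
    by (intro choice allI)
  then obtain j where j: "\<And>k. N (\<phi> k (j k)) \<le> ennreal (\<bar>B\<bar> + 1)"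
    "\<And>k. Lr (\<lambda>x. \<phi> k (j k) x - f k x) \<le> ennreal (1 / real (Suc k))"
    by blast
  define t where "t k = \<phi> k (j k)" for k
  have t: "t k \<in> borel_measurable borel" for k
    unfolding t_def by (rule M_cauchyD[OF mc])
  have Nt: "N (t k) \<le> ennreal (\<bar>B\<bar> + 1)" for k
    unfolding t_def by (rule j)
  obtain \<rho> g where \<rho>: "strict_mono \<rho>" and g: "g \<in> borel_measurable borel"
    and ae: "AE x in lebesgue. (\<lambda>k. t (\<rho> k) x) \<longlonglongrightarrow> g x"
    using bounded_AE_convergent_subseq[of t, OF t Nt] by blast
  note gl = borel_measurable_lebesgueI[OF g] and tl = borel_measurable_lebesgueI[OF t]
  have tg: "(\<lambda>k. Lr (\<lambda>x. t (\<rho> k) x - g x)) \<longlonglongrightarrow> 0"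
    by (rule AE_convergent_bounded_imp_lpn_K_tendsto[OF t g Nt ae])
  have "\<forall>\<^sub>F k in sequentially. Lr (\<lambda>x. t (\<rho> k) x - g x) \<le> ennreal 1"
    by (intro tendsto_0_ennreal_leD[OF tg]) simp
  then obtain k where "Lr (\<lambda>x. t (\<rho> k) x - g x) \<le> ennreal 1"
    using eventually_happens'[OF sequentially_bot] by blast
  then have "Lr (\<lambda>x. t (\<rho> k) x - g x) < \<infinity>"
    by (rule le_less_trans) simp
  moreover have "N (t (\<rho> k)) < \<infinity>"
    using Nt by (rule le_less_trans) simp
  ultimately have "Lr g < \<infinity>"
    by (intro Lr_finite_of_limit[OF t _ gl])
  then have A: "ae_class g \<in> L_space r K"
    using gl by (auto simp: L_space_def weighted_norm_eq_lpn)
  have "(\<lambda>k. Lr (\<lambda>x. f (\<rho> k) x - g x)) \<longlonglongrightarrow> 0"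
  proof (rule tendsto_0_le_ennreal)
    fix k
    have "Lr (\<lambda>x. f (\<rho> k) x - g x) \<le> Lr (\<lambda>x. t (\<rho> k) x - f (\<rho> k) x) + Lr (\<lambda>x. t (\<rho> k) x - g x)"
      using Lr_diff_trans[OF f tl gl, of "\<rho> k" "\<rho> k"] by (simp add: lpn_commute[of _ _ _ "f (\<rho> k)"])
    also have "\<dots> \<le> ennreal (1 / real (Suc k)) + Lr (\<lambda>x. t (\<rho> k) x - g x)"
    proof (intro add_right_mono)
      have "Lr (\<lambda>x. t (\<rho> k) x - f (\<rho> k) x) \<le> ennreal (1 / real (Suc (\<rho> k)))"
        unfolding t_def by (rule j)
      also have "\<dots> \<le> ennreal (1 / real (Suc k))"
        using strict_mono_imp_increasing[OF \<rho>, of k] by (intro ennreal_leI divide_left_mono) auto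
      finally show "Lr (\<lambda>x. t (\<rho> k) x - f (\<rho> k) x) \<le> ennreal (1 / real (Suc k))" .
    qed
    finally show "Lr (\<lambda>x. f (\<rho> k) x - g x) \<le> ennreal (1 / real (Suc k)) + Lr (\<lambda>x. t (\<rho> k) x - g x)" .
  next
    have "(\<lambda>k. ennreal (1 / real (Suc k))) \<longlonglongrightarrow> ennreal 0"
      by (intro tendsto_ennrealI LIMSEQ_Suc[OF lim_1_over_n])
    then have "(\<lambda>k. ennreal (1 / real (Suc k)) + Lr (\<lambda>x. t (\<rho> k) x - g x)) \<longlonglongrightarrow> ennreal 0 + 0"
      by (intro tendsto_add tg)
    then show "(\<lambda>k. ennreal (1 / real (Suc k)) + Lr (\<lambda>x. t (\<rho> k) x - g x)) \<longlonglongrightarrow> 0" by simp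
  qed
  moreover have "L_space_norm r K (L_space_lincomb 1 (M_function q V (U (\<rho> k))) (-1) (ae_class g)) =
      Lr (\<lambda>x. f (\<rho> k) x - g x)" for k
    unfolding Uf L_space_lincomb_ae_class[OF f gl] using f[of "\<rho> k"] gl
    by (subst L_space_norm_ae_class) simp_all
  ultimately have "(\<lambda>k. L_space_norm r K (L_space_lincomb 1 (M_function q V (U (\<rho> k))) (-1) (ae_class g)))
      \<longlonglongrightarrow> 0"
    by simp
  with A \<rho> show ?thesis by blast
qed

lemma compactly_embedded: "M_compactly_embedded s q p V r K"
  unfolding M_compactly_embedded_def
proof (intro conjI ballI allI impI)
  show "M_function q V \<in> M_space s q p V \<rightarrow> L_space r K"
  proof
    fix U assume "U \<in> M_space s q p V"
    then obtain f where "f \<in> borel_measurable lebesgue" "M_function q V U = ae_class f" "Lr f < \<infinity>"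
      using M_space_function by blast
    then show "M_function q V U \<in> L_space r K"
      by (auto simp: L_space_def weighted_norm_eq_lpn)
  qed
  show "\<exists>\<rho>. \<exists>A\<in>L_space r K. strict_mono \<rho> \<and>
      (\<lambda>k. L_space_norm r K (L_space_lincomb 1 (M_function q V (U (\<rho> k))) (-1) A)) \<longlonglongrightarrow> 0"
    if U: "(\<forall>k. U k \<in> M_space s q p V) \<and> (\<exists>B. \<forall>k. M_space_norm s q p V (U k) \<le> ennreal B)"
    for U :: "nat \<Rightarrow> (nat \<Rightarrow> real^'n \<Rightarrow> real) set"
  proof -
    from U obtain B where "\<forall>k. M_space_norm s q p V (U k) \<le> ennreal B" by (elim conjE exE)
    with U show ?thesis
      by (intro M_function_compact[of U B]) simp_all
  qed
  show "M_function q V (M_space_lincomb s q p V a U b U') =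
      L_space_lincomb a (M_function q V U) b (M_function q V U')"
    if "U \<in> M_space s q p V" "U' \<in> M_space s q p V" for U U' a b
    using that by (rule M_function_lincomb)
qed (rule inj_on_M_function L_space_norm_M_function_le)+

end

theorem theorem10:
  fixes K V :: "real^'n \<Rightarrow> real"
    and p t :: ennreal
    and s q r V\<^sub>0 q' \<tau> :: real
  assumes "CARD('n) \<ge> 2"
    and "1 \<le> p"
    and "0 < s" and "s < 1"
    and "of_nat CARD('n) \<le> ennreal s * p"
    and "1 \<le> r" and "r < q"
    and "K \<in> borel_measurable lebesgue" and "\<And>x. 0 < K x"
    and "V \<in> borel_measurable lebesgue" and "\<And>x. 0 < V x"
    and "1 < t" and "K \<in> Lt_loc t"
    and "0 < V\<^sub>0" and "V\<^sub>0 \<le> (INF x. V x)"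
    and "q < q'"
    and "0 < \<tau>" and "\<tau> \<le> r / (q - r)"
    and "integrable lebesgue (\<lambda>x. K x powr psi q r q' \<tau> * V x powr (-\<tau>))"
  shows "M_compactly_embedded s q p V r K"
proof -
  \<comment> \<open>The infimum of a set of reals is known to be a lower bound only if the set is
    bounded below; positivity of \<open>V\<close> provides that.\<close>
  have "bdd_below (range V)"
    using assms(11) by (intro bdd_belowI[of _ 0]) (auto intro: less_imp_le)
  then have V: "V\<^sub>0 \<le> V x" for x
    by (rule order_trans[OF assms(15) cINF_lower]) simp
  interpret weighted_embedding K V p s q r V\<^sub>0 q' \<tau>
    by (unfold_locales; fact)
  show ?thesis
    by (rule compactly_embedded)
qed

end
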